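(* Assume that $b,f$ are $\mathbb{F}$-progressively measurable and bounded, $\xi$ is $\mathcal{F}_T$-measurable and bounded, and that $b,f$ are uniformly continuous in $(t,\omega)$ under $\mathbf{d}$ and $\xi$ is uniformly continuous in $\omega$ under $\|\cdot\|$, with a common modulus of continuity function $\rho_0$. Then: (i) For any $0<\varepsilon_1<\varepsilon_2$ there exists $\delta>0$ such that $\mathbb{V}_{\varepsilon_1}(\tilde t,\tilde\omega)\subset\mathbb{V}_{\varepsilon_2}(t,\omega)$ for all $(t,\omega),(\tilde t,\tilde\omega)\in[0,T]\times\Omega$ with $\mathbf{d}((t,\omega),(\tilde t,\tilde\omega))\le\delta$. (ii) If $\mathbf{d}((t_n,\omega^n),(t,\omega))\to0$, then $$\mathbb{V}(t,\omega)=\bigcap_{\varepsilon>0}\Big[\liminf_{n\to\infty}\mathbb{V}_\varepsilon(t_n,\omega^n)\Big]=\bigcap_{\varepsilon>0}\Big[\limsup_{n\to\infty}\mathbb{V}_\varepsilon(t_n,\omega^n)\Big].$$ (iii) Let $(b^n,f^n,\xi^n)$, $n\ge1$, be data of the same type ($b^n,f^n$ progressively measurable and bounded, $\xi^n$ $\mathcal{F}_T$-measurable and bounded), such that, uniformly in $n$ (i.e. with moduli of continuity independent of $n$), $b^n,f^n$ are uniformly continuous in $(t,\omega)$ under $\mathbf{d}$, $\xi^n$ is uniformly continuous in $\omega$ under $\|\cdot\|$, and $b^n,f^n$ are uniformly continuous in $a$. Let $\mathbb{V}^n_\varepsilon(t,\omega)$ be defined as $\mathbb{V}_\varepsilon(t,\omega)$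 but with $(b^n,f^n,\xi^n)$ in place of $(b,f,\xi)$. If $(b^n,f^n,\xi^n)\to(b,f,\xi)$ uniformly, then for every $(t,\omega)\in[0,T]\times\Omega$ $$\mathbb{V}(t,\omega)=\bigcap_{\varepsilon>0}\Big[\liminf_{n\to\infty}\mathbb{V}^n_\varepsilon(t,\omega)\Big]=\bigcap_{\varepsilon>0}\Big[\limsup_{n\to\infty}\mathbb{V}^n_\varepsilon(t,\omega)\Big].$$
   Context: Continuous-time game on canonical space. $\Omega=\{\omega\in C([0,T];\mathbb{R}^d):\omega_0=0\}$, $B_t(\omega)=\omega_t$ the canonical process, $\mathbb{P}_0$ the Wiener measure, $\mathbb{F}=\{\mathcal{F}_t\}_{0\le t\le T}$ the $\mathbb{P}_0$-augmented filtration generated by $B$. $\|\omega\|=\sup_{0\le t\le T}|\omega_t|$ and $\mathbf{d}((t,\omega),(\tilde t,\tilde\omega))=\sqrt{|t-\tilde t|}+\|\omega_{t\wedge\cdot}-\tilde\omega_{\tilde t\wedge\cdot}\|$. There are $N$ players; $A=A_1\times\cdots\times A_N$ is a convex domain in a Euclidean space; $\mathcal{A}=\mathcal{A}_1\times\cdots\times\mathcal{A}_N$ is the set of $\mathbb{F}$-progressively measurable $A$-valued processes. Data: $(b,f):[0,T]\times\Omega\times A\to\mathbb{R}^d\times\mathbb{R}^N$ (jointly measurable in $a$ as well), where $f_i$ depends on $a$ only through $a_i\in A_i$, and $\xi:\Omega\to\mathbb{R}^N$. The modulus $\rho_0$ in $(t,\omega)$ is uniform in $a$. Concatenation: $(\omega\otimes_t\tilde\omega)_s=\omega_s$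 for $s\in[0,t]$ and $=\omega_t+\tilde\omega_{s-t}$ for $s\in[t,T]$. Shifts: $\xi^{t,\omega}(\tilde\omega)=\xi(\omega\otimes_t\tilde\omega)$, and $b^{t,\omega}(s,\tilde\omega,a)=b(t+s,\omega\otimes_t\tilde\omega,a)$, similarly $f^{t,\omega}_i$. For $(t,\omega)\in[0,T]\times\Omega$ and $\alpha\in\mathcal{A}$ define $\frac{d\mathbb{P}^{t,\omega,\alpha}}{d\mathbb{P}_0}=\exp\big(\int_0^{T-t}b^{t,\omega}(s,B,\alpha_s)\cdot dB_s-\frac12\int_0^{T-t}|b^{t,\omega}(s,B,\alpha_s)|^2ds\big)$ and $J_i(t,\omega,\alpha)=\mathbb{E}^{\mathbb{P}^{t,\omega,\alpha}}\big[\xi_i^{t,\omega}(B)+\int_0^{T-t}f_i^{t,\omega}(s,B,\alpha^i_s)ds\big]$, $J=(J_1,\dots,J_N)$. For $\varepsilon>0$, $\alpha^\varepsilon\in\mathcal{A}$ is an $\varepsilon$-equilibrium at $(t,\omega)$, written $\alpha^\varepsilon\in NE_\varepsilon(t,\omega)$, if $J_i(t,\omega,\alpha^\varepsilon)\le J_i(t,\omega,\alpha^{\varepsilon,-i},\alpha^i)+\varepsilon$ for all $i$ and all $\alpha^i\in\mathcal{A}_i$, where $(\alpha^{\varepsilon,-i},\alpha^i)$ is $\alpha^\varepsilon$ with $i$-th component replaced by $\alpha^i$. With $O_\varepsilon(y)=\{\tilde y\in\mathbb{R}^N:|\tilde y-y|<\varepsilon\}$, define $\mathbb{V}_\varepsilon(t,\omega)=\bigcup_{\alpha^\varepsilon\in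 NE_\varepsilon(t,\omega)}O_\varepsilon(J(t,\omega,\alpha^\varepsilon))$ and $\mathbb{V}(t,\omega)=\bigcap_{\varepsilon>0}\mathbb{V}_\varepsilon(t,\omega)$. Set limits: for $D_n\subset\mathbb{R}^N$, $\liminf_{n\to\infty}D_n=\{y\in\mathbb{R}^N:\lim_{n\to\infty}\inf_{y_n\in D_n}|y-y_n|=0\}$ and $\limsup_{n\to\infty}D_n=\{y\in\mathbb{R}^N:\liminf_{n\to\infty}\inf_{y_n\in D_n}|y-y_n|=0\}$ (with $\inf\emptyset=+\infty$). *)

theory Defs
  imports "HOL-Probability.Probability"
begin

section \<open>Canonical space\<close>

text \<open>Paths are extensional functions on \<open>{0..T}\<close> (value \<open>undefined\<close> outside), so that
  equality of elements of the canonical space is equality of paths on \<open>[0,T]\<close>.\<close>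

type_synonym 'd path = "real \<Rightarrow> real ^ 'd"

definition path_space :: "real \<Rightarrow> 'd::finite path set" where
  "path_space T = {\<omega> \<in> extensional {0..T}. continuous_on {0..T} \<omega> \<and> \<omega> 0 = 0}"

definition path_norm :: "real \<Rightarrow> 'd::finite path \<Rightarrow> real" where
  "path_norm T \<omega> = (SUP s\<in>{0..T}. norm (\<omega> s))"

definition path_dist :: "real \<Rightarrow> real \<Rightarrow> 'd::finite path \<Rightarrow> real \<Rightarrow> 'd path \<Rightarrow> real" where
  "path_dist T t \<omega> t' \<omega>' =
     sqrt \<bar>t - t'\<bar> + path_norm T (\<lambda>s. \<omega> (min t s) - \<omega>' (min t' s))"

definition concat_path :: "real \<Rightarrow> real \<Rightarrow> 'd::finite path \<Rightarrow> 'd path \<Rightarrow> 'd path" where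
  "concat_path T t \<omega> \<omega>' = restrict (\<lambda>s. if s \<le> t then \<omega> s else \<omega> t + \<omega>' (s - t)) {0..T}"

text \<open>The unaugmented filtration generated by the canonical process \<open>B s \<omega> = \<omega> s\<close>.\<close>

definition raw_filtration :: "real \<Rightarrow> real \<Rightarrow> 'd::finite path measure" where
  "raw_filtration T t = sigma (path_space T)
     {(\<lambda>\<omega>. \<omega> s) -` S \<inter> path_space T | s S. s \<in> {0..t} \<and> S \<in> sets borel}"

text \<open>Wiener measure on the path space: under \<open>P\<close> the increment over \<open>[s,t]\<close> of the canonical
  process is centred Gaussian with covariance \<open>(t - s)\<close> times the identity and independent
  of the past up to \<open>s\<close>. (The start at 0 is built into the path space.) These properties
  determine \<open>P\<close> uniquely.\<close>

definition wiener_measure :: "real \<Rightarrow> 'd::finite path measure \<Rightarrow> bool" where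
  "wiener_measure T P \<longleftrightarrow>
     prob_space P \<and> sets P = sets (raw_filtration T T) \<and>
     (\<forall>s t. 0 \<le> s \<longrightarrow> s < t \<longrightarrow> t \<le> T \<longrightarrow>
        distributed P lborel (\<lambda>\<omega>. \<omega> t - \<omega> s)
          (\<lambda>x. ennreal (\<Prod>j\<in>UNIV. normal_density 0 (sqrt (t - s)) (x $ j))) \<and>
        prob_space.indep_set P (sets (raw_filtration T s))
          (sets (vimage_algebra (path_space T) (\<lambda>\<omega>. \<omega> t - \<omega> s) borel)))"

text \<open>The null sets of the completion are exactly the subsets of the \<open>P\<close>-null sets, so this is
  the \<open>P\<close>-augmentation of the raw filtration. Expectations are accordingly taken under
  \<open>completion P\<close>, which is the extension of \<open>P\<close> to the augmented sigma-algebra at time \<open>T\<close>.\<close>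

definition aug_filtration :: "real \<Rightarrow> 'd::finite path measure \<Rightarrow> real \<Rightarrow> 'd path measure" where
  "aug_filtration T P t =
     sigma (path_space T) (sets (raw_filtration T t) \<union> null_sets (completion P))"

definition prog_measurable ::
  "real \<Rightarrow> 'd::finite path measure \<Rightarrow> 'x measure \<Rightarrow> (real \<Rightarrow> 'd path \<Rightarrow> 'x) set" where
  "prog_measurable T P M = {X. \<forall>t\<in>{0..T}.
     (\<lambda>(s, \<omega>). X s \<omega>) \<in> measurable (restrict_space borel {0..t} \<Otimes>\<^sub>M aug_filtration T P t) M}"

section \<open>Ito integral over \<open>[0,T]\<close>\<close>

text \<open>A simple process is given by \<open>m\<close>, a grid \<open>\<tau> 0 < \<dots> < \<tau> m\<close> and coefficients \<open>\<eta> j\<close> on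
  \<open>(\<tau> j, \<tau> (Suc j)]\<close>.\<close>

definition simple_process ::
  "real \<Rightarrow> 'd::finite path measure \<Rightarrow> nat \<Rightarrow> (nat \<Rightarrow> real) \<Rightarrow> (nat \<Rightarrow> 'd path \<Rightarrow> real ^ 'd) \<Rightarrow> bool"
where
  "simple_process T P m \<tau> \<eta> \<longleftrightarrow>
     \<tau> 0 = 0 \<and> \<tau> m = T \<and> (\<forall>j<m. \<tau> j < \<tau> (Suc j)) \<and>
     (\<forall>j<m. \<eta> j \<in> borel_measurable (aug_filtration T P (\<tau> j)) \<and> bounded (\<eta> j ` path_space T))"

definition simple_value ::
  "nat \<Rightarrow> (nat \<Rightarrow> real) \<Rightarrow> (nat \<Rightarrow> 'd::finite path \<Rightarrow> real ^ 'd) \<Rightarrow> real \<Rightarrow> 'd path \<Rightarrow> real ^ 'd" where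
  "simple_value m \<tau> \<eta> s \<omega> = (\<Sum>j<m. indicator {\<tau> j<..\<tau> (Suc j)} s *\<^sub>R \<eta> j \<omega>)"

definition simple_integral ::
  "nat \<Rightarrow> (nat \<Rightarrow> real) \<Rightarrow> (nat \<Rightarrow> 'd::finite path \<Rightarrow> real ^ 'd) \<Rightarrow> 'd path \<Rightarrow> real" where
  "simple_integral m \<tau> \<eta> \<omega> = (\<Sum>j<m. \<eta> j \<omega> \<bullet> (\<omega> (\<tau> (Suc j)) - \<omega> (\<tau> j)))"

text \<open>\<open>Y\<close> is a version of the integral of \<open>X\<close> against the canonical process: it is the
  mean-square limit of the integrals of simple processes converging to \<open>X\<close> in
  \<open>L\<^sup>2(dt \<otimes> dP)\<close>. By the Ito isometry \<open>Y\<close> is unique up to null sets and does not depend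
  on the approximating sequence.\<close>

definition is_ito_integral ::
  "real \<Rightarrow> 'd::finite path measure \<Rightarrow> (real \<Rightarrow> 'd path \<Rightarrow> real ^ 'd) \<Rightarrow> ('d path \<Rightarrow> real) \<Rightarrow> bool" where
  "is_ito_integral T P X Y \<longleftrightarrow>
     Y \<in> borel_measurable (aug_filtration T P T) \<and>
     (\<exists>m \<tau> \<eta>. (\<forall>k. simple_process T P (m k) (\<tau> k) (\<eta> k)) \<and>
        (\<lambda>k. \<integral>\<^sup>+\<omega>. (\<integral>\<^sup>+s\<in>{0..T}. ennreal ((norm (simple_value (m k) (\<tau> k) (\<eta> k) s \<omega> - X s \<omega>))\<^sup>2) \<partial>lborel)
               \<partial>completion P) \<longlonglongrightarrow> 0 \<and>
        (\<lambda>k. \<integral>\<^sup>+\<omega>. ennreal ((simple_integral (m k) (\<tau> k) (\<eta> k) \<omega> - Y \<omega>)\<^sup>2) \<partial>completion P) \<longlonglongrightarrow> 0)"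

definition ito_integral ::
  "real \<Rightarrow> 'd::finite path measure \<Rightarrow> (real \<Rightarrow> 'd path \<Rightarrow> real ^ 'd) \<Rightarrow> 'd path \<Rightarrow> real" where
  "ito_integral T P X = (SOME Y. is_ito_integral T P X Y)"

section \<open>The game\<close>

text \<open>Players are the elements of the finite type \<open>'n\<close>. The action sets \<open>A i\<close> are subsets of
  one Euclidean space \<open>'a\<close>; action spaces of different dimensions are embedded in it.\<close>

definition action_set :: "('n \<Rightarrow> 'a::euclidean_space set) \<Rightarrow> ('a ^ 'n::finite) set" where
  "action_set A = {a. \<forall>i. a $ i \<in> A i}"

text \<open>Measurability into \<open>restrict_space borel (A i)\<close> includes that the process takes its values
  in \<open>A i\<close>.\<close>

definition player_controls ::
  "real \<Rightarrow> 'd::finite path measure \<Rightarrow> ('n \<Rightarrow> 'a::euclidean_space set) \<Rightarrow> 'n \<Rightarrow>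
   (real \<Rightarrow> 'd path \<Rightarrow> 'a) set" where
  "player_controls T P A i = prog_measurable T P (restrict_space borel (A i))"

definition controls ::
  "real \<Rightarrow> 'd::finite path measure \<Rightarrow> ('n::finite \<Rightarrow> 'a::euclidean_space set) \<Rightarrow>
   (real \<Rightarrow> 'd path \<Rightarrow> 'a ^ 'n) set" where
  "controls T P A = {\<alpha>. \<forall>i. (\<lambda>s \<omega>. \<alpha> s \<omega> $ i) \<in> player_controls T P A i}"

definition replace_control ::
  "(real \<Rightarrow> 'd::finite path \<Rightarrow> 'a ^ 'n::finite) \<Rightarrow> 'n \<Rightarrow> (real \<Rightarrow> 'd path \<Rightarrow> 'a) \<Rightarrow>
   real \<Rightarrow> 'd path \<Rightarrow> 'a ^ 'n" where
  "replace_control \<alpha> i \<beta> s \<omega> = (\<chi> j. if j = i then \<beta> s \<omega> else \<alpha> s \<omega> $ j)"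

text \<open>The drift shifted by \<open>(t,\<omega>)\<close> and evaluated along \<open>\<alpha>\<close>, set to 0 for \<open>s > T - t\<close>,
  so that its integrals over \<open>[0,T]\<close> are the integrals over \<open>[0,T-t]\<close>.\<close>

definition shifted_drift ::
  "real \<Rightarrow> (real \<Rightarrow> 'd::finite path \<Rightarrow> 'x \<Rightarrow> real ^ 'd) \<Rightarrow> real \<Rightarrow> 'd path \<Rightarrow>
   (real \<Rightarrow> 'd path \<Rightarrow> 'x) \<Rightarrow> real \<Rightarrow> 'd path \<Rightarrow> real ^ 'd" where
  "shifted_drift T b t \<omega> \<alpha> s \<omega>' =
     indicator {0..T - t} s *\<^sub>R b (t + s) (concat_path T t \<omega> \<omega>') (\<alpha> s \<omega>')"

definition controlled_measure ::
  "real \<Rightarrow> 'd::finite path measure \<Rightarrow> (real \<Rightarrow> 'd path \<Rightarrow> 'x \<Rightarrow> real ^ 'd) \<Rightarrow> real \<Rightarrow> 'd path \<Rightarrow>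
   (real \<Rightarrow> 'd path \<Rightarrow> 'x) \<Rightarrow> 'd path measure" where
  "controlled_measure T P b t \<omega> \<alpha> = density (completion P) (\<lambda>\<omega>'. ennreal (exp
     (ito_integral T P (shifted_drift T b t \<omega> \<alpha>) \<omega>'
        - (1/2) * (LBINT s:{0..T}. (norm (shifted_drift T b t \<omega> \<alpha> s \<omega>'))\<^sup>2))))"

definition game_cost ::
  "real \<Rightarrow> 'd::finite path measure \<Rightarrow> (real \<Rightarrow> 'd path \<Rightarrow> 'x \<Rightarrow> real ^ 'd) \<Rightarrow>
   (real \<Rightarrow> 'd path \<Rightarrow> 'x \<Rightarrow> real ^ 'n::finite) \<Rightarrow> ('d path \<Rightarrow> real ^ 'n) \<Rightarrow>
   real \<Rightarrow> 'd path \<Rightarrow> (real \<Rightarrow> 'd path \<Rightarrow> 'x) \<Rightarrow> real ^ 'n" where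
  "game_cost T P b f \<xi> t \<omega> \<alpha> = (\<chi> i.
     integral\<^sup>L (controlled_measure T P b t \<omega> \<alpha>) (\<lambda>\<omega>'.
       \<xi> (concat_path T t \<omega> \<omega>') $ i
         + (LBINT s:{0..T - t}. f (t + s) (concat_path T t \<omega> \<omega>') (\<alpha> s \<omega>') $ i)))"

definition eps_equilibria ::
  "real \<Rightarrow> 'd::finite path measure \<Rightarrow> ('n::finite \<Rightarrow> 'a::euclidean_space set) \<Rightarrow>
   (real \<Rightarrow> 'd path \<Rightarrow> 'a ^ 'n \<Rightarrow> real ^ 'd) \<Rightarrow> (real \<Rightarrow> 'd path \<Rightarrow> 'a ^ 'n \<Rightarrow> real ^ 'n) \<Rightarrow>
   ('d path \<Rightarrow> real ^ 'n) \<Rightarrow> real \<Rightarrow> real \<Rightarrow> 'd path \<Rightarrow> (real \<Rightarrow> 'd path \<Rightarrow> 'a ^ 'n) set" where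
  "eps_equilibria T P A b f \<xi> \<epsilon> t \<omega> = {\<alpha> \<in> controls T P A.
     \<forall>i. \<forall>\<beta>\<in>player_controls T P A i.
       game_cost T P b f \<xi> t \<omega> \<alpha> $ i \<le> game_cost T P b f \<xi> t \<omega> (replace_control \<alpha> i \<beta>) $ i + \<epsilon>}"

definition set_value_eps ::
  "real \<Rightarrow> 'd::finite path measure \<Rightarrow> ('n::finite \<Rightarrow> 'a::euclidean_space set) \<Rightarrow>
   (real \<Rightarrow> 'd path \<Rightarrow> 'a ^ 'n \<Rightarrow> real ^ 'd) \<Rightarrow> (real \<Rightarrow> 'd path \<Rightarrow> 'a ^ 'n \<Rightarrow> real ^ 'n) \<Rightarrow>
   ('d path \<Rightarrow> real ^ 'n) \<Rightarrow> real \<Rightarrow> real \<Rightarrow> 'd path \<Rightarrow> (real ^ 'n) set" where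
  "set_value_eps T P A b f \<xi> \<epsilon> t \<omega> =
     (\<Union>\<alpha>\<in>eps_equilibria T P A b f \<xi> \<epsilon> t \<omega>. ball (game_cost T P b f \<xi> t \<omega> \<alpha>) \<epsilon>)"

definition set_value ::
  "real \<Rightarrow> 'd::finite path measure \<Rightarrow> ('n::finite \<Rightarrow> 'a::euclidean_space set) \<Rightarrow>
   (real \<Rightarrow> 'd path \<Rightarrow> 'a ^ 'n \<Rightarrow> real ^ 'd) \<Rightarrow> (real \<Rightarrow> 'd path \<Rightarrow> 'a ^ 'n \<Rightarrow> real ^ 'n) \<Rightarrow>
   ('d path \<Rightarrow> real ^ 'n) \<Rightarrow> real \<Rightarrow> 'd path \<Rightarrow> (real ^ 'n) set" where
  "set_value T P A b f \<xi> t \<omega> = (\<Inter>\<epsilon>\<in>{0<..}. set_value_eps T P A b f \<xi> \<epsilon> t \<omega>)"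

section \<open>Set limits\<close>

text \<open>The infima are taken in the extended reals, where the infimum over the empty set is
  \<open>\<infinity>\<close> (the library's \<open>infdist\<close> would give 0).\<close>

definition set_liminf :: "(nat \<Rightarrow> 'y::metric_space set) \<Rightarrow> 'y set" where
  "set_liminf D = {y. (\<lambda>n. INF z\<in>D n. ereal (dist y z)) \<longlonglongrightarrow> 0}"

definition set_limsup :: "(nat \<Rightarrow> 'y::metric_space set) \<Rightarrow> 'y set" where
  "set_limsup D = {y. liminf (\<lambda>n. INF z\<in>D n. ereal (dist y z)) = 0}"

section \<open>Conditions on the data\<close>

definition modulus_of_continuity :: "(real \<Rightarrow> real) \<Rightarrow> bool" where
  "modulus_of_continuity \<rho> \<longleftrightarrow> mono_on {0..} \<rho> \<and> \<rho> 0 = 0 \<and> (\<rho> \<longlongrightarrow> 0) (at_right 0)"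

definition game_data ::
  "real \<Rightarrow> 'd::finite path measure \<Rightarrow> ('n::finite \<Rightarrow> 'a::euclidean_space set) \<Rightarrow>
   (real \<Rightarrow> 'd path \<Rightarrow> 'a ^ 'n \<Rightarrow> real ^ 'd) \<Rightarrow> (real \<Rightarrow> 'd path \<Rightarrow> 'a ^ 'n \<Rightarrow> real ^ 'n) \<Rightarrow>
   ('d path \<Rightarrow> real ^ 'n) \<Rightarrow> bool" where
  "game_data T P A b f \<xi> \<longleftrightarrow>
     (\<forall>t\<in>{0..T}.
        (\<lambda>((s, \<omega>), a). b s \<omega> a) \<in> borel_measurable
          ((restrict_space borel {0..t} \<Otimes>\<^sub>M aug_filtration T P t) \<Otimes>\<^sub>M restrict_space borel (action_set A)) \<and>
        (\<lambda>((s, \<omega>), a). f s \<omega> a) \<in> borel_measurable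
          ((restrict_space borel {0..t} \<Otimes>\<^sub>M aug_filtration T P t) \<Otimes>\<^sub>M restrict_space borel (action_set A))) \<and>
     \<xi> \<in> borel_measurable (aug_filtration T P T) \<and>
     bounded ((\<lambda>(s, \<omega>, a). b s \<omega> a) ` ({0..T} \<times> path_space T \<times> action_set A)) \<and>
     bounded ((\<lambda>(s, \<omega>, a). f s \<omega> a) ` ({0..T} \<times> path_space T \<times> action_set A)) \<and>
     bounded (\<xi> ` path_space T) \<and>
     (\<forall>s\<in>{0..T}. \<forall>\<omega>\<in>path_space T. \<forall>a\<in>action_set A. \<forall>a'\<in>action_set A. \<forall>i.
        a $ i = a' $ i \<longrightarrow> f s \<omega> a $ i = f s \<omega> a' $ i)"

text \<open>Continuity of \<open>b, f\<close> in \<open>(t,\<omega>)\<close>, uniformly in the action, and of \<open>\<xi>\<close> in \<open>\<omega>\<close>.\<close>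

definition state_modulus ::
  "real \<Rightarrow> ('n::finite \<Rightarrow> 'a::euclidean_space set) \<Rightarrow>
   (real \<Rightarrow> 'd::finite path \<Rightarrow> 'a ^ 'n \<Rightarrow> real ^ 'd) \<Rightarrow> (real \<Rightarrow> 'd path \<Rightarrow> 'a ^ 'n \<Rightarrow> real ^ 'n) \<Rightarrow>
   ('d path \<Rightarrow> real ^ 'n) \<Rightarrow> (real \<Rightarrow> real) \<Rightarrow> bool" where
  "state_modulus T A b f \<xi> \<rho> \<longleftrightarrow>
     (\<forall>t\<in>{0..T}. \<forall>t'\<in>{0..T}. \<forall>\<omega>\<in>path_space T. \<forall>\<omega>'\<in>path_space T. \<forall>a\<in>action_set A.
        norm (b t \<omega> a - b t' \<omega>' a) \<le> \<rho> (path_dist T t \<omega> t' \<omega>') \<and>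
        norm (f t \<omega> a - f t' \<omega>' a) \<le> \<rho> (path_dist T t \<omega> t' \<omega>')) \<and>
     (\<forall>\<omega>\<in>path_space T. \<forall>\<omega>'\<in>path_space T.
        norm (\<xi> \<omega> - \<xi> \<omega>') \<le> \<rho> (path_norm T (\<lambda>s. \<omega> s - \<omega>' s)))"

definition action_modulus ::
  "real \<Rightarrow> ('n::finite \<Rightarrow> 'a::euclidean_space set) \<Rightarrow>
   (real \<Rightarrow> 'd::finite path \<Rightarrow> 'a ^ 'n \<Rightarrow> real ^ 'd) \<Rightarrow> (real \<Rightarrow> 'd path \<Rightarrow> 'a ^ 'n \<Rightarrow> real ^ 'n) \<Rightarrow>
   (real \<Rightarrow> real) \<Rightarrow> bool" where
  "action_modulus T A b f \<rho> \<longleftrightarrow>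
     (\<forall>t\<in>{0..T}. \<forall>\<omega>\<in>path_space T. \<forall>a\<in>action_set A. \<forall>a'\<in>action_set A.
        norm (b t \<omega> a - b t \<omega> a') \<le> \<rho> (dist a a') \<and> norm (f t \<omega> a - f t \<omega> a') \<le> \<rho> (dist a a'))"

end

theory Submission
  imports Defs
begin

text \<open>The costs \<open>J\<^sub>i(t,\<omega>,\<alpha>)\<close> depend continuously on \<open>(t,\<omega>)\<close> and on the data, uniformly in the
  control \<open>\<alpha>\<close>; every claim follows from this by enlarging \<open>\<epsilon>\<close>. The uniformity comes from the
  density \<open>exp(\<integral>\<beta>\<sqdot>dB - 1/2 \<integral>|\<beta>|\<^sup>2 ds)\<close>: its second moment is bounded in terms of the bound of the
  drift \<open>\<beta>\<close>, and the Ito isometry (needed only up to a constant) bounds the distance of two densities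
  by the \<open>L\<^sup>2\<close> distance of the drifts. For two base
  points the drifts differ by at most the modulus of continuity evaluated at the distance of the base
  points plus the oscillation of the Brownian path over the time lag; this does not involve the
  control and is small with probability close to one.\<close>

section \<open>Gaussian integrals\<close>

text \<open>An equilibrium quantifies over all deviations, so costs have to be compared at a rate
  that no control can influence. The comparison keeps a control as one fixed functional of the
  driving path and moves only the base point: both drifts are then evaluated at the same action.
  What this leaves over is the horizon. For two starting times \<open>t\<close> and
  \<open>t'\<close> one drift has already been switched off at \<open>T - t\<close> while the other
  still runs up to \<open>T - t'\<close>. This strip of times, of length
  \<open>\<bar>t - t'\<bar>\<close>, and the event of paths with a large oscillation are the two
  exceptional sets of the estimates; on them only trivial bounds are available, and their measure is
  made small.

  The Ito integral is an arbitrarily chosen version of a mean-square limit. Its exponential moments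
  therefore come from simple integrals through Fatou's lemma and are carried to the chosen version
  by uniqueness up to null sets. The estimates are carried out with nonnegative integrals in
  \<open>ennreal\<close>, where mixed terms of indefinite sign are removed by symmetry of the
  Gaussian law.\<close>

definition gaussian :: "real \<Rightarrow> (real ^ 'd::finite) measure" where
  "gaussian h = density lborel (\<lambda>x. ennreal (\<Prod>j\<in>UNIV. normal_density 0 (sqrt h) (x $ j)))"

lemma sets_gaussian[measurable_cong, simp]: "sets (gaussian h) = sets borel"
  by (simp add: gaussian_def)

lemma space_gaussian[simp]: "space (gaussian h) = UNIV"
  by (simp add: gaussian_def)

text \<open>The product formula for \<open>lborel\<close> runs over \<open>Basis\<close>; for
  \<open>real ^ 'd\<close> the basis vectors are the \<open>axis j 1\<close>, and the index
  \<open>j\<close> is recovered by inverting this injection.\<close>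

lemma nn_integral_lborel_prod_vec:
  fixes f :: "'d::finite \<Rightarrow> real \<Rightarrow> ennreal"
  assumes [measurable]: "\<And>j. f j \<in> borel_measurable borel"
  shows "(\<integral>\<^sup>+x. (\<Prod>j\<in>UNIV. f j (x $ j)) \<partial>lborel) = (\<Prod>j\<in>UNIV. \<integral>\<^sup>+x. f j x \<partial>lborel)"
proof -
  have inj: "inj (\<lambda>j::'d. axis j (1::real))" by (auto simp: inj_on_def axis_eq_axis)
  have B: "(Basis :: (real^'d) set) = range (\<lambda>j. axis j 1)" by (auto simp: Basis_vec_def)
  define g where "g = (\<lambda>b. f (inv (\<lambda>j::'d. axis j (1::real)) b))"
  have g: "g (axis j 1) = f j" for j by (simp add: g_def inv_f_f[OF inj])
  have 1: "(\<Prod>j\<in>UNIV. f j (x $ j)) = (\<Prod>b\<in>Basis. g b (x \<bullet> b))" for x :: "real^'d"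
    unfolding B by (subst prod.reindex[OF inj]) (simp add: g inner_axis)
  have 2: "(\<Prod>j\<in>UNIV. \<integral>\<^sup>+x. f j x \<partial>lborel) = (\<Prod>b\<in>(Basis :: (real^'d) set). \<integral>\<^sup>+x. g b x \<partial>lborel)"
    unfolding B by (subst prod.reindex[OF inj]) (simp add: g)
  show ?thesis unfolding 1 2
    by (rule nn_integral_lborel_prod) (auto simp: g_def)
qed

text \<open>The density is itself a product over coordinates and can be merged with the integrand
  factor by factor. The moments below thereby reduce to one dimension.\<close>

lemma nn_integral_gaussian_prod:
  fixes f :: "'d::finite \<Rightarrow> real \<Rightarrow> ennreal"
  assumes [measurable]: "\<And>j. f j \<in> borel_measurable borel"
  shows "(\<integral>\<^sup>+x. (\<Prod>j\<in>UNIV. f j (x $ j)) \<partial>gaussian h) =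
    (\<Prod>j\<in>UNIV. \<integral>\<^sup>+x. ennreal (normal_density 0 (sqrt h) x) * f j x \<partial>lborel)"
proof -
  have "(\<integral>\<^sup>+x. (\<Prod>j\<in>UNIV. f j (x $ j)) \<partial>gaussian h) =
     (\<integral>\<^sup>+x. (\<Prod>j\<in>UNIV. ennreal (normal_density 0 (sqrt h) (x $ j)) * f j (x $ j)) \<partial>lborel)"
    unfolding gaussian_def
    by (subst nn_integral_density)
      (auto simp: prod.distrib prod_ennreal[symmetric] intro!: borel_measurable_prod_ennreal)
  also have "\<dots> = (\<Prod>j\<in>UNIV. \<integral>\<^sup>+x. ennreal (normal_density 0 (sqrt h) x) * f j x \<partial>lborel)"
    by (rule nn_integral_lborel_prod_vec) measurable
  finally show ?thesis .
qed

lemma nn_integral_normal_density: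
  assumes "0 < \<sigma>" shows "(\<integral>\<^sup>+x. ennreal (normal_density \<mu> \<sigma> x) \<partial>lborel) = 1"
  using prob_space.emeasure_space_1[OF prob_space_normal_density[OF assms, of \<mu>]]
  by (simp add: emeasure_density)

lemma prob_space_gaussian:
  assumes "0 < h" shows "prob_space (gaussian h :: (real^'d::finite) measure)"
proof
  have "emeasure (gaussian h :: (real^'d) measure) (space (gaussian h :: (real^'d) measure))
      = (\<integral>\<^sup>+x. (\<Prod>j\<in>(UNIV::'d set). (\<lambda>_ _. 1) j (x $ j)) \<partial>gaussian h)"
    by simp
  also have "\<dots> = 1"
    using assms by (subst nn_integral_gaussian_prod) (auto simp: nn_integral_normal_density)
  finally show "emeasure (gaussian h :: (real^'d) measure) (space (gaussian h :: (real^'d) measure)) = 1" .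
qed

text \<open>Completing the square: tilting the centred normal density by \<open>exp (a * x)\<close>
  gives \<open>exp (h * a\<^sup>2 / 2)\<close> times the normal density with mean
  \<open>h * a\<close>, whose total mass is 1.\<close>

lemma nn_integral_normal_exp:
  assumes h: "0 < h"
  shows "(\<integral>\<^sup>+x. ennreal (normal_density 0 (sqrt h) x) * ennreal (exp (a * x)) \<partial>lborel)
    = ennreal (exp (h * a\<^sup>2 / 2))"
proof -
  have "normal_density 0 (sqrt h) x * exp (a * x) = exp (h * a\<^sup>2 / 2) * normal_density (h * a) (sqrt h) x" for x
  proof -
    have "-(x - 0)\<^sup>2 / (2 * h) + a * x = h * a\<^sup>2 / 2 + (-(x - h * a)\<^sup>2 / (2 * h))"
      using h by (simp add: field_simps power2_eq_square)
    then show ?thesis using h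
      by (simp add: normal_density_def mult_exp_exp)
  qed
  then have "(\<integral>\<^sup>+x. ennreal (normal_density 0 (sqrt h) x) * ennreal (exp (a * x)) \<partial>lborel)
    = (\<integral>\<^sup>+x. ennreal (exp (h * a\<^sup>2 / 2)) * ennreal (normal_density (h * a) (sqrt h) x) \<partial>lborel)"
    by (intro nn_integral_cong) (simp add: ennreal_mult[symmetric])
  also have "\<dots> = ennreal (exp (h * a\<^sup>2 / 2))"
    using h by (simp add: nn_integral_cmult nn_integral_normal_density)
  finally show ?thesis .
qed

lemma nn_integral_normal_square:
  assumes h: "0 < h"
  shows "(\<integral>\<^sup>+x. ennreal (normal_density 0 (sqrt h) x) * ennreal (x\<^sup>2) \<partial>lborel) = ennreal h"
proof -
  have "has_bochner_integral lborel (\<lambda>x. normal_density 0 (sqrt h) x * x\<^sup>2) h"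
    using normal_moment_even[of "sqrt h" 0 1] h by (simp add: fact_numeral)
  then show ?thesis
    by (simp add: ennreal_mult[symmetric] has_bochner_integral_iff nn_integral_eq_integral)
qed

lemma gaussian_exp:
  fixes e :: "real^'d::finite"
  assumes h: "0 < h"
  shows "(\<integral>\<^sup>+x. ennreal (exp (e \<bullet> x)) \<partial>gaussian h) = ennreal (exp (h * (norm e)\<^sup>2 / 2))"
proof -
  have "(\<integral>\<^sup>+x. ennreal (exp (e \<bullet> x)) \<partial>gaussian h)
     = (\<integral>\<^sup>+x. (\<Prod>j\<in>(UNIV::'d set). (\<lambda>j y. ennreal (exp (e $ j * y))) j (x $ j)) \<partial>gaussian h)"
    by (simp add: inner_vec_def exp_sum prod_ennreal)
  also have "\<dots> = (\<Prod>j\<in>(UNIV::'d set). ennreal (exp (h * (e $ j)\<^sup>2 / 2)))"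
    using h by (subst nn_integral_gaussian_prod) (auto simp: nn_integral_normal_exp)
  also have "\<dots> = ennreal (exp (h * (norm e)\<^sup>2 / 2))"
    by (simp add: prod_ennreal exp_sum[symmetric] norm_vec_def L2_set_def sum_nonneg
        sum_divide_distrib sum_distrib_left)
  finally show ?thesis .
qed

text \<open>A single squared coordinate is a product whose other factors are 1, and those integrate
  to total mass 1.\<close>

lemma gaussian_component_square:
  assumes h: "0 < h"
  shows "(\<integral>\<^sup>+x. ennreal (((x :: real^'d::finite) $ i)\<^sup>2) \<partial>gaussian h) = ennreal h"
proof -
  have "(\<integral>\<^sup>+x. ennreal (((x :: real^'d::finite) $ i)\<^sup>2) \<partial>gaussian h)
     = (\<integral>\<^sup>+x. (\<Prod>j\<in>(UNIV::'d set). (\<lambda>j y. if j = i then ennreal (y\<^sup>2) else 1) j (x $ j)) \<partial>gaussian h)"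
    by (simp add: prod.delta)
  also have "\<dots> = (\<Prod>j\<in>(UNIV::'d set). \<integral>\<^sup>+y. ennreal (normal_density 0 (sqrt h) y) *
      (if j = i then ennreal (y\<^sup>2) else 1) \<partial>lborel)"
    by (rule nn_integral_gaussian_prod) auto
  also have "\<dots> = (\<Prod>j\<in>(UNIV::'d set). if j = i then ennreal h else 1)"
  proof (rule prod.cong)
    show "(\<integral>\<^sup>+y. ennreal (normal_density 0 (sqrt h) y) * (if j = i then ennreal (y\<^sup>2) else 1) \<partial>lborel)
      = (if j = i then ennreal h else 1)" for j
      using h by (cases "j = i") (simp_all add: nn_integral_normal_density nn_integral_normal_square)
  qed simp
  also have "\<dots> = ennreal h" by (simp add: prod.delta)
  finally show ?thesis .
qed

lemma gaussian_norm_square: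
  assumes h: "0 < h"
  shows "(\<integral>\<^sup>+x. ennreal ((norm (x :: real^'d::finite))\<^sup>2) \<partial>gaussian h) = ennreal (real CARD('d) * h)"
proof -
  have "(\<integral>\<^sup>+x. ennreal ((norm (x :: real^'d::finite))\<^sup>2) \<partial>gaussian h)
    = (\<integral>\<^sup>+x. (\<Sum>i\<in>(UNIV::'d set). ennreal ((x $ i)\<^sup>2)) \<partial>gaussian h)"
    by (simp add: norm_vec_def L2_set_def sum_nonneg sum_ennreal)
  also have "\<dots> = (\<Sum>i\<in>(UNIV::'d set). ennreal h)"
    by (subst nn_integral_sum) (auto simp: gaussian_component_square[OF h])
  also have "\<dots> = ennreal (real CARD('d) * h)"
    using h by (simp add: ennreal_mult ennreal_of_nat_eq_real_of_nat)
  finally show ?thesis .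
qed

text \<open>The symmetry that later removes the term linear in the increment without ever
  integrating a function of changing sign.\<close>

lemma gaussian_uminus:
  assumes [measurable]: "g \<in> borel_measurable (borel :: (real^'d::finite) measure)"
  shows "(\<integral>\<^sup>+x. g (- x) \<partial>gaussian h) = (\<integral>\<^sup>+x. g x \<partial>gaussian h)"
proof -
  let ?n = "\<lambda>x::real^'d. ennreal (\<Prod>j\<in>UNIV. normal_density 0 (sqrt h) (x $ j))"
  have "(lborel :: (real^'d) measure) = density (distr lborel borel uminus) (\<lambda>_. 1)"
    using lborel_affine[of "-1" "0::real^'d"] by simp
  then have l: "(lborel :: (real^'d) measure) = distr lborel borel uminus"
    by (simp add: density_1)
  have "(\<integral>\<^sup>+x. g x \<partial>gaussian h) = (\<integral>\<^sup>+x. ?n x * g x \<partial>lborel)"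
    by (simp add: gaussian_def nn_integral_density)
  also have "\<dots> = (\<integral>\<^sup>+x. ?n (-x) * g (-x) \<partial>lborel)"
    by (subst l) (simp add: nn_integral_distr)
  also have "\<dots> = (\<integral>\<^sup>+x. ?n x * g (-x) \<partial>lborel)"
    by (simp add: normal_density_def)
  also have "\<dots> = (\<integral>\<^sup>+x. g (- x) \<partial>gaussian h)"
    by (simp add: gaussian_def nn_integral_density)
  finally show ?thesis by simp
qed

text \<open>Averaging the integrand over \<open>x\<close> and \<open>-x\<close> cancels the mixed
  term \<open>2 * z * (e \<bullet> x)\<close> pointwise. Cauchy-Schwarz then replaces
  \<open>(e \<bullet> x)\<^sup>2\<close> by \<open>(norm e)\<^sup>2 * (norm x)\<^sup>2\<close>,
  which is where the factor \<open>CARD('d)\<close> comes from.\<close>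

lemma gaussian_shift_square:
  fixes e :: "real^'d::finite" and z h :: real
  assumes h: "0 < h"
  shows "(\<integral>\<^sup>+x. ennreal ((z + e \<bullet> x)\<^sup>2) \<partial>gaussian h) \<le> ennreal (z\<^sup>2 + CARD('d) * h * (norm e)\<^sup>2)"
proof -
  interpret prob_space "gaussian h :: (real^'d) measure" by (rule prob_space_gaussian[OF h])
  let ?I = "\<integral>\<^sup>+x. ennreal ((z + e \<bullet> x)\<^sup>2) \<partial>gaussian h"
  have "2 * ?I = ?I + (\<integral>\<^sup>+x. ennreal ((z - e \<bullet> x)\<^sup>2) \<partial>gaussian h)"
    using gaussian_uminus[of "\<lambda>x. ennreal ((z + e \<bullet> x)\<^sup>2)" h] by (simp add: mult_2)
  also have "\<dots> = (\<integral>\<^sup>+x. ennreal ((z + e \<bullet> x)\<^sup>2) + ennreal ((z - e \<bullet> x)\<^sup>2) \<partial>gaussian h)"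
    by (rule nn_integral_add[symmetric]) auto
  also have "\<dots> \<le> (\<integral>\<^sup>+x. ennreal (2 * z\<^sup>2) + ennreal (2 * (norm e)\<^sup>2) * ennreal ((norm (x :: real^'d))\<^sup>2) \<partial>gaussian h)"
  proof (intro nn_integral_mono)
    fix x :: "real^'d"
    have "(e \<bullet> x)\<^sup>2 \<le> (norm e * norm x)\<^sup>2"
      using Cauchy_Schwarz_ineq2[of e x] by (metis abs_ge_zero power2_abs power_mono)
    then have "(z + e \<bullet> x)\<^sup>2 + (z - e \<bullet> x)\<^sup>2 \<le> 2 * z\<^sup>2 + (2 * (norm e)\<^sup>2) * (norm x)\<^sup>2"
      by (simp add: power_mult_distrib power2_sum power2_diff)
    then show "ennreal ((z + e \<bullet> x)\<^sup>2) + ennreal ((z - e \<bullet> x)\<^sup>2)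
        \<le> ennreal (2 * z\<^sup>2) + ennreal (2 * (norm e)\<^sup>2) * ennreal ((norm x)\<^sup>2)"
      by (simp add: ennreal_plus[symmetric] ennreal_mult[symmetric] ennreal_leI del: ennreal_plus)
  qed
  also have "\<dots> = ennreal (2 * z\<^sup>2) + ennreal (2 * (norm e)\<^sup>2) * ennreal (CARD('d) * h)"
    by (subst nn_integral_add) (auto simp: nn_integral_cmult gaussian_norm_square[OF h] emeasure_space_1[simplified])
  also have "\<dots> = 2 * ennreal (z\<^sup>2 + CARD('d) * h * (norm e)\<^sup>2)"
    using h by (simp add: ennreal_plus[symmetric] ennreal_mult[symmetric] ennreal_leI algebra_simps
        ennreal_numeral[symmetric] del: ennreal_plus ennreal_numeral)
  finally show ?thesis
    by (subst (asm) ennreal_mult_le_mult_iff) auto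
qed

section \<open>The augmented filtration\<close>

lemma space_raw_filtration[simp]: "space (raw_filtration T t) = path_space T"
  unfolding raw_filtration_def by (intro space_measure_of) auto

lemma sets_raw_filtration:
  "sets (raw_filtration T t) = sigma_sets (path_space T)
     {(\<lambda>\<omega>. \<omega> s) -` S \<inter> path_space T | s S. s \<in> {0..t} \<and> S \<in> sets borel}"
  unfolding raw_filtration_def by (intro sets_measure_of) auto

lemma sets_raw_filtration_mono:
  assumes "s \<le> t" shows "sets (raw_filtration T s) \<subseteq> sets (raw_filtration T t)"
  unfolding sets_raw_filtration using assms by (intro sigma_sets_mono') fastforce

lemma measurable_eval_raw:
  assumes "0 \<le> s" "s \<le> t"
  shows "(\<lambda>\<omega>. \<omega> s) \<in> borel_measurable (raw_filtration T t)"
proof (rule measurableI)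
  fix S :: "(real^'a) set" assume "S \<in> sets borel"
  then show "(\<lambda>\<omega>. \<omega> s) -` S \<inter> space (raw_filtration T t) \<in> sets (raw_filtration T t)"
    unfolding sets_raw_filtration using assms by (auto intro!: sigma_sets.Basic)
qed simp

locale wiener =
  fixes T :: real and P :: "'d::finite path measure"
  assumes T_pos: "0 < T" and wiener: "wiener_measure T P"
begin

abbreviation "Q \<equiv> completion P"
abbreviation "F \<equiv> aug_filtration T P"

lemma sets_P: "sets P = sets (raw_filtration T T)"
  using wiener by (simp add: wiener_measure_def)

lemma space_P[simp]: "space P = path_space T"
  using sets_eq_imp_space_eq[OF sets_P] by simp

sublocale P: prob_space P
  using wiener by (simp add: wiener_measure_def)

sublocale Q: prob_space Q
  by (rule P.prob_space_completion)

lemma null_subset: "null_sets Q \<subseteq> Pow (path_space T)"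
  using sets.sets_into_space[of _ Q] by (auto simp: null_sets_def)

lemma aug_generator_subset: "sets (raw_filtration T t) \<union> null_sets Q \<subseteq> Pow (path_space T)"
  using null_subset sets.space_closed[of "raw_filtration T t"] by simp

lemma space_F[simp]: "space (F t) = path_space T"
  unfolding aug_filtration_def by (rule space_measure_of[OF aug_generator_subset])

lemma sets_F: "sets (F t) = sigma_sets (path_space T) (sets (raw_filtration T t) \<union> null_sets Q)"
  unfolding aug_filtration_def by (rule sets_measure_of[OF aug_generator_subset])

lemma sets_F_mono: assumes "s \<le> t" shows "sets (F s) \<subseteq> sets (F t)"
  unfolding sets_F using sets_raw_filtration_mono[OF assms]
  by (intro sigma_sets_mono') blast

lemma sets_raw_F: "sets (raw_filtration T t) \<subseteq> sets (F t)"
  unfolding sets_F by blast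

lemma sets_F_Q: assumes "t \<le> T" shows "sets (F t) \<subseteq> sets Q"
proof -
  have "sets (raw_filtration T t) \<subseteq> sets Q"
    using sets_raw_filtration_mono[OF assms, where T=T] sets_P by auto
  then show ?thesis unfolding sets_F
    using sets.sigma_sets_subset[of "sets (raw_filtration T t) \<union> null_sets Q" Q] by auto
qed

text \<open>This identification allows limits formed under \<open>Q\<close> to be read as
  \<open>F T\<close>-measurable, as the definition of the Ito integral demands.\<close>

lemma sets_F_T: "sets (F T) = sets Q"
proof
  show "sets Q \<subseteq> sets (F T)"
  proof
    fix A assume "A \<in> sets Q"
    then obtain S N N' where "A = S \<union> N" "N \<subseteq> N'" "N' \<in> null_sets P" "S \<in> sets P"
      by (rule sets_completionE)
    moreover have "N \<in> null_sets Q"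
      using \<open>N \<subseteq> N'\<close> \<open>N' \<in> null_sets P\<close> by (rule null_sets_completion_subset[OF _ null_sets_completionI])
    then have "N \<in> sets (F T)" "S \<in> sets (F T)"
      using \<open>S \<in> sets P\<close> unfolding sets_F sets_P by auto
    ultimately show "A \<in> sets (F T)" by auto
  qed
qed (rule sets_F_Q, simp)

lemma measurable_F_mono:
  "f \<in> measurable (F s) N \<Longrightarrow> s \<le> t \<Longrightarrow> f \<in> measurable (F t) N"
  using measurable_mono[OF order_refl refl sets_F_mono[of s t]] by auto

lemma measurable_F_Q: "f \<in> measurable (F s) N \<Longrightarrow> s \<le> T \<Longrightarrow> f \<in> measurable Q N"
  using measurable_mono[OF order_refl refl sets_F_Q[of s]] by auto

lemma measurable_raw_F: "f \<in> measurable (raw_filtration T t) N \<Longrightarrow> f \<in> measurable (F t) N"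
  using measurable_mono[OF order_refl refl sets_raw_F[of t], of N] by auto

lemma measurable_eval_F:
  assumes "0 \<le> s" "s \<le> t" shows "(\<lambda>\<omega>. \<omega> s) \<in> borel_measurable (F t)"
  by (rule measurable_raw_F[OF measurable_eval_raw[OF assms]])

text \<open>\<open>wiener_measure\<close> states independence for the raw filtration only; this
  lemma is the bridge to the augmented one. Sets that differ from a raw event by a null set are
  closed under complements and countable unions, and both kinds of generators are of this
  form.\<close>

lemma aug_set_approx:
  assumes "A \<in> sets (F t)"
  obtains A' where "A' \<in> sets (raw_filtration T t)" "sym_diff A A' \<in> null_sets Q"
proof -
  have "\<exists>A'\<in>sets (raw_filtration T t). sym_diff A A' \<in> null_sets Q"
    using assms unfolding sets_F
  proof (induction rule: sigma_sets.induct)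
    case (Basic a)
    then show ?case
    proof
      assume "a \<in> sets (raw_filtration T t)"
      moreover have "sym_diff a a \<in> null_sets Q" by simp
      ultimately show ?thesis by (rule bexI[rotated])
    next
      assume "a \<in> null_sets Q"
      then have "sym_diff a {} \<in> null_sets Q" by simp
      then show ?thesis using sets.empty_sets by (rule bexI)
    qed
  next
    case Empty
    have "sym_diff {} {} \<in> null_sets Q" by simp
    then show ?case using sets.empty_sets by (rule bexI)
  next
    case (Compl a)
    then obtain A' where A': "A' \<in> sets (raw_filtration T t)" "sym_diff a A' \<in> null_sets Q" by auto
    have "a \<subseteq> path_space T"
      using sigma_sets_into_sp[OF aug_generator_subset Compl.hyps] .
    moreover have "A' \<subseteq> path_space T"
      using sets.sets_into_space[OF A'(1)] by simp
    ultimately have "sym_diff (path_space T - a) (path_space T - A') = sym_diff a A'" by auto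
    then have "sym_diff (path_space T - a) (path_space T - A') \<in> null_sets Q" using A'(2) by (simp only:)
    moreover have "path_space T - A' \<in> sets (raw_filtration T t)"
      using sets.compl_sets[OF A'(1)] by simp
    ultimately show ?case by (rule bexI)
  next
    case (Union a)
    then obtain A' where A': "\<And>i. A' i \<in> sets (raw_filtration T t)" "\<And>i. sym_diff (a i) (A' i) \<in> null_sets Q"
      by metis
    have "(\<Union>i. sym_diff (a i) (A' i)) \<in> null_sets Q"
      using A'(2) by (rule null_sets_UN)
    moreover have "sym_diff (\<Union>i. a i) (\<Union>i. A' i) \<subseteq> (\<Union>i. sym_diff (a i) (A' i))" by auto
    ultimately have "sym_diff (\<Union>i. a i) (\<Union>i. A' i) \<in> null_sets Q"
      using null_sets_completion_subset by blast
    moreover have "(\<Union>i. A' i) \<in> sets (raw_filtration T t)" using A'(1) by blast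
    ultimately show ?case by (rule bexI)
  qed
  then show ?thesis using that by auto
qed

lemma increment_measurable:
  assumes "0 \<le> s" "s \<le> t" "t \<le> T"
  shows "(\<lambda>\<omega>. \<omega> t - \<omega> s) \<in> borel_measurable (F t)"
  using assms by (intro borel_measurable_diff measurable_eval_F) auto

text \<open>Makes it possible to push \<open>Q\<close> forward to the smaller sigma-algebra
  \<open>F s\<close>, which is needed to speak of the joint law of the past and a later
  increment.\<close>

lemma measurable_id_F:
  assumes "s \<le> T" shows "(\<lambda>\<omega>. \<omega>) \<in> measurable Q (F s)"
proof (rule measurableI)
  fix A assume A: "A \<in> sets (F s)"
  then have "(\<lambda>\<omega>. \<omega>) -` A \<inter> space Q = A" using sets.sets_into_space[OF A] by auto
  then show "(\<lambda>\<omega>. \<omega>) -` A \<inter> space Q \<in> sets Q" using A sets_F_Q[OF assms] by auto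
qed simp

text \<open>Augmentation does not destroy independence: \<open>A\<close> is exchanged for a raw
  event \<open>A'\<close> at the cost of a null set, the product rule is applied to
  \<open>A'\<close> under \<open>P\<close>, and \<open>A'\<close> is exchanged back.\<close>

lemma emeasure_indep_increment:
  assumes st: "0 \<le> s" "s < t" "t \<le> T" and A: "A \<in> sets (F s)" and S: "S \<in> sets borel"
  shows "emeasure Q {\<omega>\<in>A. \<omega> t - \<omega> s \<in> S} = emeasure Q A * emeasure (gaussian (t - s)) S"
proof -
  let ?X = "\<lambda>\<omega>. \<omega> t - \<omega> s"
  let ?E = "?X -` S \<inter> path_space T"
  obtain A' where A': "A' \<in> sets (raw_filtration T s)" "sym_diff A A' \<in> null_sets Q"
    by (rule aug_set_approx[OF A])
  have A'P: "A' \<in> sets P" using A'(1) sets_raw_filtration_mono[of s T T] st by (auto simp: sets_P)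
  have dist: "distributed P lborel ?X (\<lambda>x. ennreal (\<Prod>j\<in>UNIV. normal_density 0 (sqrt (t - s)) (x $ j)))"
    and ind: "P.indep_set (sets (raw_filtration T s)) (sets (vimage_algebra (path_space T) ?X borel))"
    using wiener st by (auto simp: wiener_measure_def)
  have EP: "?E \<in> sets P"
    using measurable_sets[OF distributed_measurable[OF dist], of S] S by simp
  have AQ: "A \<in> sets Q" using A sets_F_Q[of s] st by auto
  have AA: "AE \<omega> in Q. \<omega> \<in> A \<longleftrightarrow> \<omega> \<in> A'"
    using AE_not_in[OF A'(2)] by eventually_elim auto
  have "A \<subseteq> path_space T" using sets.sets_into_space[OF A] by simp
  then have "{\<omega>\<in>A. ?X \<omega> \<in> S} = A \<inter> ?E" by auto
  then have "emeasure Q {\<omega>\<in>A. ?X \<omega> \<in> S} = emeasure Q (A \<inter> ?E)" by simp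
  also have "\<dots> = emeasure Q (A' \<inter> ?E)"
    using AA AQ A'P EP by (intro emeasure_eq_AE) auto
  also have "\<dots> = emeasure P (A' \<inter> ?E)" using A'P EP by simp
  also have "\<dots> = emeasure P A' * emeasure P ?E"
  proof -
    have "?E \<in> sets (vimage_algebra (path_space T) ?X borel)"
      using S by (rule in_vimage_algebra)
    then have "measure P (A' \<inter> ?E) = measure P A' * measure P ?E"
      using P.indep_setD[OF ind A'(1)] by simp
    then show ?thesis by (simp add: P.emeasure_eq_measure ennreal_mult)
  qed
  also have "emeasure P A' = emeasure Q A'" using A'P by simp
  also have "\<dots> = emeasure Q A"
    using AA AQ A'P by (intro emeasure_eq_AE) auto
  also have "emeasure P ?E = emeasure (distr P lborel ?X) S"
    using distributed_measurable[OF dist] S by (subst emeasure_distr) auto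
  also have "\<dots> = emeasure (gaussian (t - s)) S"
    by (simp add: gaussian_def distributed_distr_eq_density[OF dist])
  finally show ?thesis .
qed

lemma increment_pair_measurable:
  assumes "0 \<le> s" "s < t" "t \<le> T"
  shows "(\<lambda>\<omega>. (\<omega>, \<omega> t - \<omega> s)) \<in> measurable Q (F s \<Otimes>\<^sub>M borel)"
proof -
  have "(\<lambda>\<omega>. \<omega> t - \<omega> s) \<in> borel_measurable Q"
    using assms by (intro measurable_F_Q[OF increment_measurable]) auto
  moreover have "(\<lambda>\<omega>. \<omega>) \<in> measurable Q (F s)"
    using assms by (intro measurable_id_F) auto
  ultimately show ?thesis by (rule measurable_Pair[rotated])
qed

text \<open>Integrating out the last increment with the past frozen gives second and exponential moments of
  simple integrals by induction over the grid; nonnegative integrands suffice for both.\<close>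

lemma nn_integral_freeze:
  assumes st: "0 \<le> s" "s < t" "t \<le> T"
    and G: "G \<in> borel_measurable (F s \<Otimes>\<^sub>M borel)"
  shows "(\<integral>\<^sup>+\<omega>. G (\<omega>, \<omega> t - \<omega> s) \<partial>Q) = (\<integral>\<^sup>+\<omega>. (\<integral>\<^sup>+x. G (\<omega>, x) \<partial>gaussian (t - s)) \<partial>Q)"
proof -
  let ?g = "gaussian (t - s) :: (real^'d) measure"
  interpret g: prob_space ?g using st by (intro prob_space_gaussian) auto
  have id: "(\<lambda>\<omega>. \<omega>) \<in> measurable Q (F s)"
    using st by (intro measurable_id_F) auto
  let ?D = "distr Q (F s) (\<lambda>\<omega>. \<omega>)"
  interpret D: prob_space ?D by (rule Q.prob_space_distr[OF id])
  have pair: "(\<lambda>\<omega>. (\<omega>, \<omega> t - \<omega> s)) \<in> measurable Q (F s \<Otimes>\<^sub>M borel)"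
    by (rule increment_pair_measurable[OF st])
  \<comment> \<open>The joint law of past and increment is a product measure. Both sides are
    compared on rectangles only, where the claim is the independence just proved.\<close>
  have eq: "?D \<Otimes>\<^sub>M ?g = distr Q (F s \<Otimes>\<^sub>M borel) (\<lambda>\<omega>. (\<omega>, \<omega> t - \<omega> s))"
  proof (rule pair_measure_eqI)
    show "sigma_finite_measure ?D" "sigma_finite_measure ?g" by unfold_locales
    show "sets (?D \<Otimes>\<^sub>M ?g) = sets (distr Q (F s \<Otimes>\<^sub>M borel) (\<lambda>\<omega>. (\<omega>, \<omega> t - \<omega> s)))"
      by (simp cong: sets_pair_measure_cong)
    fix A S assume "A \<in> sets ?D" "S \<in> sets ?g"
    then have A: "A \<in> sets (F s)" and S: "S \<in> sets borel" by auto
    have AO: "A \<subseteq> path_space T" using sets.sets_into_space[OF A] by simp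
    have "emeasure ?D A = emeasure Q A"
      using A AO by (subst emeasure_distr[OF id]) (auto simp: Int_absorb2)
    moreover have "(\<lambda>\<omega>. (\<omega>, \<omega> t - \<omega> s)) -` (A \<times> S) \<inter> space Q = {\<omega>\<in>A. \<omega> t - \<omega> s \<in> S}"
      using AO by auto
    ultimately show "emeasure ?D A * emeasure ?g S = emeasure (distr Q (F s \<Otimes>\<^sub>M borel) (\<lambda>\<omega>. (\<omega>, \<omega> t - \<omega> s))) (A \<times> S)"
      using A S by (subst emeasure_distr[OF pair]) (auto simp: emeasure_indep_increment[OF st A S])
  qed
  have "(\<integral>\<^sup>+\<omega>. G (\<omega>, \<omega> t - \<omega> s) \<partial>Q) = (\<integral>\<^sup>+z. G z \<partial>(?D \<Otimes>\<^sub>M ?g))"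
    unfolding eq using G by (subst nn_integral_distr[OF pair]) auto
  also have "\<dots> = (\<integral>\<^sup>+\<omega>. (\<integral>\<^sup>+x. G (\<omega>, x) \<partial>?g) \<partial>?D)"
  proof (rule g.nn_integral_fst[symmetric])
    show "G \<in> borel_measurable (?D \<Otimes>\<^sub>M ?g)"
      using G by (simp cong: measurable_cong_sets sets_pair_measure_cong)
  qed
  also have "\<dots> = (\<integral>\<^sup>+\<omega>. (\<integral>\<^sup>+x. G (\<omega>, x) \<partial>?g) \<partial>Q)"
  proof (rule nn_integral_distr[OF id])
    have "G \<in> borel_measurable (F s \<Otimes>\<^sub>M ?g)"
      using G by (simp cong: measurable_cong_sets sets_pair_measure_cong)
    then have "(\<lambda>\<omega>. \<integral>\<^sup>+x. G (\<omega>, x) \<partial>?g) \<in> borel_measurable (F s)"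
      by (rule g.borel_measurable_nn_integral_fst)
    then show "(\<lambda>\<omega>. \<integral>\<^sup>+x. G (\<omega>, x) \<partial>?g) \<in> borel_measurable (distr Q (F s) (\<lambda>\<omega>. \<omega>))"
      by simp
  qed
  finally show ?thesis .
qed

end

section \<open>Integrals of simple processes\<close>

lemma grid_less:
  fixes u :: "nat \<Rightarrow> real"
  assumes "\<forall>k<m. u k < u (Suc k)" "i < j" "j \<le> m" shows "u i < u j"
  using assms(2,3)
proof (induction j)
  case (Suc j)
  then have "u j < u (Suc j)" using assms(1) by auto
  then show ?case using Suc by (cases "i = j") auto
qed simp

lemma grid_le:
  fixes u :: "nat \<Rightarrow> real"
  assumes "\<forall>k<m. u k < u (Suc k)" "i \<le> j" "j \<le> m" shows "u i \<le> u j"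
  using grid_less[OF assms(1), of i j] assms by (cases "i = j") auto

lemma grid_cover:
  fixes u :: "nat \<Rightarrow> real"
  assumes "s \<in> {u 0<..u m}" shows "\<exists>k<m. s \<in> {u k<..u (Suc k)}"
  using assms
proof (induction m)
  case (Suc m)
  show ?case
  proof (cases "s \<le> u m")
    case True
    then show ?thesis using Suc by (auto intro: less_SucI)
  next
    case False
    then show ?thesis using Suc.prems by (intro exI[of _ m]) auto
  qed
qed auto

lemma simple_value_eq:
  assumes u: "\<forall>k<m. u k < u (Suc k)" and k: "k < m" "s \<in> {u k<..u (Suc k)}"
  shows "simple_value m u \<eta> s \<omega> = \<eta> k \<omega>"
proof -
  have "indicator {u j<..u (Suc j)} s *\<^sub>R \<eta> j \<omega> = (if j = k then \<eta> k \<omega> else 0)" if "j < m" for j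
  proof -
    have "s \<notin> {u j<..u (Suc j)}" if "j \<noteq> k"
    proof (cases "j < k")
      case True
      then have "u (Suc j) \<le> u k" using k by (intro grid_le[OF u]) auto
      then show ?thesis using k by auto
    next
      case False
      then have "u (Suc k) \<le> u j" using \<open>j < m\<close> that by (intro grid_le[OF u]) auto
      then show ?thesis using k by auto
    qed
    then show ?thesis using k by auto
  qed
  then have "simple_value m u \<eta> s \<omega> = (\<Sum>j<m. if j = k then \<eta> k \<omega> else 0)"
    unfolding simple_value_def by (intro sum.cong) auto
  then show ?thesis using k by simp
qed

lemma simple_value_outside:
  assumes u: "\<forall>k<m. u k < u (Suc k)" and s: "s \<notin> {u 0<..u m}"
  shows "simple_value m u \<eta> s \<omega> = 0"
proof -
  have "s \<notin> {u j<..u (Suc j)}" if "j < m" for j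
    using s grid_le[OF u, of 0 j] grid_le[OF u, of "Suc j" m] that by auto
  then show ?thesis unfolding simple_value_def by (intro sum.neutral) auto
qed

text \<open>A pointwise comparison of \<open>w\<close> with a step function, integrated afterwards.
  It is an inequality because \<open>w\<close> may be anything outside the cells; no measurability
  of \<open>w\<close> is assumed.\<close>

lemma grid_nn_integral:
  fixes w :: "real \<Rightarrow> ennreal"
  assumes u: "\<forall>k<m. u k < u (Suc k)" and u0: "0 \<le> u 0" "u m \<le> T"
    and w: "\<And>k s. k < m \<Longrightarrow> s \<in> {u k<..u (Suc k)} \<Longrightarrow> w s = c k"
  shows "(\<Sum>k<m. ennreal (u (Suc k) - u k) * c k) \<le> (\<integral>\<^sup>+s\<in>{0..T}. w s \<partial>lborel)"
proof -
  have "(\<Sum>k<m. ennreal (u (Suc k) - u k) * c k) = (\<Sum>k<m. \<integral>\<^sup>+s. c k * indicator {u k<..u (Suc k)} s \<partial>lborel)"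
    using u by (intro sum.cong) (auto simp: nn_integral_cmult mult.commute less_imp_le)
  also have "\<dots> = (\<integral>\<^sup>+s. (\<Sum>k<m. c k * indicator {u k<..u (Suc k)} s) \<partial>lborel)"
    by (rule nn_integral_sum[symmetric]) auto
  also have "\<dots> \<le> (\<integral>\<^sup>+s\<in>{0..T}. w s \<partial>lborel)"
  proof (intro nn_integral_mono)
    fix s :: real
    show "(\<Sum>k<m. c k * indicator {u k<..u (Suc k)} s) \<le> w s * indicator {0..T} s"
    proof (cases "\<exists>k<m. s \<in> {u k<..u (Suc k)}")
      case True
      then obtain k where k: "k < m" "s \<in> {u k<..u (Suc k)}" by auto
      have "s \<notin> {u j<..u (Suc j)}" if "j < m" "j \<noteq> k" for j
      proof (cases "j < k")
        case True
        then have "u (Suc j) \<le> u k" using k by (intro grid_le[OF u]) auto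
        then show ?thesis using k by auto
      next
        case False
        then have "u (Suc k) \<le> u j" using that by (intro grid_le[OF u]) auto
        then show ?thesis using k by auto
      qed
      then have "(\<Sum>j<m. c j * indicator {u j<..u (Suc j)} s) = (\<Sum>j<m. if j = k then c k else 0)"
        using k by (intro sum.cong) auto
      also have "\<dots> = w s" using k w by simp
      moreover have "s \<in> {0..T}"
        using k u0 grid_le[OF u, of 0 k] grid_le[OF u, of "Suc k" m] by auto
      ultimately show ?thesis by simp
    next
      case False
      then have "(\<Sum>k<m. c k * indicator {u k<..u (Suc k)} s) = 0" by (intro sum.neutral) auto
      then show ?thesis by simp
    qed
  qed
  finally show ?thesis .
qed

text \<open>Two simple processes come with two different grids. The sorted enumeration of the union
  of their points is one strictly increasing grid that refines both.\<close>

lemma common_grid: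
  fixes S :: "real set"
  assumes S: "finite S" "0 \<in> S" "T \<in> S" "S \<subseteq> {0..T}" and T: "0 < T"
  obtains m u where "u 0 = 0" "u m = T" "\<forall>k<m. u k < u (Suc k)" "S = u ` {..m}"
proof -
  define l where "l = sorted_list_of_set S"
  define m where "m = length l - 1"
  define u where "u = (\<lambda>k. l ! k)"
  have l: "set l = S" "sorted_wrt (<) l" using S by (auto simp: l_def)
  then have len: "length l = Suc m" using S unfolding m_def by (cases l) auto
  have lt: "u i < u j" if "i < j" "j \<le> m" for i j
    unfolding u_def using sorted_wrt_nth_less[OF l(2)] that len by auto
  have Su: "S = u ` {..m}" unfolding l(1)[symmetric] u_def using len
    by (auto simp: set_conv_nth less_Suc_eq_le)
  have "u 0 = 0"
  proof -
    obtain i where "i \<le> m" "u i = 0" using S(2) Su by auto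
    moreover have "u 0 \<in> S" using Su by auto
    ultimately show ?thesis using lt[of 0 i] S(4) by (cases "i = 0") auto
  qed
  moreover have "u m = T"
  proof -
    obtain i where "i \<le> m" "u i = T" using S(3) Su by auto
    moreover have "u m \<in> S" using Su by auto
    ultimately show ?thesis using lt[of i m] S(4) by (cases "i = m") auto
  qed
  ultimately show ?thesis using that[of u m] lt Su by auto
qed

lemma measurable_simple_value:
  assumes "\<And>j. j < m \<Longrightarrow> \<eta> j \<in> borel_measurable M"
  shows "(\<lambda>(s, \<omega>). simple_value m \<tau> \<eta> s \<omega>) \<in> borel_measurable (borel \<Otimes>\<^sub>M M)"
proof -
  have "(\<lambda>x. \<Sum>j<m. indicator {\<tau> j<..\<tau> (Suc j)} (fst x) *\<^sub>R \<eta> j (snd x)) \<in> borel_measurable (borel \<Otimes>\<^sub>M M)"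
    using assms
    by (intro borel_measurable_sum borel_measurable_scaleR)
      (auto intro: measurable_compose[OF measurable_snd] measurable_compose[OF measurable_fst borel_measurable_indicator])
  then show ?thesis by (simp add: simple_value_def split_beta')
qed

section \<open>Moments, refinement and isometry for simple integrals\<close>

context wiener begin

lemma simple_integral_measurable:
  assumes u: "\<forall>k<m. u k < u (Suc k)" and u0: "0 \<le> u 0" "u m \<le> T"
    and \<zeta>: "\<And>k. k < m \<Longrightarrow> \<zeta> k \<in> borel_measurable (F (u k))" and n: "n \<le> m"
  shows "simple_integral n u \<zeta> \<in> borel_measurable (F (u n))"
  unfolding simple_integral_def
proof (intro borel_measurable_sum borel_measurable_inner)
  fix k assume k: "k \<in> {..<n}"
  show "\<zeta> k \<in> borel_measurable (F (u n))"
    using k n grid_le[OF u, of k n] by (intro measurable_F_mono[OF \<zeta>]) auto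
  have "0 \<le> u k" "u k \<le> u (Suc k)" "u (Suc k) \<le> u n" "u n \<le> T"
    using k n u0 grid_le[OF u, of 0 k] grid_le[OF u, of "Suc k" n] grid_le[OF u, of k "Suc k"] grid_le[OF u, of n m] by auto
  then show "(\<lambda>\<omega>. \<omega> (u (Suc k)) - \<omega> (u k)) \<in> borel_measurable (F (u n))"
    by (intro measurable_F_mono[OF increment_measurable]) auto
qed

text \<open>The isometry as an upper bound. In each cell the integral so far and the coefficient
  belong to the past of the increment, so \<open>gaussian_shift_square\<close> applies with both
  frozen and the squares simply add up.\<close>

lemma simple_integral_second_moment:
  assumes u: "\<forall>k<m. u k < u (Suc k)" and u0: "0 \<le> u 0" "u m \<le> T"
    and \<zeta>: "\<And>k. k < m \<Longrightarrow> \<zeta> k \<in> borel_measurable (F (u k))" and n: "n \<le> m"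
  shows "(\<integral>\<^sup>+\<omega>. ennreal ((simple_integral n u \<zeta> \<omega>)\<^sup>2) \<partial>Q)
    \<le> of_nat CARD('d) * (\<integral>\<^sup>+\<omega>. (\<Sum>k<n. ennreal (u (Suc k) - u k) * ennreal ((norm (\<zeta> k \<omega>))\<^sup>2)) \<partial>Q)"
  using n
proof (induction n)
  case 0
  then show ?case by (simp add: simple_integral_def)
next
  case (Suc n)
  let ?h = "u (Suc n) - u n" and ?Z = "simple_integral n u \<zeta>"
  let ?S = "\<lambda>n \<omega>. \<Sum>k<n. ennreal (u (Suc k) - u k) * ennreal ((norm (\<zeta> k \<omega>))\<^sup>2)"
  have n: "n < m" "n \<le> m" using Suc by auto
  have t: "0 \<le> u n" "u n < u (Suc n)" "u (Suc n) \<le> T"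
    using n u u0 grid_le[OF u, of 0 n] grid_le[OF u, of "Suc n" m] by auto
  have Z[measurable]: "?Z \<in> borel_measurable (F (u n))"
    by (rule simple_integral_measurable[OF u u0 \<zeta> n(2)])
  have z[measurable]: "\<zeta> n \<in> borel_measurable (F (u n))" by (rule \<zeta>[OF n(1)])
  have ZQ: "?Z \<in> borel_measurable Q" using t by (intro measurable_F_Q[OF Z]) auto
  have zQ: "\<zeta> k \<in> borel_measurable Q" if "k < Suc n" for k
    using that n t grid_le[OF u, of k n] by (intro measurable_F_Q[OF \<zeta>]) auto
  have SQ: "?S n \<in> borel_measurable Q"
  proof (intro borel_measurable_sum)
    fix k assume "k \<in> {..<n}"
    then have [measurable]: "\<zeta> k \<in> borel_measurable Q" by (intro zQ) auto
    show "(\<lambda>\<omega>. ennreal (u (Suc k) - u k) * ennreal ((norm (\<zeta> k \<omega>))\<^sup>2)) \<in> borel_measurable Q"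
      by measurable
  qed
  have meas: "(\<lambda>(\<omega>, x). ennreal ((?Z \<omega> + \<zeta> n \<omega> \<bullet> x)\<^sup>2)) \<in> borel_measurable (F (u n) \<Otimes>\<^sub>M borel)"
    by measurable
  have "(\<integral>\<^sup>+\<omega>. ennreal ((simple_integral (Suc n) u \<zeta> \<omega>)\<^sup>2) \<partial>Q)
     = (\<integral>\<^sup>+\<omega>. (\<lambda>(\<omega>, x). ennreal ((?Z \<omega> + \<zeta> n \<omega> \<bullet> x)\<^sup>2)) (\<omega>, \<omega> (u (Suc n)) - \<omega> (u n)) \<partial>Q)"
    by (simp add: simple_integral_def)
  also have "\<dots> = (\<integral>\<^sup>+\<omega>. (\<integral>\<^sup>+x. ennreal ((?Z \<omega> + \<zeta> n \<omega> \<bullet> x)\<^sup>2) \<partial>gaussian ?h) \<partial>Q)"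
    by (subst nn_integral_freeze[OF t meas]) simp
  also have "\<dots> \<le> (\<integral>\<^sup>+\<omega>. ennreal ((?Z \<omega>)\<^sup>2 + CARD('d) * ?h * (norm (\<zeta> n \<omega>))\<^sup>2) \<partial>Q)"
    using t by (intro nn_integral_mono gaussian_shift_square) auto
  also have "\<dots> = (\<integral>\<^sup>+\<omega>. ennreal ((?Z \<omega>)\<^sup>2) + of_nat CARD('d) * (ennreal ?h * ennreal ((norm (\<zeta> n \<omega>))\<^sup>2)) \<partial>Q)"
    using t by (intro nn_integral_cong) (simp add: ennreal_plus ennreal_mult ennreal_of_nat_eq_real_of_nat ac_simps)
  also have "\<dots> = (\<integral>\<^sup>+\<omega>. ennreal ((?Z \<omega>)\<^sup>2) \<partial>Q) + of_nat CARD('d) * (\<integral>\<^sup>+\<omega>. ennreal ?h * ennreal ((norm (\<zeta> n \<omega>))\<^sup>2) \<partial>Q)"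
    using ZQ zQ[of n] by (subst nn_integral_add) (auto simp: nn_integral_cmult)
  also have "\<dots> \<le> of_nat CARD('d) * (\<integral>\<^sup>+\<omega>. ?S n \<omega> \<partial>Q) + of_nat CARD('d) * (\<integral>\<^sup>+\<omega>. ennreal ?h * ennreal ((norm (\<zeta> n \<omega>))\<^sup>2) \<partial>Q)"
    using Suc n by (intro add_right_mono) auto
  also have "\<dots> = of_nat CARD('d) * (\<integral>\<^sup>+\<omega>. ?S (Suc n) \<omega> \<partial>Q)"
    unfolding sum.lessThan_Suc using SQ zQ[of n] by (subst nn_integral_add) (auto simp: distrib_left)
  finally show ?case .
qed

text \<open>Each cell contributes a factor at most
  \<open>exp (c\<^sup>2 * C\<^sup>2 * h / 2)\<close> with \<open>h\<close> its length, and the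
  lengths add up to \<open>u n - u 0\<close>. The bound sees the coefficients only through
  \<open>C\<close>, so it survives a passage to the limit over grids.\<close>

lemma simple_integral_exp_moment:
  assumes u: "\<forall>k<m. u k < u (Suc k)" and u0: "0 \<le> u 0" "u m \<le> T"
    and \<zeta>: "\<And>k. k < m \<Longrightarrow> \<zeta> k \<in> borel_measurable (F (u k))" and n: "n \<le> m"
    and C: "\<And>k \<omega>. k < m \<Longrightarrow> \<omega> \<in> path_space T \<Longrightarrow> norm (\<zeta> k \<omega>) \<le> C"
  shows "(\<integral>\<^sup>+\<omega>. ennreal (exp (c * simple_integral n u \<zeta> \<omega>)) \<partial>Q)
    \<le> ennreal (exp (c\<^sup>2 * C\<^sup>2 * (u n - u 0) / 2))"
  using n
proof (induction n)
  case 0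
  then show ?case using Q.emeasure_space_1 by (simp add: simple_integral_def)
next
  case (Suc n)
  let ?h = "u (Suc n) - u n" and ?Z = "simple_integral n u \<zeta>"
  have n: "n < m" "n \<le> m" using Suc by auto
  have t: "0 \<le> u n" "u n < u (Suc n)" "u (Suc n) \<le> T"
    using n u u0 grid_le[OF u, of 0 n] grid_le[OF u, of "Suc n" m] by auto
  have Z[measurable]: "?Z \<in> borel_measurable (F (u n))"
    by (rule simple_integral_measurable[OF u u0 \<zeta> n(2)])
  have z[measurable]: "\<zeta> n \<in> borel_measurable (F (u n))" by (rule \<zeta>[OF n(1)])
  have ZQ: "?Z \<in> borel_measurable Q" using t by (intro measurable_F_Q[OF Z]) auto
  have [measurable]: "(\<lambda>\<omega>. c *\<^sub>R \<zeta> n \<omega>) \<in> borel_measurable (F (u n))" by measurable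
  have meas: "(\<lambda>(\<omega>, x). ennreal (exp (c * ?Z \<omega>)) * ennreal (exp ((c *\<^sub>R \<zeta> n \<omega>) \<bullet> x)))
      \<in> borel_measurable (F (u n) \<Otimes>\<^sub>M borel)"
    by measurable
  have "(\<integral>\<^sup>+\<omega>. ennreal (exp (c * simple_integral (Suc n) u \<zeta> \<omega>)) \<partial>Q)
     = (\<integral>\<^sup>+\<omega>. (\<lambda>(\<omega>, x). ennreal (exp (c * ?Z \<omega>)) * ennreal (exp ((c *\<^sub>R \<zeta> n \<omega>) \<bullet> x))) (\<omega>, \<omega> (u (Suc n)) - \<omega> (u n)) \<partial>Q)"
    by (simp add: simple_integral_def distrib_left exp_add ennreal_mult)
  also have "\<dots> = (\<integral>\<^sup>+\<omega>. (\<integral>\<^sup>+x. ennreal (exp (c * ?Z \<omega>)) * ennreal (exp ((c *\<^sub>R \<zeta> n \<omega>) \<bullet> x)) \<partial>gaussian ?h) \<partial>Q)"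
    by (subst nn_integral_freeze[OF t meas]) simp
  also have "\<dots> = (\<integral>\<^sup>+\<omega>. ennreal (exp (c * ?Z \<omega>)) * ennreal (exp (?h * (norm (c *\<^sub>R \<zeta> n \<omega>))\<^sup>2 / 2)) \<partial>Q)"
    using t by (subst nn_integral_cmult) (auto simp del: inner_scaleR_left simp: gaussian_exp)
  also have "\<dots> \<le> (\<integral>\<^sup>+\<omega>. ennreal (exp (c * ?Z \<omega>)) * ennreal (exp (c\<^sup>2 * C\<^sup>2 * ?h / 2)) \<partial>Q)"
  proof (intro nn_integral_mono mult_left_mono ennreal_leI)
    fix \<omega> assume "\<omega> \<in> space Q"
    then have "(norm (\<zeta> n \<omega>))\<^sup>2 \<le> C\<^sup>2" using C[OF n(1)] by (intro power_mono) auto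
    then have "?h * (c\<^sup>2 * (norm (\<zeta> n \<omega>))\<^sup>2) \<le> ?h * (c\<^sup>2 * C\<^sup>2)"
      using t by (intro mult_left_mono) auto
    then show "exp (?h * (norm (c *\<^sub>R \<zeta> n \<omega>))\<^sup>2 / 2) \<le> exp (c\<^sup>2 * C\<^sup>2 * ?h / 2)"
      by (simp add: power_mult_distrib ac_simps)
  qed auto
  also have "\<dots> = (\<integral>\<^sup>+\<omega>. ennreal (exp (c * ?Z \<omega>)) \<partial>Q) * ennreal (exp (c\<^sup>2 * C\<^sup>2 * ?h / 2))"
    using ZQ by (subst nn_integral_multc) auto
  also have "\<dots> \<le> ennreal (exp (c\<^sup>2 * C\<^sup>2 * (u n - u 0) / 2)) * ennreal (exp (c\<^sup>2 * C\<^sup>2 * ?h / 2))"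
    using Suc n by (intro mult_right_mono) auto
  also have "\<dots> = ennreal (exp (c\<^sup>2 * C\<^sup>2 * (u (Suc n) - u 0) / 2))"
    by (simp add: ennreal_mult[symmetric] mult_exp_exp) (simp add: field_simps)
  finally show ?case .
qed

text \<open>Cells are open on the left and closed on the right, so the value at the right endpoint
  \<open>u (Suc k)\<close> is the value on the whole refined cell. It is known at
  \<open>u k\<close>, because a coarse cell containing \<open>u (Suc k)\<close> starts no later than
  \<open>u k\<close>.\<close>

lemma simple_process_refine:
  assumes sp: "simple_process T P m \<tau> \<eta>"
    and u: "u 0 = 0" "u m' = T" "\<forall>k<m'. u k < u (Suc k)" and sub: "\<tau> ` {..m} \<subseteq> u ` {..m'}"
  defines "\<zeta> \<equiv> \<lambda>k \<omega>. simple_value m \<tau> \<eta> (u (Suc k)) \<omega>"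
  shows "\<And>k. k < m' \<Longrightarrow> \<zeta> k \<in> borel_measurable (F (u k))"
    and "\<And>\<omega>. simple_integral m \<tau> \<eta> \<omega> = simple_integral m' u \<zeta> \<omega>"
    and "\<And>k s \<omega>. k < m' \<Longrightarrow> s \<in> {u k<..u (Suc k)} \<Longrightarrow> simple_value m \<tau> \<eta> s \<omega> = \<zeta> k \<omega>"
proof -
  have tau: "\<forall>j<m. \<tau> j < \<tau> (Suc j)" and eta: "\<And>j. j < m \<Longrightarrow> \<eta> j \<in> borel_measurable (F (\<tau> j))"
    using sp by (auto simp: simple_process_def)
  have pts: "\<exists>p\<le>m'. \<tau> j = u p" if "j \<le> m" for j
  proof -
    have "\<tau> j \<in> u ` {..m'}" using sub that by blast
    then show ?thesis by blast
  qed
  \<comment> \<open>No refined cell straddles a coarse grid point: such a point is some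
    \<open>u p\<close>, and either \<open>p \<le> k\<close> or \<open>Suc k \<le> p\<close>.\<close>
  have iff: "s \<in> {\<tau> j<..\<tau> (Suc j)} \<longleftrightarrow> u (Suc k) \<in> {\<tau> j<..\<tau> (Suc j)}"
    if j: "j < m" and "k < m'" "s \<in> {u k<..u (Suc k)}" for j k s
  proof -
    have *: "s \<le> u p \<longleftrightarrow> u (Suc k) \<le> u p" if "p \<le> m'" for p
    proof (cases "p \<le> k")
      case True
      then have "u p \<le> u k" using \<open>k < m'\<close> by (intro grid_le[OF u(3)]) auto
      then show ?thesis using \<open>s \<in> _\<close> by auto
    next
      case False
      then have "u (Suc k) \<le> u p" using that by (intro grid_le[OF u(3)]) auto
      then show ?thesis using \<open>s \<in> _\<close> by auto
    qed
    obtain p q where p: "\<tau> j = u p" "p \<le> m'" and q: "\<tau> (Suc j) = u q" "q \<le> m'"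
      using pts[of j] pts[of "Suc j"] j by (meson Suc_leI less_imp_le)
    show ?thesis unfolding p(1) q(1) greaterThanAtMost_iff not_le[symmetric] *[OF p(2)] *[OF q(2)] ..
  qed
  show 3: "simple_value m \<tau> \<eta> s \<omega> = \<zeta> k \<omega>" if "k < m'" "s \<in> {u k<..u (Suc k)}" for k s \<omega>
    unfolding \<zeta>_def simple_value_def using iff[OF _ that] by (intro sum.cong) (auto simp: indicator_def)
  show "\<zeta> k \<in> borel_measurable (F (u k))" if k: "k < m'" for k
    unfolding \<zeta>_def simple_value_def
  proof (intro borel_measurable_sum)
    fix j assume j: "j \<in> {..<m}"
    show "(\<lambda>\<omega>. indicator {\<tau> j<..\<tau> (Suc j)} (u (Suc k)) *\<^sub>R \<eta> j \<omega>) \<in> borel_measurable (F (u k))"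
    proof (cases "u (Suc k) \<in> {\<tau> j<..\<tau> (Suc j)}")
      case True
      obtain p where p: "\<tau> j = u p" "p \<le> m'"
        using pts[of j] j by (meson lessThan_iff less_imp_le)
      have "p \<le> k"
      proof (rule ccontr)
        assume "\<not> p \<le> k"
        then have "u (Suc k) \<le> u p" using p by (intro grid_le[OF u(3)]) auto
        then show False using True p by auto
      qed
      then have "\<tau> j \<le> u k" unfolding p using k by (intro grid_le[OF u(3)]) auto
      then have "\<eta> j \<in> borel_measurable (F (u k))" using j by (intro measurable_F_mono[OF eta]) auto
      then show ?thesis using True by simp
    qed simp
  qed
  show "simple_integral m \<tau> \<eta> \<omega> = simple_integral m' u \<zeta> \<omega>" for \<omega>
  proof -
    \<comment> \<open>The coarse increment is the telescoping sum of the refined increments whose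
      right endpoint lies in the coarse cell.\<close>
    have tele: "\<omega> (\<tau> (Suc j)) - \<omega> (\<tau> j)
        = (\<Sum>k<m'. indicator {\<tau> j<..\<tau> (Suc j)} (u (Suc k)) *\<^sub>R (\<omega> (u (Suc k)) - \<omega> (u k)))" if j: "j < m" for j
    proof -
      obtain p q where p: "\<tau> j = u p" "p \<le> m'" and q: "\<tau> (Suc j) = u q" "q \<le> m'"
      using pts[of j] pts[of "Suc j"] j by (meson Suc_leI less_imp_le)
      have inj: "u a < u b \<longleftrightarrow> a < b" if "a \<le> m'" "b \<le> m'" for a b
        using grid_less[OF u(3), of a b] grid_le[OF u(3), of b a] that by (cases "a < b") auto
      have le: "u a \<le> u b \<longleftrightarrow> a \<le> b" if "a \<le> m'" "b \<le> m'" for a b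
        using inj[of b a] that by (simp add: not_less[symmetric])
      have pq: "p \<le> q" using tau j inj[OF p(2) q(2)] unfolding p(1)[symmetric] q(1)[symmetric] by simp
      have "(\<Sum>k<m'. indicator {\<tau> j<..\<tau> (Suc j)} (u (Suc k)) *\<^sub>R (\<omega> (u (Suc k)) - \<omega> (u k)))
         = (\<Sum>k\<in>{p..<q}. \<omega> (u (Suc k)) - \<omega> (u k))"
      proof (intro sum.mono_neutral_cong_right)
        show "{p..<q} \<subseteq> {..<m'}" using q by auto
        show "\<forall>k\<in>{..<m'} - {p..<q}. indicator {\<tau> j<..\<tau> (Suc j)} (u (Suc k)) *\<^sub>R (\<omega> (u (Suc k)) - \<omega> (u k)) = 0"
          using p q by (auto simp: indicator_def inj le)
        show "indicator {\<tau> j<..\<tau> (Suc j)} (u (Suc k)) *\<^sub>R (\<omega> (u (Suc k)) - \<omega> (u k)) = \<omega> (u (Suc k)) - \<omega> (u k)" if "k \<in> {p..<q}" for k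
          using that p q by (auto simp: indicator_def inj le)
      qed simp
      also have "\<dots> = \<omega> (u q) - \<omega> (u p)" by (rule sum_Suc_diff'[OF pq])
      finally show ?thesis using p q by simp
    qed
    have "simple_integral m \<tau> \<eta> \<omega>
        = (\<Sum>j<m. \<Sum>k<m'. (indicator {\<tau> j<..\<tau> (Suc j)} (u (Suc k)) *\<^sub>R \<eta> j \<omega>) \<bullet> (\<omega> (u (Suc k)) - \<omega> (u k)))"
      unfolding simple_integral_def by (intro sum.cong refl) (simp add: tele inner_sum_right)
    also have "\<dots> = (\<Sum>k<m'. \<Sum>j<m. (indicator {\<tau> j<..\<tau> (Suc j)} (u (Suc k)) *\<^sub>R \<eta> j \<omega>) \<bullet> (\<omega> (u (Suc k)) - \<omega> (u k)))"
      by (rule sum.swap)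
    also have "\<dots> = simple_integral m' u \<zeta> \<omega>"
      unfolding simple_integral_def \<zeta>_def simple_value_def by (simp add: inner_sum_left)
    finally show ?thesis .
  qed
qed

lemma simple_process_bounds:
  assumes sp: "simple_process T P m \<tau> \<eta>" and j: "j \<le> m"
  shows "0 \<le> \<tau> j" "\<tau> j \<le> T"
proof -
  have t: "\<tau> 0 = 0" "\<tau> m = T" "\<forall>j<m. \<tau> j < \<tau> (Suc j)" using sp by (auto simp: simple_process_def)
  show "0 \<le> \<tau> j" "\<tau> j \<le> T" using grid_le[OF t(3), of 0 j] grid_le[OF t(3), of j m] t j by auto
qed

text \<open>On the common refinement the difference of the two integrals is again a simple integral,
  to which the second moment bound applies. The resulting Riemann sum is dominated by the time
  integral, as the difference of the two processes is constant on each refined cell.\<close>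

lemma simple_integral_isometry:
  assumes sp: "simple_process T P m \<tau> \<eta>" and sp': "simple_process T P m' \<tau>' \<eta>'"
  shows "(\<integral>\<^sup>+\<omega>. ennreal ((simple_integral m \<tau> \<eta> \<omega> - simple_integral m' \<tau>' \<eta>' \<omega>)\<^sup>2) \<partial>Q)
    \<le> of_nat CARD('d) * (\<integral>\<^sup>+\<omega>. (\<integral>\<^sup>+s\<in>{0..T}. ennreal ((norm (simple_value m \<tau> \<eta> s \<omega> - simple_value m' \<tau>' \<eta>' s \<omega>))\<^sup>2) \<partial>lborel) \<partial>Q)"
proof -
  let ?S = "\<tau> ` {..m} \<union> \<tau>' ` {..m'}"
  have S: "finite ?S" "?S \<subseteq> {0..T}"
    using simple_process_bounds[OF sp] simple_process_bounds[OF sp'] by auto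
  have "\<tau> 0 \<in> ?S" "\<tau> m \<in> ?S" by blast+
  moreover have "\<tau> 0 = 0" "\<tau> m = T" using sp by (simp_all only: simple_process_def)
  ultimately have S': "0 \<in> ?S" "T \<in> ?S" by metis+
  obtain M u where u: "u 0 = 0" "u M = T" "\<forall>k<M. u k < u (Suc k)" and S: "?S = u ` {..M}"
    by (rule common_grid[OF S(1) S' S(2) T_pos])
  define \<zeta> where "\<zeta> = (\<lambda>k \<omega>. simple_value m \<tau> \<eta> (u (Suc k)) \<omega>)"
  define \<zeta>' where "\<zeta>' = (\<lambda>k \<omega>. simple_value m' \<tau>' \<eta>' (u (Suc k)) \<omega>)"
  have "\<tau> ` {..m} \<subseteq> u ` {..M}" "\<tau>' ` {..m'} \<subseteq> u ` {..M}" using S by blast+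
  note r = simple_process_refine[OF sp u this(1)] and r' = simple_process_refine[OF sp' u this(2)]
  define \<delta> where "\<delta> = (\<lambda>k \<omega>. \<zeta> k \<omega> - \<zeta>' k \<omega>)"
  have I: "simple_integral m \<tau> \<eta> \<omega> - simple_integral m' \<tau>' \<eta>' \<omega> = simple_integral M u \<delta> \<omega>" for \<omega>
    unfolding r(2) r'(2) by (simp add: simple_integral_def \<delta>_def \<zeta>_def \<zeta>'_def inner_diff_left sum_subtractf)
  have d: "\<delta> k \<in> borel_measurable (F (u k))" if "k < M" for k
    unfolding \<delta>_def \<zeta>_def \<zeta>'_def by (rule borel_measurable_diff[OF r(1)[OF that] r'(1)[OF that]])
  have "(\<integral>\<^sup>+\<omega>. ennreal ((simple_integral M u \<delta> \<omega>)\<^sup>2) \<partial>Q)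
    \<le> of_nat CARD('d) * (\<integral>\<^sup>+\<omega>. (\<Sum>k<M. ennreal (u (Suc k) - u k) * ennreal ((norm (\<delta> k \<omega>))\<^sup>2)) \<partial>Q)"
    using u by (intro simple_integral_second_moment[OF u(3) _ _ d]) auto
  also have "\<dots> \<le> of_nat CARD('d) * (\<integral>\<^sup>+\<omega>. (\<integral>\<^sup>+s\<in>{0..T}. ennreal ((norm (simple_value m \<tau> \<eta> s \<omega> - simple_value m' \<tau>' \<eta>' s \<omega>))\<^sup>2) \<partial>lborel) \<partial>Q)"
  proof (intro mult_left_mono nn_integral_mono grid_nn_integral[OF u(3)])
    fix \<omega> k s assume "k < M" "s \<in> {u k<..u (Suc k)}"
    then show "ennreal ((norm (simple_value m \<tau> \<eta> s \<omega> - simple_value m' \<tau>' \<eta>' s \<omega>))\<^sup>2) = ennreal ((norm (\<delta> k \<omega>))\<^sup>2)"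
      unfolding \<delta>_def \<zeta>_def \<zeta>'_def by (simp only: r(3) r'(3))
  qed (use u in auto)
  finally show ?thesis unfolding I .
qed

end

section \<open>Completeness of \<open>L\<^sup>2\<close> and block averages\<close>

lemma square_sum3_le:
  fixes a b c :: real
  shows "(a + b + c)\<^sup>2 \<le> 3 * (a\<^sup>2 + b\<^sup>2 + c\<^sup>2)"
proof -
  have "0 \<le> (a - b)\<^sup>2 + (b - c)\<^sup>2 + (a - c)\<^sup>2" by simp
  then show ?thesis by (simp add: power2_eq_square algebra_simps)
qed

text \<open>The terms of a convergent series are bounded, so
  \<open>4 ^ n * (d n)\<^sup>2 \<le> K\<close>, that is,
  \<open>\<bar>d n\<bar> \<le> sqrt K * (1/2) ^ n\<close>.\<close>

lemma summable_imp_geometric_dominated: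
  fixes d :: "nat \<Rightarrow> real"
  assumes "(\<Sum>n. ennreal (4 ^ n * (d n)\<^sup>2)) < \<infinity>"
  shows "summable d"
proof -
  have s: "summable (\<lambda>n. 4 ^ n * (d n)\<^sup>2)"
    using assms by (intro summable_suminf_not_top) auto
  then obtain K where K: "\<And>n. norm (4 ^ n * (d n)\<^sup>2) \<le> K"
    using summable_imp_bounded[OF s] by (auto simp: bounded_iff)
  have "norm (d n) \<le> sqrt K * (1/2) ^ n" for n
  proof -
    have "(2 ^ n * \<bar>d n\<bar>)\<^sup>2 \<le> K"
    proof -
      have "(4::real) ^ n = (2 ^ n)\<^sup>2" by (simp add: power2_eq_square power_mult_distrib[symmetric])
      then show ?thesis using K[of n] by (simp add: power_mult_distrib)
    qed
    then have "2 ^ n * \<bar>d n\<bar> \<le> sqrt K" by (rule real_le_rsqrt)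
    then show ?thesis by (simp add: field_simps power_divide)
  qed
  moreover have "summable (\<lambda>n. sqrt K * (1/2) ^ n)" by (intro summable_mult summable_geometric) auto
  ultimately show ?thesis by (intro summable_comparison_test'[of _ 0 d])
qed

text \<open>Two modes of convergence are recorded since both are used: the whole sequence in mean
  square, for the definition of the Ito integral, and a subsequence almost everywhere, for Fatou's
  lemma on exponential moments.\<close>

lemma L2_complete:
  fixes Z :: "nat \<Rightarrow> 'a \<Rightarrow> real"
  assumes [measurable]: "\<And>k. Z k \<in> borel_measurable M"
    and Cauchy: "\<And>e. 0 < e \<Longrightarrow> \<exists>N. \<forall>k\<ge>N. \<forall>l\<ge>N. (\<integral>\<^sup>+x. ennreal ((Z k x - Z l x)\<^sup>2) \<partial>M) \<le> ennreal e"
  obtains Y r where "Y \<in> borel_measurable M" "strict_mono r"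
    "AE x in M. (\<lambda>k. Z (r k) x) \<longlonglongrightarrow> Y x"
    "(\<lambda>k. \<integral>\<^sup>+x. ennreal ((Z k x - Y x)\<^sup>2) \<partial>M) \<longlonglongrightarrow> 0"
proof -
  obtain N where N: "\<And>e k l. 0 < e \<Longrightarrow> k \<ge> N e \<Longrightarrow> l \<ge> N e \<Longrightarrow> (\<integral>\<^sup>+x. ennreal ((Z k x - Z l x)\<^sup>2) \<partial>M) \<le> ennreal e"
    using Cauchy by metis
  \<comment> \<open>Rate \<open>8^-n\<close> against weight \<open>4^n\<close>: the weighted second
    moments of the increments sum like \<open>2^-n\<close>, and finiteness of the weighted series
    forces the increments to be summable. The \<open>Suc rn\<close> in the maximum keeps
    \<open>r\<close> strictly increasing.\<close>
  define r where "r = rec_nat (N 1) (\<lambda>n rn. max (Suc rn) (N ((1/8) ^ Suc n)))"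
  have r_Suc: "r (Suc n) = max (Suc (r n)) (N ((1/8) ^ Suc n))" for n by (simp add: r_def)
  have r: "strict_mono r" by (auto simp: strict_mono_Suc_iff r_Suc)
  have rN: "N ((1/8) ^ n) \<le> r n" for n by (cases n) (auto simp: r_Suc, simp add: r_def)
  define d where "d = (\<lambda>n x. Z (r (Suc n)) x - Z (r n) x)"
  have [measurable]: "d n \<in> borel_measurable M" for n unfolding d_def by measurable
  have dn: "(\<integral>\<^sup>+x. ennreal ((d n x)\<^sup>2) \<partial>M) \<le> ennreal ((1/8) ^ n)" for n
    unfolding d_def using rN[of n] r by (intro N) (auto intro: order_trans simp: strict_mono_less_eq)
  have "(\<integral>\<^sup>+x. (\<Sum>n. ennreal (4 ^ n * (d n x)\<^sup>2)) \<partial>M) = (\<Sum>n. \<integral>\<^sup>+x. ennreal (4 ^ n * (d n x)\<^sup>2) \<partial>M)"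
    by (intro nn_integral_suminf) auto
  also have "\<dots> \<le> (\<Sum>n. ennreal ((1/2) ^ n))"
  proof (intro suminf_le)
    fix n
    have "(\<integral>\<^sup>+x. ennreal (4 ^ n * (d n x)\<^sup>2) \<partial>M) = ennreal (4 ^ n) * (\<integral>\<^sup>+x. ennreal ((d n x)\<^sup>2) \<partial>M)"
      by (subst nn_integral_cmult[symmetric]) (auto simp: ennreal_mult)
    also have "\<dots> \<le> ennreal (4 ^ n) * ennreal ((1/8) ^ n)" by (intro mult_left_mono dn) auto
    also have "\<dots> = ennreal ((1/2) ^ n)"
      by (simp add: ennreal_mult[symmetric] power_mult_distrib[symmetric])
    finally show "(\<integral>\<^sup>+x. ennreal (4 ^ n * (d n x)\<^sup>2) \<partial>M) \<le> ennreal ((1/2) ^ n)" .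
  qed auto
  also have "\<dots> < \<infinity>"
    by (subst suminf_ennreal2) (auto intro: summable_geometric)
  finally have "AE x in M. (\<Sum>n. ennreal (4 ^ n * (d n x)\<^sup>2)) \<noteq> \<infinity>"
    by (intro nn_integral_PInf_AE) auto
  then have conv: "AE x in M. convergent (\<lambda>k. Z (r k) x)"
  proof eventually_elim
    fix x assume "(\<Sum>n. ennreal (4 ^ n * (d n x)\<^sup>2)) \<noteq> \<infinity>"
    then have "summable (\<lambda>n. d n x)" by (intro summable_imp_geometric_dominated) (auto simp: top.not_eq_extremum)
    then have "convergent (\<lambda>k. \<Sum>n<k. d n x)" by (simp add: summable_iff_convergent)
    moreover have "(\<Sum>n<k. d n x) = Z (r k) x - Z (r 0) x" for k
      unfolding d_def by (rule sum_lessThan_telescope)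
    ultimately have "convergent (\<lambda>k. Z (r k) x - Z (r 0) x)" by simp
    then show "convergent (\<lambda>k. Z (r k) x)" by (simp add: convergent_diff_const_right_iff)
  qed
  define Y where "Y = (\<lambda>x. lim (\<lambda>k. Z (r k) x))"
  have Y[measurable]: "Y \<in> borel_measurable M" unfolding Y_def by measurable
  have lim: "AE x in M. (\<lambda>k. Z (r k) x) \<longlonglongrightarrow> Y x"
    using conv by eventually_elim (simp add: Y_def convergent_LIMSEQ_iff)
  have "(\<lambda>k. \<integral>\<^sup>+x. ennreal ((Z k x - Y x)\<^sup>2) \<partial>M) \<longlonglongrightarrow> 0"
  proof (rule tendsto_zero_ennreal)
    fix e :: real assume e: "0 < e"
    have "(\<integral>\<^sup>+x. ennreal ((Z k x - Y x)\<^sup>2) \<partial>M) < ennreal e" if k: "N (e / 2) \<le> k" for k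
    proof -
      \<comment> \<open>Fatou along the subsequence turns the Cauchy bound for
        \<open>Z k - Z (r n)\<close> into a bound for \<open>Z k - Y\<close>, for every large
        \<open>k\<close>, although pointwise limits are known along \<open>r\<close> only.\<close>
      have "(\<integral>\<^sup>+x. ennreal ((Z k x - Y x)\<^sup>2) \<partial>M)
          = (\<integral>\<^sup>+x. liminf (\<lambda>n. ennreal ((Z k x - Z (r n) x)\<^sup>2)) \<partial>M)"
      proof (rule nn_integral_cong_AE, use lim in eventually_elim)
        fix x assume "(\<lambda>k. Z (r k) x) \<longlonglongrightarrow> Y x"
        then have "(\<lambda>n. ennreal ((Z k x - Z (r n) x)\<^sup>2)) \<longlonglongrightarrow> ennreal ((Z k x - Y x)\<^sup>2)"
          by (intro tendsto_intros tendsto_ennrealI)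
        then show "ennreal ((Z k x - Y x)\<^sup>2) = liminf (\<lambda>n. ennreal ((Z k x - Z (r n) x)\<^sup>2))"
          by (rule lim_imp_Liminf[OF trivial_limit_sequentially, symmetric])
      qed
      also have "\<dots> \<le> liminf (\<lambda>n. \<integral>\<^sup>+x. ennreal ((Z k x - Z (r n) x)\<^sup>2) \<partial>M)"
        by (rule nn_integral_liminf) measurable
      also have "\<dots> \<le> liminf (\<lambda>n. ennreal (e / 2))"
      proof (rule Liminf_mono)
        have "eventually (\<lambda>n. N (e / 2) \<le> r n) sequentially"
          using filterlim_subseq[OF r] by (simp add: filterlim_at_top)
        then show "\<forall>\<^sub>F n in sequentially. (\<integral>\<^sup>+x. ennreal ((Z k x - Z (r n) x)\<^sup>2) \<partial>M) \<le> ennreal (e / 2)"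
          by eventually_elim (use k e in \<open>auto intro!: N\<close>)
      qed
      also have "\<dots> = ennreal (e / 2)" by (simp add: Liminf_const)
      also have "\<dots> < ennreal e" using e by (simp add: ennreal_lessI)
      finally show ?thesis .
    qed
    then show "\<forall>\<^sub>F k in sequentially. (\<integral>\<^sup>+x. ennreal ((Z k x - Y x)\<^sup>2) \<partial>M) < ennreal e"
      by (auto simp: eventually_sequentially)
  qed
  then show ?thesis using that Y r lim by blast
qed

text \<open>The radial retraction onto the closed ball of radius \<open>C\<close>. The maximum in
  the denominator makes it continuous across the sphere and the identity inside.\<close>

definition clip :: "real \<Rightarrow> 'b::real_normed_vector \<Rightarrow> 'b" where
  "clip C y = (C / max C (norm y)) *\<^sub>R y"

lemma norm_clip_le: "0 < C \<Longrightarrow> norm (clip C y) \<le> C"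
  by (simp add: clip_def field_simps max_def)

lemma clip_id: "0 < C \<Longrightarrow> norm y \<le> C \<Longrightarrow> clip C y = y"
  by (simp add: clip_def max_def)

lemma continuous_on_clip: "0 < C \<Longrightarrow> continuous_on S (clip C)"
  unfolding clip_def by (intro continuous_intros) (auto simp: max_def)

text \<open>A Lebesgue measurable function is an almost everywhere limit of continuous functions.
  Clipping these keeps the limit, restores the bound \<open>C\<close>, and so permits dominated
  convergence on \<open>{0..T}\<close>.\<close>

lemma L1_approx_continuous:
  fixes g :: "real \<Rightarrow> 'b::euclidean_space"
  assumes g: "g \<in> borel_measurable borel" and C: "0 < C" "\<And>s. norm (g s) \<le> C" and e: "0 < e"
  obtains \<phi> where "continuous_on UNIV \<phi>" "\<And>s. norm (\<phi> s) \<le> C"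
    "(\<integral>\<^sup>+s\<in>{0..T}. ennreal (norm (g s - \<phi> s)) \<partial>lborel) < ennreal e"
proof -
  have "g \<in> borel_measurable lebesgue" using g by (intro measurable_completion) simp
  then have "g measurable_on UNIV" by (rule lebesgue_measurable_imp_measurable_on) simp
  then obtain N G where N: "negligible N" and G: "\<And>n. continuous_on UNIV (G n)"
    and lim: "\<And>x. x \<notin> N \<Longrightarrow> (\<lambda>n. G n x) \<longlonglongrightarrow> g x"
    unfolding measurable_on_def by auto
  have AEN: "AE x in lborel. x \<notin> N"
    using AE_not_in[of N lebesgue] N by (simp add: negligible_iff_null_sets AE_completion_iff)
  define \<phi> where "\<phi> = (\<lambda>n x. clip C (G n x))"
  have cont: "continuous_on UNIV (\<phi> n)" for n
    unfolding \<phi>_def by (rule continuous_on_compose2[OF continuous_on_clip[OF C(1), of UNIV] G]) auto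
  have [measurable]: "\<phi> n \<in> borel_measurable borel" for n
    by (rule borel_measurable_continuous_onI[OF cont])
  have bd: "norm (\<phi> n s) \<le> C" for n s unfolding \<phi>_def using C by (intro norm_clip_le)
  note g[measurable]
  have "(\<lambda>n. \<integral>\<^sup>+s. ennreal (norm (g s - \<phi> n s)) * indicator {0..T} s \<partial>lborel)
      \<longlonglongrightarrow> (\<integral>\<^sup>+s. (0::ennreal) \<partial>(lborel :: real measure))"
  proof (rule nn_integral_dominated_convergence[where w="\<lambda>s. ennreal (2 * C) * indicator {0..T} s"])
    show "AE s in lborel. ennreal (norm (g s - \<phi> n s)) * indicator {0..T} s \<le> ennreal (2 * C) * indicator {0..T} s" for n
    proof (intro AE_I2 mult_right_mono ennreal_leI)
      show "norm (g s - \<phi> n s) \<le> 2 * C" for s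
        using norm_triangle_ineq4[of "g s" "\<phi> n s"] C(2)[of s] bd[of n s] by simp
    qed simp
    show "(\<integral>\<^sup>+s. ennreal (2 * C) * indicator {0..T} s \<partial>lborel) < \<infinity>"
      by (subst nn_integral_cmult) (auto simp: ennreal_mult_less_top emeasure_lborel_Icc_eq)
    show "AE s in lborel. (\<lambda>n. ennreal (norm (g s - \<phi> n s)) * indicator {0..T} s) \<longlonglongrightarrow> 0"
      using AEN
    proof eventually_elim
      fix s assume "s \<notin> N"
      have "continuous (at (g s)) (clip C)"
        using continuous_on_clip[OF C(1), of "UNIV :: 'b set"] by (simp add: continuous_on_eq_continuous_at)
      then have "(\<lambda>n. \<phi> n s) \<longlonglongrightarrow> clip C (g s)"
        unfolding \<phi>_def by (rule isCont_tendsto_compose[OF _ lim[OF \<open>s \<notin> N\<close>]])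
      then have "(\<lambda>n. \<phi> n s) \<longlonglongrightarrow> g s" using clip_id[OF C(1) C(2)] by simp
      then have "(\<lambda>n. norm (g s - \<phi> n s)) \<longlonglongrightarrow> norm (g s - g s)" by (intro tendsto_intros)
      then have "(\<lambda>n. ennreal (norm (g s - \<phi> n s)) * indicator {0..T} s) \<longlonglongrightarrow> ennreal 0 * indicator {0..T} s"
        by (cases "s \<in> {0..T}") (auto intro: tendsto_ennrealI simp del: ennreal_0)
      then show "(\<lambda>n. ennreal (norm (g s - \<phi> n s)) * indicator {0..T} s) \<longlonglongrightarrow> 0" by simp
    qed
  qed auto
  then have "(\<lambda>n. \<integral>\<^sup>+s. ennreal (norm (g s - \<phi> n s)) * indicator {0..T} s \<partial>lborel) \<longlonglongrightarrow> 0" by simp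
  then have "\<forall>\<^sub>F n in sequentially. (\<integral>\<^sup>+s. ennreal (norm (g s - \<phi> n s)) * indicator {0..T} s \<partial>lborel) < ennreal e"
    using e by (intro order_tendstoD) auto
  then obtain n where "(\<integral>\<^sup>+s. ennreal (norm (g s - \<phi> n s)) * indicator {0..T} s \<partial>lborel) < ennreal e"
    by (auto simp: eventually_sequentially)
  then show ?thesis using that[OF cont bd] by blast
qed


text \<open>The value intended for the cell from \<open>j * h\<close> to \<open>(j + 1) * h\<close>
  is the average of \<open>g\<close> over the preceding cell. This delay makes it depend on
  \<open>g\<close> up to time \<open>j * h\<close> only, which gives adapted coefficients. The first
  cell has no predecessor and receives the default 0.\<close>

definition block_avg :: "real \<Rightarrow> (real \<Rightarrow> 'b) \<Rightarrow> nat \<Rightarrow> 'b::euclidean_space" where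
  "block_avg h g j = (if j = 0 then 0 else (1 / h) *\<^sub>R
     (\<integral>s. indicator {(real j - 1) * h<..real j * h} s *\<^sub>R g s \<partial>lborel))"

lemma integrable_block:
  fixes g :: "real \<Rightarrow> 'b::euclidean_space"
  assumes g: "g \<in> borel_measurable borel" and C: "\<And>s. norm (g s) \<le> C"
  shows "integrable lborel (\<lambda>s. indicator {a<..b} s *\<^sub>R g s)"
proof (rule Bochner_Integration.integrable_bound[where f="\<lambda>s. C * indicator {a<..b} s"])
  show "integrable lborel (\<lambda>s. C * indicator {a<..b} s)" by (cases "a \<le> b") auto
  show "AE s in lborel. norm (indicator {a<..b} s *\<^sub>R g s) \<le> norm (C * indicator {a<..b} s)"
    using C order_trans[OF norm_ge_zero C] by (auto simp: indicator_def)
qed (use g in measurable)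

text \<open>The average minus \<open>y\<close> is the average of \<open>g - y\<close>. The point
  \<open>y\<close> is free: \<open>y = 0\<close> gives the bound on averages, and the value of a
  continuous approximation gives convergence.\<close>

lemma block_avg_dist_le:
  fixes g :: "real \<Rightarrow> 'b::euclidean_space"
  assumes g: "g \<in> borel_measurable borel" and C: "\<And>s. norm (g s) \<le> C" and h: "0 < h" and j: "0 < j"
  shows "ennreal (norm (block_avg h g j - y)) \<le>
    ennreal (1 / h) * (\<integral>\<^sup>+s. ennreal (norm (g s - y)) * indicator {(real j - 1) * h<..real j * h} s \<partial>lborel)"
proof -
  let ?I = "{(real j - 1) * h<..real j * h}"
  have le: "(real j - 1) * h \<le> real j * h" using h by (intro mult_right_mono) auto
  have iy: "integrable lborel (\<lambda>s. indicator ?I s *\<^sub>R y)" using le by (intro integrable_scaleR_left) auto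
  have "(\<integral>s. indicator ?I s *\<^sub>R y \<partial>lborel) = h *\<^sub>R y"
    using le by (subst integral_scaleR_left) (auto simp: algebra_simps)
  then have "block_avg h g j - y = (1 / h) *\<^sub>R ((\<integral>s. indicator ?I s *\<^sub>R g s \<partial>lborel) - (\<integral>s. indicator ?I s *\<^sub>R y \<partial>lborel))"
    using h j by (simp add: block_avg_def scaleR_diff_right left_diff_distrib)
  also have "\<dots> = (1 / h) *\<^sub>R (\<integral>s. indicator ?I s *\<^sub>R g s - indicator ?I s *\<^sub>R y \<partial>lborel)"
    by (subst Bochner_Integration.integral_diff[OF integrable_block[OF g C] iy]) simp
  also have "\<dots> = (1 / h) *\<^sub>R (\<integral>s. indicator ?I s *\<^sub>R (g s - y) \<partial>lborel)" by (simp add: scaleR_diff_right)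
  finally have eq: "norm (block_avg h g j - y) = (1 / h) * norm (\<integral>s. indicator ?I s *\<^sub>R (g s - y) \<partial>lborel)"
    using h by simp
  have "integrable lborel (\<lambda>s. indicator ?I s *\<^sub>R (g s - y))"
    unfolding scaleR_diff_right by (intro Bochner_Integration.integrable_diff integrable_block[OF g C] iy)
  then have "ennreal (norm (\<integral>s. indicator ?I s *\<^sub>R (g s - y) \<partial>lborel)) \<le> (\<integral>\<^sup>+s. norm (indicator ?I s *\<^sub>R (g s - y)) \<partial>lborel)"
    by (rule integral_norm_bound_ennreal)
  also have "\<dots> = (\<integral>\<^sup>+s. ennreal (norm (g s - y)) * indicator ?I s \<partial>lborel)"
    by (intro nn_integral_cong) (simp add: indicator_def)
  finally have "ennreal (1 / h) * ennreal (norm (\<integral>s. indicator ?I s *\<^sub>R (g s - y) \<partial>lborel))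
      \<le> ennreal (1 / h) * (\<integral>\<^sup>+s. ennreal (norm (g s - y)) * indicator ?I s \<partial>lborel)"
    by (rule mult_left_mono) simp
  moreover have "0 \<le> 1 / h" using h by simp
  ultimately show ?thesis unfolding eq by (simp only: ennreal_mult norm_ge_zero)
qed

lemma norm_block_avg_le:
  fixes g :: "real \<Rightarrow> 'b::euclidean_space"
  assumes g: "g \<in> borel_measurable borel" and C: "\<And>s. norm (g s) \<le> C" and h: "0 < h"
  shows "norm (block_avg h g j) \<le> C"
proof -
  have C0: "0 \<le> C" using order_trans[OF norm_ge_zero C] .
  show ?thesis
  proof (cases "j = 0")
    case False
    let ?I = "{(real j - 1) * h<..real j * h}"
    have le: "(real j - 1) * h \<le> real j * h" using h by (intro mult_right_mono) auto
    have "ennreal (norm (block_avg h g j - 0)) \<le> ennreal (1 / h) * (\<integral>\<^sup>+s. ennreal (norm (g s - 0)) * indicator ?I s \<partial>lborel)"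
      using False by (intro block_avg_dist_le[OF g C h]) auto
    also have "\<dots> \<le> ennreal (1 / h) * (\<integral>\<^sup>+s. ennreal C * indicator ?I s \<partial>lborel)"
      using C by (intro mult_left_mono nn_integral_mono mult_right_mono ennreal_leI) auto
    also have "\<dots> = ennreal C"
      using le h C0 by (simp add: nn_integral_cmult ennreal_mult[symmetric] algebra_simps)
    finally show ?thesis using C0 by (simp add: ennreal_le_iff)
  qed (use C0 in \<open>simp add: block_avg_def\<close>)
qed

lemma sum_indicator_blocks:
  fixes u :: "nat \<Rightarrow> real"
  assumes "\<forall>k<m. u k < u (Suc k)"
  shows "(\<Sum>j<m. indicator {u j<..u (Suc j)} s) = (indicator {u 0<..u m} s :: ennreal)"
  using assms
proof (induction m)
  case (Suc m)
  have "u 0 \<le> u m" "u m < u (Suc m)" using Suc.prems grid_le[of m u 0 m] by auto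
  then have "{u 0<..u (Suc m)} = {u 0<..u m} \<union> {u m<..u (Suc m)}" by auto
  moreover have "indicator ({u 0<..u m} \<union> {u m<..u (Suc m)}) s = (indicator {u 0<..u m} s + indicator {u m<..u (Suc m)} s :: ennreal)"
    by (auto simp: indicator_def)
  ultimately show ?case using Suc by simp
qed simp

text \<open>\<open>g\<close> is replaced by a continuous \<phi> at small L1 distance. Averages over
  the preceding cell follow \<phi> by uniform continuity, and averaging does not increase the L1
  error. Since all functions are bounded, the square costs only a factor over the first
  power.\<close>

lemma block_avg_converge:
  fixes g :: "real \<Rightarrow> real ^ 'd::finite"
  assumes g: "g \<in> borel_measurable borel" and C: "\<And>s. norm (g s) \<le> C" and T: "0 < T"
  shows "(\<lambda>k. \<integral>\<^sup>+s\<in>{0..T}. ennreal ((norm (simple_value (Suc k) (\<lambda>j. real j * (T / real (Suc k)))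
      (\<lambda>j _. block_avg (T / real (Suc k)) g j) s \<omega> - g s))\<^sup>2) \<partial>lborel) \<longlonglongrightarrow> 0"
proof (rule tendsto_zero_ennreal)
  fix r :: real assume r: "0 < r"
  \<comment> \<open>Shifted by 1 because clipping needs a strictly positive radius.\<close>
  define D where "D = C + 1"
  have D: "0 < D" "norm (g s) \<le> D" for s using C[of s] order_trans[OF norm_ge_zero C] by (auto simp: D_def)
  \<comment> \<open>The bracket counts the multiples of \<open>e\<close> in the L1 error: the
    approximation error twice, once averaged and once directly, the oscillation of \<phi> over
    length \<open>T\<close>, and the first cell with its trivial bound. The prefactor
    \<open>2 * D\<close> passes from first powers to squares.\<close>
  define K where "K = 2 * D * (2 + T + 2 * D)"
  have K: "0 < K" unfolding K_def using D T by (intro mult_pos_pos add_pos_pos) auto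
  define e where "e = r / (2 * K)"
  have e: "0 < e" "K * e < r" using r K by (auto simp: e_def)
  obtain \<phi> where cont: "continuous_on UNIV \<phi>" and \<phi>D: "\<And>s. norm (\<phi> s) \<le> D"
    and \<phi>e: "(\<integral>\<^sup>+s\<in>{0..T}. ennreal (norm (g s - \<phi> s)) \<partial>lborel) < ennreal e"
    using L1_approx_continuous[OF g D e(1)] by blast
  have "uniformly_continuous_on {0..T} \<phi>"
    using cont by (intro compact_uniformly_continuous) (auto intro: continuous_on_subset)
  then obtain \<delta> where \<delta>: "0 < \<delta>" "\<And>s s'. s \<in> {0..T} \<Longrightarrow> s' \<in> {0..T} \<Longrightarrow> dist s' s < \<delta> \<Longrightarrow> dist (\<phi> s') (\<phi> s) < e"
    using e(1) unfolding uniformly_continuous_on_def by metis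
  have [measurable]: "\<phi> \<in> borel_measurable borel" by (rule borel_measurable_continuous_onI[OF cont])
  note g[measurable]
  define \<psi> where "\<psi> = (\<lambda>s. ennreal (norm (g s - \<phi> s)))"
  have [measurable]: "\<psi> \<in> borel_measurable borel" unfolding \<psi>_def by measurable
  have "(\<lambda>k. T / real (Suc k)) \<longlonglongrightarrow> 0" by (rule LIMSEQ_Suc) (rule lim_const_over_n)
  then have "\<forall>\<^sub>F k in sequentially. T / real (Suc k) < min (\<delta> / 2) e"
    using \<delta>(1) e(1) by (intro order_tendstoD) auto
  then show "\<forall>\<^sub>F k in sequentially. (\<integral>\<^sup>+s\<in>{0..T}. ennreal ((norm (simple_value (Suc k) (\<lambda>j. real j * (T / real (Suc k)))
      (\<lambda>j _. block_avg (T / real (Suc k)) g j) s \<omega> - g s))\<^sup>2) \<partial>lborel) < ennreal r"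
  proof eventually_elim
    fix k
    define m where "m = Suc k"
    define h where "h = T / real m"
    define u where "u = (\<lambda>j. real j * h)"
    define V where "V = (\<lambda>s. simple_value m u (\<lambda>j _. block_avg h g j) s \<omega>)"
    assume "T / real (Suc k) < min (\<delta> / 2) e"
    \<comment> \<open>Points of two neighbouring cells differ by less than \<open>2 * h\<close>, so
      \<phi> moves by less than \<open>e\<close> between them; \<open>h < e\<close> controls the
      first cell, where the average is replaced by 0.\<close>
    then have h: "0 < h" "2 * h < \<delta>" "h < e" using T by (auto simp: h_def m_def mult.commute)
    have u: "\<forall>k<m. u k < u (Suc k)" "u 0 = 0" "u m = T"
      using h(1) by (simp_all add: u_def) (simp add: h_def m_def)
    let ?I = "\<lambda>j. {u j<..u (Suc j)}"
    define a where "a = (\<lambda>j. if j = 0 then 0 else ennreal (1 / h) * (\<integral>\<^sup>+s. \<psi> s * indicator (?I (j - 1)) s \<partial>lborel))"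
    define W where "W = (\<lambda>s. (\<Sum>j<m. indicator (?I j) s * a j) + ennreal e + \<psi> s + ennreal (2 * D) * indicator {0..h} s)"
    have Ij: "?I (j - 1) = {(real j - 1) * h<..real j * h}" if "0 < j" for j
      using that by (auto simp: u_def of_nat_diff)
    have VD: "norm (V s) \<le> D" for s
    proof (cases "s \<in> {0<..T}")
      case True
      then obtain j where "j < m" "s \<in> ?I j" using grid_cover[of s u m] u by auto
      then have "V s = block_avg h g j" unfolding V_def by (rule simple_value_eq[OF u(1)])
      then show ?thesis using norm_block_avg_le[OF g D(2) h(1)] by simp
    next
      case False
      then have "V s = 0" unfolding V_def using u by (intro simple_value_outside[OF u(1)]) auto
      then show ?thesis using D by simp
    qed
    have VgD: "norm (V s - g s) \<le> 2 * D" for s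
      using norm_triangle_ineq4[of "V s" "g s"] VD[of s] D(2)[of s] by simp
    have W: "ennreal (norm (V s - g s)) \<le> W s" if s: "s \<in> {0..T}" for s
    proof (cases "s \<le> h")
      case True
      then have "ennreal (norm (V s - g s)) \<le> ennreal (2 * D) * indicator {0..h} s"
        using s VgD by (auto intro!: ennreal_leI)
      also have "\<dots> \<le> W s" unfolding W_def by simp
      finally show ?thesis .
    next
      case False
      then have "s \<in> {u 0<..u m}" using s h u by auto
      then obtain j where j: "j < m" "s \<in> ?I j" using grid_cover by blast
      have "j \<noteq> 0"
      proof
        assume "j = 0"
        then show False using False j(2) by (simp add: u_def)
      qed
      then have "0 < j" by simp
      have "V s = block_avg h g j" unfolding V_def by (rule simple_value_eq[OF u(1) j])
      then have "ennreal (norm (V s - \<phi> s)) \<le> ennreal (1 / h) * (\<integral>\<^sup>+r. ennreal (norm (g r - \<phi> s)) * indicator (?I (j - 1)) r \<partial>lborel)"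
        unfolding Ij[OF \<open>0 < j\<close>] using block_avg_dist_le[OF g D(2) h(1) \<open>0 < j\<close>] by simp
      also have "\<dots> \<le> ennreal (1 / h) * (\<integral>\<^sup>+r. \<psi> r * indicator (?I (j - 1)) r + ennreal e * indicator (?I (j - 1)) r \<partial>lborel)"
      proof (intro mult_left_mono nn_integral_mono)
        fix r
        show "ennreal (norm (g r - \<phi> s)) * indicator (?I (j - 1)) r
          \<le> \<psi> r * indicator (?I (j - 1)) r + ennreal e * indicator (?I (j - 1)) r"
        proof (cases "r \<in> ?I (j - 1)")
          case True
          have "real (Suc j) * h \<le> T" using j(1) grid_le[OF u(1), of "Suc j" m] u(3) by (auto simp: u_def)
          then have "r \<in> {0..T}" "dist r s < \<delta>"
          proof -
            define x where "x = real j * h"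
            have "1 * h \<le> real j * h" using \<open>0 < j\<close> h by (intro mult_right_mono) auto
            moreover have "(real j - 1) * h < r" "r \<le> real j * h" using True unfolding Ij[OF \<open>0 < j\<close>] by auto
            moreover have "real j * h < s" "s \<le> real (Suc j) * h" using j(2) by (auto simp: u_def)
            ultimately have "h \<le> x" "x - h < r" "r \<le> x" "x < s" "s \<le> x + h" "x + h \<le> T"
              using \<open>real (Suc j) * h \<le> T\<close> by (simp_all add: x_def algebra_simps)
            then show "r \<in> {0..T}" "dist r s < \<delta>" using h by (simp_all add: dist_real_def abs_if)
          qed
          then have "dist (\<phi> r) (\<phi> s) < e" using \<delta>(2)[OF s] by blast
          then have "norm (g r - \<phi> s) \<le> norm (g r - \<phi> r) + e"
            using norm_triangle_ineq[of "g r - \<phi> r" "\<phi> r - \<phi> s"] by (simp add: dist_norm)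
          then have "ennreal (norm (g r - \<phi> s)) \<le> \<psi> r + ennreal e"
            unfolding \<psi>_def using e by (simp add: ennreal_plus[symmetric] del: ennreal_plus)
          then show ?thesis using True by simp
        qed simp
      qed simp
      also have "\<dots> = a j + ennreal (1 / h) * (ennreal e * emeasure lborel (?I (j - 1)))"
        using \<open>j \<noteq> 0\<close> by (subst nn_integral_add) (auto simp: a_def distrib_left nn_integral_cmult)
      also have "emeasure lborel (?I (j - 1)) = ennreal h"
        unfolding Ij[OF \<open>0 < j\<close>] using h by (simp add: algebra_simps)
      also have "ennreal (1 / h) * (ennreal e * ennreal h) = ennreal e"
        using h e by (simp add: ennreal_mult[symmetric])
      finally have 1: "ennreal (norm (V s - \<phi> s)) \<le> a j + ennreal e" .
      have "a j = indicator (?I j) s * a j" using j(2) by simp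
      also have "\<dots> \<le> (\<Sum>i<m. indicator (?I i) s * a i)" using j(1) by (intro member_le_sum) auto
      finally have 2: "a j \<le> (\<Sum>i<m. indicator (?I i) s * a i)" .
      have "norm (V s - g s) \<le> norm (V s - \<phi> s) + norm (g s - \<phi> s)"
        using norm_triangle_ineq4[of "V s - \<phi> s" "g s - \<phi> s"] by simp
      then have "ennreal (norm (V s - g s)) \<le> ennreal (norm (V s - \<phi> s)) + \<psi> s"
        unfolding \<psi>_def by (simp add: ennreal_plus[symmetric] del: ennreal_plus)
      also have "\<dots> \<le> ((\<Sum>i<m. indicator (?I i) s * a i) + ennreal e) + \<psi> s"
        using 1 2 by (intro add_right_mono) (auto intro: order_trans add_right_mono)
      also have "\<dots> \<le> W s" unfolding W_def by simp
      finally show ?thesis .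
    qed
    have [measurable]: "V \<in> borel_measurable borel" unfolding V_def simple_value_def by measurable
    have "(\<integral>\<^sup>+s\<in>{0..T}. \<psi> s \<partial>lborel) \<le> ennreal e" using \<phi>e unfolding \<psi>_def by simp
    note \<psi>e = this
    \<comment> \<open>Weighted by the cell length, \<open>a j\<close> becomes the integral of \<psi>
      over the preceding cell. These cells are disjoint, and the term for \<open>j = 0\<close>
      vanishes by definition, which shifts the index by one.\<close>
    have sa: "(\<Sum>j<m. ennreal h * a j) \<le> ennreal e"
    proof -
      have "(\<Sum>j<m. ennreal h * a j) = (\<Sum>j<k. ennreal h * a (Suc j))"
        unfolding m_def by (subst sum.lessThan_Suc_shift) (simp add: a_def)
      also have "\<dots> = (\<Sum>j<k. \<integral>\<^sup>+s. \<psi> s * indicator (?I j) s \<partial>lborel)"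
        using h by (intro sum.cong) (auto simp: a_def mult.assoc[symmetric] ennreal_mult[symmetric])
      also have "\<dots> = (\<integral>\<^sup>+s. (\<Sum>j<k. \<psi> s * indicator (?I j) s) \<partial>lborel)"
        by (rule nn_integral_sum[symmetric]) auto
      also have "\<dots> = (\<integral>\<^sup>+s. \<psi> s * indicator {u 0<..u k} s \<partial>lborel)"
        using u(1) by (intro nn_integral_cong) (simp add: sum_distrib_left[symmetric] sum_indicator_blocks m_def)
      also have "\<dots> \<le> (\<integral>\<^sup>+s\<in>{0..T}. \<psi> s \<partial>lborel)"
        using u grid_le[OF u(1), of k m] by (intro nn_integral_mono) (auto simp: m_def indicator_def)
      finally show ?thesis using \<psi>e by simp
    qed
    have "(\<integral>\<^sup>+s\<in>{0..T}. ennreal ((norm (V s - g s))\<^sup>2) \<partial>lborel) \<le> (\<integral>\<^sup>+s. ennreal (2 * D) * (W s * indicator {0..T} s) \<partial>lborel)"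
    proof (intro nn_integral_mono)
      fix s
      show "ennreal ((norm (V s - g s))\<^sup>2) * indicator {0..T} s \<le> ennreal (2 * D) * (W s * indicator {0..T} s)"
      proof (cases "s \<in> {0..T}")
        case True
        have "ennreal ((norm (V s - g s))\<^sup>2) \<le> ennreal (2 * D * norm (V s - g s))"
          unfolding power2_eq_square using VgD by (intro ennreal_leI mult_right_mono) auto
        also have "\<dots> = ennreal (2 * D) * ennreal (norm (V s - g s))" using D by (simp add: ennreal_mult)
        also have "\<dots> \<le> ennreal (2 * D) * W s" using W[OF True] by (rule mult_left_mono) simp
        finally show ?thesis using True by simp
      qed simp
    qed
    also have "\<dots> = ennreal (2 * D) * (\<integral>\<^sup>+s. W s * indicator {0..T} s \<partial>lborel)"
      by (rule nn_integral_cmult) (unfold W_def, measurable)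
    also have "(\<integral>\<^sup>+s. W s * indicator {0..T} s \<partial>lborel) \<le> (\<integral>\<^sup>+s. (\<Sum>j<m. a j * indicator (?I j) s) + ennreal e * indicator {0..T} s
        + \<psi> s * indicator {0..T} s + ennreal (2 * D) * indicator {0..h} s \<partial>lborel)"
      unfolding W_def by (intro nn_integral_mono) (auto simp: indicator_def mult.commute)
    also have "\<dots> = (\<Sum>j<m. ennreal h * a j) + ennreal (e * T) + (\<integral>\<^sup>+s\<in>{0..T}. \<psi> s \<partial>lborel) + ennreal (2 * D * h)"
    proof -
      have "emeasure lborel (?I j) = ennreal h" for j
        using h by (simp add: u_def algebra_simps)
      then show ?thesis using T D h e
        by (simp add: nn_integral_add nn_integral_cmult nn_integral_multc nn_integral_sum ennreal_mult mult.commute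
            del: sum_mult_indicator sum_indicator_mult)
    qed
    also have "\<dots> \<le> ennreal e + ennreal (e * T) + ennreal e + ennreal (2 * D * e)"
      using sa \<psi>e h D by (intro add_mono order_refl ennreal_leI mult_left_mono) auto
    also have "\<dots> = ennreal ((2 + T + 2 * D) * e)"
      using e T D by (simp add: ennreal_plus[symmetric] algebra_simps del: ennreal_plus)
    finally have "(\<integral>\<^sup>+s\<in>{0..T}. ennreal ((norm (V s - g s))\<^sup>2) \<partial>lborel) \<le> ennreal (2 * D) * ennreal ((2 + T + 2 * D) * e)"
      by (simp add: mult_left_mono)
    also have "\<dots> = ennreal (K * e)" using D T e unfolding K_def by (simp add: ennreal_mult[symmetric] mult.assoc)
    also have "\<dots> < ennreal r" using e r by (intro ennreal_lessI) auto
    finally show "(\<integral>\<^sup>+s\<in>{0..T}. ennreal ((norm (simple_value (Suc k) (\<lambda>j. real j * (T / real (Suc k)))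
      (\<lambda>j _. block_avg (T / real (Suc k)) g j) s \<omega> - g s))\<^sup>2) \<partial>lborel) < ennreal r"
      unfolding V_def u_def h_def m_def .
  qed
qed

section \<open>The Ito integral of a bounded progressively measurable process\<close>

lemma norm_add3_le:
  fixes a b c :: "'b::real_normed_vector"
  shows "norm (a + b + c) \<le> norm a + norm b + norm c"
  using norm_triangle_ineq[of "a + b" c] norm_triangle_ineq[of a b] by linarith

lemma norm_simple_value_le:
  assumes u: "\<forall>k<m. u k < u (Suc k)" and C: "\<And>k. k < m \<Longrightarrow> norm (\<eta> k \<omega>) \<le> C" "0 \<le> C"
  shows "norm (simple_value m u \<eta> s \<omega>) \<le> C"
proof (cases "s \<in> {u 0<..u m}")
  case True
  then obtain k where "k < m" "s \<in> {u k<..u (Suc k)}" using grid_cover by blast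
  then show ?thesis using C(1) by (simp add: simple_value_eq[OF u])
next
  case False
  then show ?thesis using C(2) by (simp add: simple_value_outside[OF u])
qed

section \<open>Processes square integrable in time and path, and the Ito integral as a mean-square
  limit\<close>

context wiener begin

definition sqnorm :: "(real \<Rightarrow> 'd path \<Rightarrow> real ^ 'd) \<Rightarrow> ennreal" where
  "sqnorm Z = (\<integral>\<^sup>+\<omega>. (\<integral>\<^sup>+s\<in>{0..T}. ennreal ((norm (Z s \<omega>))\<^sup>2) \<partial>lborel) \<partial>Q)"

text \<open>The path comes first in the pair, opposite to progressive measurability, so that
  integrating out time is integration over the second factor. The indicator discards the unspecified
  values outside \<open>{0..T}\<close>.\<close>

definition jointly_measurable :: "(real \<Rightarrow> 'd path \<Rightarrow> 'b::euclidean_space) \<Rightarrow> bool" where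
  "jointly_measurable Z \<longleftrightarrow> (\<lambda>(\<omega>, s). indicator {0..T} s *\<^sub>R Z s \<omega>) \<in> borel_measurable (Q \<Otimes>\<^sub>M lborel)"

definition bounded_progressive :: "real \<Rightarrow> (real \<Rightarrow> 'd path \<Rightarrow> 'b::euclidean_space) \<Rightarrow> bool" where
  "bounded_progressive C X \<longleftrightarrow> X \<in> prog_measurable T P borel \<and>
     (\<forall>s\<in>{0..T}. \<forall>\<omega>\<in>path_space T. norm (X s \<omega>) \<le> C)"

text \<open>Time is clamped to \<open>{0..t}\<close> before the process is evaluated, and the
  indicator then erases the values at clamped times. This trades the restricted time space for the
  whole line.\<close>

lemma prog_measurable_extend:
  fixes X :: "real \<Rightarrow> 'd path \<Rightarrow> 'b::euclidean_space"
  assumes X: "X \<in> prog_measurable T P borel" and t: "t \<in> {0..T}"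
  shows "(\<lambda>(\<omega>, s). indicator {0..t} s *\<^sub>R X s \<omega>) \<in> borel_measurable (F t \<Otimes>\<^sub>M lborel)"
proof -
  have c: "(\<lambda>s. max 0 (min t s)) \<in> measurable borel (restrict_space borel {0..t})"
    using t by (intro measurable_restrict_space2) auto
  have "(\<lambda>(s, \<omega>). X s \<omega>) \<in> borel_measurable (restrict_space borel {0..t} \<Otimes>\<^sub>M F t)"
    using X t by (simp add: prog_measurable_def)
  moreover have "(\<lambda>x. (max 0 (min t (snd x)), fst x)) \<in> measurable (F t \<Otimes>\<^sub>M lborel) (restrict_space borel {0..t} \<Otimes>\<^sub>M F t)"
  proof (rule measurable_Pair)
    show "(\<lambda>x. max 0 (min t (snd x))) \<in> measurable (F t \<Otimes>\<^sub>M lborel) (restrict_space borel {0..t})"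
      by (rule measurable_compose[OF _ c]) simp
  qed simp
  ultimately have "(\<lambda>x. X (max 0 (min t (snd x))) (fst x)) \<in> borel_measurable (F t \<Otimes>\<^sub>M lborel)"
    by (auto dest: measurable_compose[rotated])
  then have "(\<lambda>x. indicator {0..t} (snd x) *\<^sub>R X (max 0 (min t (snd x))) (fst x)) \<in> borel_measurable (F t \<Otimes>\<^sub>M lborel)"
    by (intro borel_measurable_scaleR) auto
  also have "(\<lambda>x. indicator {0..t} (snd x) *\<^sub>R X (max 0 (min t (snd x))) (fst x)) = (\<lambda>(\<omega>, s). indicator {0..t} s *\<^sub>R X s \<omega>)"
    by (auto simp: fun_eq_iff indicator_def)
  finally show ?thesis .
qed

lemma measurable_F_T_lborel: "measurable (F T \<Otimes>\<^sub>M lborel) N = measurable (Q \<Otimes>\<^sub>M lborel) N"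
  by (intro measurable_cong_sets sets_pair_measure_cong sets_F_T refl)

lemma prog_jointly_measurable:
  "X \<in> prog_measurable T P borel \<Longrightarrow> jointly_measurable X"
  unfolding jointly_measurable_def using prog_measurable_extend[of X T] T_pos
  by (simp add: measurable_F_T_lborel)

lemma bounded_progressive_jm: "bounded_progressive C X \<Longrightarrow> jointly_measurable X"
  by (auto simp: bounded_progressive_def intro: prog_jointly_measurable)

lemma jointly_measurable_diff:
  fixes X Y :: "real \<Rightarrow> 'd path \<Rightarrow> real ^ 'd"
  shows "jointly_measurable X \<Longrightarrow> jointly_measurable Y \<Longrightarrow> jointly_measurable (\<lambda>s \<omega>. X s \<omega> - Y s \<omega>)"
  unfolding jointly_measurable_def scaleR_diff_right split_beta' by (rule borel_measurable_diff)

lemma jointly_measurable_norm_power: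
  fixes X :: "real \<Rightarrow> 'd path \<Rightarrow> real ^ 'd"
  assumes "jointly_measurable X"
  shows "(\<lambda>(\<omega>, s). ennreal ((norm (X s \<omega>))\<^sup>2) * indicator {0..T} s) \<in> borel_measurable (Q \<Otimes>\<^sub>M lborel)"
proof -
  have "(\<lambda>x. ennreal ((norm ((\<lambda>(\<omega>, s). indicator {0..T} s *\<^sub>R X s \<omega>) x))\<^sup>2)) \<in> borel_measurable (Q \<Otimes>\<^sub>M lborel)"
    using assms unfolding jointly_measurable_def by measurable
  also have "(\<lambda>x. ennreal ((norm ((\<lambda>(\<omega>, s). indicator {0..T} s *\<^sub>R X s \<omega>) x))\<^sup>2)) =
      (\<lambda>(\<omega>, s). ennreal ((norm (X s \<omega>))\<^sup>2) * indicator {0..T} s)"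
    by (auto simp: fun_eq_iff indicator_def)
  finally show ?thesis .
qed

lemma sqnorm_inner_measurable:
  fixes X :: "real \<Rightarrow> 'd path \<Rightarrow> real ^ 'd"
  assumes "jointly_measurable X"
  shows "(\<lambda>\<omega>. \<integral>\<^sup>+s\<in>{0..T}. ennreal ((norm (X s \<omega>))\<^sup>2) \<partial>lborel) \<in> borel_measurable Q"
  using jointly_measurable_norm_power[OF assms] by (rule lborel.borel_measurable_nn_integral)

lemma norm_sum3_square_le:
  fixes a b c :: "'b::real_normed_vector"
  shows "(norm (a + b + c))\<^sup>2 \<le> 3 * ((norm a)\<^sup>2 + (norm b)\<^sup>2 + (norm c)\<^sup>2)"
proof -
  have "norm (a + b + c) \<le> norm a + norm b + norm c"
    by (rule norm_add3_le)
  then have "(norm (a + b + c))\<^sup>2 \<le> (norm a + norm b + norm c)\<^sup>2" by (intro power_mono) auto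
  also have "\<dots> \<le> 3 * ((norm a)\<^sup>2 + (norm b)\<^sup>2 + (norm c)\<^sup>2)" by (rule square_sum3_le)
  finally show ?thesis .
qed

text \<open>The form with constant 3 takes the place of Minkowski's inequality: every use compares
  two processes through approximants and tolerates a constant factor.\<close>

lemma sqnorm_triangle:
  assumes Z: "\<And>s \<omega>. Z s \<omega> = A s \<omega> + B s \<omega> + C s \<omega>"
    and jm: "jointly_measurable A" "jointly_measurable B" "jointly_measurable C"
  shows "sqnorm Z \<le> 3 * (sqnorm A + sqnorm B + sqnorm C)"
proof -
  have m: "(\<lambda>s. ennreal ((norm (X s \<omega>))\<^sup>2) * indicator {0..T} s) \<in> borel_measurable lborel"
    if "jointly_measurable X" "\<omega> \<in> space Q" for X :: "real \<Rightarrow> 'd path \<Rightarrow> real ^ 'd" and \<omega>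
    using measurable_Pair2[OF jointly_measurable_norm_power[OF that(1)] that(2)] by simp
  have "sqnorm Z \<le> (\<integral>\<^sup>+\<omega>. 3 * ((\<integral>\<^sup>+s\<in>{0..T}. ennreal ((norm (A s \<omega>))\<^sup>2) \<partial>lborel) + (\<integral>\<^sup>+s\<in>{0..T}. ennreal ((norm (B s \<omega>))\<^sup>2) \<partial>lborel)
     + (\<integral>\<^sup>+s\<in>{0..T}. ennreal ((norm (C s \<omega>))\<^sup>2) \<partial>lborel)) \<partial>Q)"
    unfolding sqnorm_def
  proof (intro nn_integral_mono)
    fix \<omega> assume \<omega>: "\<omega> \<in> space Q"
    have "(\<integral>\<^sup>+s\<in>{0..T}. ennreal ((norm (Z s \<omega>))\<^sup>2) \<partial>lborel) \<le>
      (\<integral>\<^sup>+s. 3 * (ennreal ((norm (A s \<omega>))\<^sup>2) * indicator {0..T} s + ennreal ((norm (B s \<omega>))\<^sup>2) * indicator {0..T} s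
        + ennreal ((norm (C s \<omega>))\<^sup>2) * indicator {0..T} s) \<partial>lborel)"
    proof (intro nn_integral_mono)
      fix s
      have "ennreal ((norm (Z s \<omega>))\<^sup>2) \<le> ennreal (3 * ((norm (A s \<omega>))\<^sup>2 + (norm (B s \<omega>))\<^sup>2 + (norm (C s \<omega>))\<^sup>2))"
        unfolding Z by (intro ennreal_leI norm_sum3_square_le)
      also have "\<dots> = 3 * (ennreal ((norm (A s \<omega>))\<^sup>2) + ennreal ((norm (B s \<omega>))\<^sup>2) + ennreal ((norm (C s \<omega>))\<^sup>2))"
        by (simp add: ennreal_mult)
      finally show "ennreal ((norm (Z s \<omega>))\<^sup>2) * indicator {0..T} s \<le>
        3 * (ennreal ((norm (A s \<omega>))\<^sup>2) * indicator {0..T} s + ennreal ((norm (B s \<omega>))\<^sup>2) * indicator {0..T} s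
        + ennreal ((norm (C s \<omega>))\<^sup>2) * indicator {0..T} s)"
        by (simp add: indicator_def)
    qed
    also have "\<dots> = 3 * ((\<integral>\<^sup>+s\<in>{0..T}. ennreal ((norm (A s \<omega>))\<^sup>2) \<partial>lborel) + (\<integral>\<^sup>+s\<in>{0..T}. ennreal ((norm (B s \<omega>))\<^sup>2) \<partial>lborel)
     + (\<integral>\<^sup>+s\<in>{0..T}. ennreal ((norm (C s \<omega>))\<^sup>2) \<partial>lborel))"
      using m[OF jm(1) \<omega>] m[OF jm(2) \<omega>] m[OF jm(3) \<omega>]
      by (subst nn_integral_cmult) (simp_all add: nn_integral_add)
    finally show "(\<integral>\<^sup>+s\<in>{0..T}. ennreal ((norm (Z s \<omega>))\<^sup>2) \<partial>lborel) \<le> \<dots>" .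
  qed
  also have "\<dots> = 3 * (sqnorm A + sqnorm B + sqnorm C)"
    unfolding sqnorm_def
    using sqnorm_inner_measurable[OF jm(1)] sqnorm_inner_measurable[OF jm(2)] sqnorm_inner_measurable[OF jm(3)]
    by (subst nn_integral_cmult) (simp_all add: nn_integral_add)
  finally show ?thesis .
qed

lemma sqnorm_minus_commute: "sqnorm (\<lambda>s \<omega>. A s \<omega> - B s \<omega>) = sqnorm (\<lambda>s \<omega>. B s \<omega> - A s \<omega>)"
  by (simp add: sqnorm_def norm_minus_commute)

lemma simple_process_measurable_Q:
  assumes "simple_process T P m \<tau> \<eta>" "j < m" shows "\<eta> j \<in> borel_measurable Q"
  using assms simple_process_bounds[OF assms(1), of j]
  by (auto simp: simple_process_def intro: measurable_F_Q)

lemma simple_integral_measurable_Q: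
  assumes sp: "simple_process T P m \<tau> \<eta>"
  shows "simple_integral m \<tau> \<eta> \<in> borel_measurable Q"
proof -
  have t: "\<tau> 0 = 0" "\<tau> m = T" "\<forall>j<m. \<tau> j < \<tau> (Suc j)" "\<And>j. j < m \<Longrightarrow> \<eta> j \<in> borel_measurable (F (\<tau> j))"
    using sp unfolding simple_process_def by blast+
  have "simple_integral m \<tau> \<eta> \<in> borel_measurable (F (\<tau> m))"
    by (rule simple_integral_measurable[OF t(3) _ _ t(4) order_refl]) (simp_all add: t(1,2))
  then show ?thesis unfolding t(2) by (rule measurable_F_Q) simp
qed

lemma simple_value_jm:
  assumes sp: "simple_process T P m \<tau> \<eta>"
  shows "jointly_measurable (simple_value m \<tau> \<eta>)"
proof -
  have "(\<lambda>(s, \<omega>). simple_value m \<tau> \<eta> s \<omega>) \<in> borel_measurable (borel \<Otimes>\<^sub>M Q)"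
    by (rule measurable_simple_value[OF simple_process_measurable_Q[OF sp]])
  then have "(\<lambda>(s, \<omega>). simple_value m \<tau> \<eta> s \<omega>) \<in> borel_measurable (lborel \<Otimes>\<^sub>M Q)"
    by (simp cong: measurable_cong_sets sets_pair_measure_cong)
  from measurable_pair_swap[OF this]
  have "(\<lambda>x. simple_value m \<tau> \<eta> (snd x) (fst x)) \<in> borel_measurable (Q \<Otimes>\<^sub>M lborel)"
    by (simp add: split_beta')
  then show ?thesis unfolding jointly_measurable_def split_beta' by (intro borel_measurable_scaleR) auto
qed

text \<open>Delayed block averages of each path on uniform grids. They inherit the bound
  \<open>C\<close>, they are adapted by the delay, and they converge path by path; dominated
  convergence over paths, with dominating constant \<open>(2 * C)\<^sup>2 * T\<close>, gives
  convergence in \<open>sqnorm\<close>.\<close>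

lemma simple_approximation:
  assumes X: "bounded_progressive C X"
  obtains m \<tau> \<eta> where "\<And>k. simple_process T P (m k) (\<tau> k) (\<eta> k)"
    "\<And>k j \<omega>. \<omega> \<in> path_space T \<Longrightarrow> norm (\<eta> k j \<omega>) \<le> C"
    "(\<lambda>k. sqnorm (\<lambda>s \<omega>. simple_value (m k) (\<tau> k) (\<eta> k) s \<omega> - X s \<omega>)) \<longlonglongrightarrow> 0"
proof (cases "path_space T = ({} :: 'd path set)")
  case True
  then show ?thesis using Q.not_empty by simp
next
  case False
  define g where "g = (\<lambda>\<omega> s. indicator {0..T} s *\<^sub>R X s \<omega>)"
  define m where "m = (\<lambda>k. Suc k)"
  define h where "h = (\<lambda>k. T / real (Suc k))"
  define \<tau> where "\<tau> = (\<lambda>k j. real j * h k)"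
  define \<eta> where "\<eta> = (\<lambda>k j \<omega>. block_avg (h k) (g \<omega>) j)"
  have Xp: "X \<in> prog_measurable T P borel" and XC: "\<And>s \<omega>. s \<in> {0..T} \<Longrightarrow> \<omega> \<in> path_space T \<Longrightarrow> norm (X s \<omega>) \<le> C"
    using X by (auto simp: bounded_progressive_def)
  obtain \<omega>\<^sub>0 :: "'d path" where "\<omega>\<^sub>0 \<in> path_space T" using False by blast
  then have C0: "0 \<le> C" using XC[of 0 \<omega>\<^sub>0] T_pos by (auto intro: order_trans[OF norm_ge_zero])
  have h: "0 < h k" "real (Suc k) * h k = T" for k using T_pos by (auto simp: h_def)
  have gC: "norm (g \<omega> s) \<le> C" if "\<omega> \<in> path_space T" for \<omega> s
    using XC[of s \<omega>] that C0 by (auto simp: g_def indicator_def)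
  have jm: "jointly_measurable X" by (rule prog_jointly_measurable[OF Xp])
  have gm: "g \<omega> \<in> borel_measurable borel" if "\<omega> \<in> path_space T" for \<omega>
    using measurable_Pair2[OF jm[unfolded jointly_measurable_def], of \<omega>] that by (simp add: g_def)
  have \<eta>C: "norm (\<eta> k j \<omega>) \<le> C" if "\<omega> \<in> path_space T" for k j \<omega>
    unfolding \<eta>_def using norm_block_avg_le[OF gm gC h(1)] that by blast
  have \<tau>: "\<tau> k 0 = 0" "\<tau> k (m k) = T" "\<forall>j<m k. \<tau> k j < \<tau> k (Suc j)" for k
    using h[of k] unfolding \<tau>_def m_def by simp_all
  have \<eta>m: "\<eta> k j \<in> borel_measurable (F (\<tau> k j))" if j: "j < m k" for k j
  proof (cases "j = 0")
    case True
    then show ?thesis by (simp add: \<eta>_def block_avg_def)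
  next
    case False
    have t: "\<tau> k j \<in> {0..T}" using grid_le[OF \<tau>(3), of 0 j k] grid_le[OF \<tau>(3), of j "m k" k] \<tau>(1,2)[of k] j by auto
    let ?I = "{(real j - 1) * h k<..real j * h k}"
    have "(\<lambda>(\<omega>, s). indicator {0..\<tau> k j} s *\<^sub>R X s \<omega>) \<in> borel_measurable (F (\<tau> k j) \<Otimes>\<^sub>M lborel)"
      by (rule prog_measurable_extend[OF Xp t])
    then have "(\<lambda>x. indicator ?I (snd x) *\<^sub>R (indicator {0..\<tau> k j} (snd x) *\<^sub>R X (snd x) (fst x))) \<in> borel_measurable (F (\<tau> k j) \<Otimes>\<^sub>M lborel)"
      unfolding split_beta' by (rule borel_measurable_scaleR[rotated]) measurable
    then have "(\<lambda>\<omega>. \<integral>s. indicator ?I s *\<^sub>R (indicator {0..\<tau> k j} s *\<^sub>R X s \<omega>) \<partial>lborel) \<in> borel_measurable (F (\<tau> k j))"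
      by (intro lborel.borel_measurable_lebesgue_integral) (simp add: split_beta')
    \<comment> \<open>The averaging block ends at \<open>\<tau> k j\<close>, so cutting the process
      off there changes nothing, and the cut process is measurable for
      \<open>F (\<tau> k j)\<close>. This is where the delay of one cell is used.\<close>
    moreover have "indicator ?I s *\<^sub>R (indicator {0..\<tau> k j} s *\<^sub>R X s \<omega>) = indicator ?I s *\<^sub>R g \<omega> s" for s \<omega>
    proof (cases "s \<in> ?I")
      case True
      have "0 \<le> (real j - 1) * h k" using False h(1)[of k] by (intro mult_nonneg_nonneg) auto
      then have "s \<in> {0..\<tau> k j}" "s \<in> {0..T}" using True t unfolding \<tau>_def by auto
      then show ?thesis by (simp add: g_def)
    qed simp
    ultimately have "(\<lambda>\<omega>. \<integral>s. indicator ?I s *\<^sub>R g \<omega> s \<partial>lborel) \<in> borel_measurable (F (\<tau> k j))" by simp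
    then show ?thesis using False unfolding \<eta>_def block_avg_def by simp
  qed
  have sp: "simple_process T P (m k) (\<tau> k) (\<eta> k)" for k
  proof -
    have "bounded (\<eta> k j ` path_space T)" for j
      unfolding bounded_iff using \<eta>C by blast
    then show ?thesis unfolding simple_process_def using \<tau>[of k] \<eta>m[of _ k] by blast
  qed
  let ?V = "\<lambda>k. simple_value (m k) (\<tau> k) (\<eta> k)"
  let ?D = "\<lambda>k \<omega>. \<integral>\<^sup>+s\<in>{0..T}. ennreal ((norm (?V k s \<omega> - X s \<omega>))\<^sup>2) \<partial>lborel"
  have "(\<lambda>k. \<integral>\<^sup>+\<omega>. ?D k \<omega> \<partial>Q) \<longlonglongrightarrow> (\<integral>\<^sup>+\<omega>. 0 \<partial>Q)"
  proof (rule nn_integral_dominated_convergence[where w="\<lambda>_. ennreal ((2 * C)\<^sup>2 * T)"])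
    show "?D k \<in> borel_measurable Q" for k
      by (intro sqnorm_inner_measurable jointly_measurable_diff simple_value_jm sp jm)
    show "AE \<omega> in Q. ?D k \<omega> \<le> ennreal ((2 * C)\<^sup>2 * T)" for k
    proof (rule AE_I2)
      fix \<omega> assume "\<omega> \<in> space Q"
      then have \<omega>: "\<omega> \<in> path_space T" by simp
      have "?D k \<omega> \<le> (\<integral>\<^sup>+s. ennreal ((2 * C)\<^sup>2) * indicator {0..T} s \<partial>lborel)"
      proof (intro nn_integral_mono)
        fix s
        show "ennreal ((norm (?V k s \<omega> - X s \<omega>))\<^sup>2) * indicator {0..T} s \<le> ennreal ((2 * C)\<^sup>2) * indicator {0..T} s"
        proof (cases "s \<in> {0..T}")
          case True
          have "norm (?V k s \<omega>) \<le> C" using \<eta>C[OF \<omega>] C0 by (intro norm_simple_value_le \<tau>) auto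
          then have "norm (?V k s \<omega> - X s \<omega>) \<le> 2 * C"
            using norm_triangle_ineq4[of "?V k s \<omega>" "X s \<omega>"] XC[OF True \<omega>] by simp
          then have "(norm (?V k s \<omega> - X s \<omega>))\<^sup>2 \<le> (2 * C)\<^sup>2" by (rule power_mono) simp
          then have "ennreal ((norm (?V k s \<omega> - X s \<omega>))\<^sup>2) \<le> ennreal ((2 * C)\<^sup>2)" by (rule ennreal_leI)
          then show ?thesis by (rule mult_right_mono) simp
        qed simp
      qed
      also have "\<dots> = ennreal ((2 * C)\<^sup>2 * T)"
        using T_pos by (simp add: nn_integral_cmult ennreal_mult)
      finally show "?D k \<omega> \<le> ennreal ((2 * C)\<^sup>2 * T)" .
    qed
    show "AE \<omega> in Q. (\<lambda>k. ?D k \<omega>) \<longlonglongrightarrow> 0"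
    proof (rule AE_I2)
      fix \<omega> assume "\<omega> \<in> space Q"
      then have \<omega>: "\<omega> \<in> path_space T" by simp
      have "?D k \<omega> = (\<integral>\<^sup>+s\<in>{0..T}. ennreal ((norm (simple_value (Suc k) (\<lambda>j. real j * (T / real (Suc k)))
        (\<lambda>j _. block_avg (T / real (Suc k)) (g \<omega>) j) s \<omega> - g \<omega> s))\<^sup>2) \<partial>lborel)" for k
        by (intro nn_integral_cong) (auto simp: simple_value_def m_def \<tau>_def h_def \<eta>_def g_def indicator_def)
      then show "(\<lambda>k. ?D k \<omega>) \<longlonglongrightarrow> 0" using block_avg_converge[OF gm[OF \<omega>] gC[OF \<omega>] T_pos] by simp
    qed
  qed (auto simp: Q.emeasure_space_1[simplified])
  then have "(\<lambda>k. sqnorm (\<lambda>s \<omega>. ?V k s \<omega> - X s \<omega>)) \<longlonglongrightarrow> 0" by (simp add: sqnorm_def)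
  then show ?thesis using that[of m \<tau> \<eta>] sp \<eta>C by blast
qed

lemma simple_integral_isometry_sqnorm:
  assumes "simple_process T P m \<tau> \<eta>" "simple_process T P m' \<tau>' \<eta>'"
  shows "(\<integral>\<^sup>+\<omega>. ennreal ((simple_integral m \<tau> \<eta> \<omega> - simple_integral m' \<tau>' \<eta>' \<omega>)\<^sup>2) \<partial>Q)
    \<le> of_nat CARD('d) * sqnorm (\<lambda>s \<omega>. simple_value m \<tau> \<eta> s \<omega> - simple_value m' \<tau>' \<eta>' s \<omega>)"
  using simple_integral_isometry[OF assms] by (simp add: sqnorm_def)

lemma jointly_measurable_zero: "jointly_measurable (\<lambda>_ _. 0)"
  by (simp add: jointly_measurable_def)

lemma sqnorm_zero: "sqnorm (\<lambda>_ _. 0) = 0"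
  by (simp add: sqnorm_def)

lemma ennreal_tendsto_0_cmult:
  fixes f :: "nat \<Rightarrow> ennreal"
  assumes "f \<longlonglongrightarrow> 0" "c < top" shows "(\<lambda>k. c * f k) \<longlonglongrightarrow> 0"
  using ennreal_tendsto_cmult[OF assms(2,1)] by simp

text \<open>By the isometry the integrals of the approximants form a mean-square Cauchy sequence.
  Their exponential moments are bounded uniformly because the approximants keep the bound
  \<open>C\<close>, and Fatou's lemma along the almost everywhere convergent subsequence hands the
  bound to the limit.\<close>

lemma is_ito_integral_exists:
  assumes X: "bounded_progressive C X"
  obtains Y where "is_ito_integral T P X Y"
    "\<And>c. (\<integral>\<^sup>+\<omega>. ennreal (exp (c * Y \<omega>)) \<partial>Q) \<le> ennreal (exp (c\<^sup>2 * C\<^sup>2 * T / 2))"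
proof -
  obtain m \<tau> \<eta> where sp: "\<And>k. simple_process T P (m k) (\<tau> k) (\<eta> k)"
    and bd: "\<And>k j \<omega>. \<omega> \<in> path_space T \<Longrightarrow> norm (\<eta> k j \<omega>) \<le> C"
    and conv: "(\<lambda>k. sqnorm (\<lambda>s \<omega>. simple_value (m k) (\<tau> k) (\<eta> k) s \<omega> - X s \<omega>)) \<longlonglongrightarrow> 0"
    using simple_approximation[OF X] by blast
  have jm: "jointly_measurable X" by (rule bounded_progressive_jm[OF X])
  let ?V = "\<lambda>k. simple_value (m k) (\<tau> k) (\<eta> k)"
  let ?I = "\<lambda>k. simple_integral (m k) (\<tau> k) (\<eta> k)"
  have I[measurable]: "?I k \<in> borel_measurable Q" for k by (rule simple_integral_measurable_Q[OF sp])
  let ?d = "\<lambda>k. sqnorm (\<lambda>s \<omega>. ?V k s \<omega> - X s \<omega>)"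
  have jd: "jointly_measurable (\<lambda>s \<omega>. ?V k s \<omega> - X s \<omega>)" for k
    by (intro jointly_measurable_diff simple_value_jm sp jm)
  have jd': "jointly_measurable (\<lambda>s \<omega>. X s \<omega> - ?V k s \<omega>)" for k
    by (intro jointly_measurable_diff simple_value_jm sp jm)
  have diff: "(\<integral>\<^sup>+\<omega>. ennreal ((?I k \<omega> - ?I l \<omega>)\<^sup>2) \<partial>Q) \<le> of_nat CARD('d) * 3 * (?d k + ?d l)" for k l
  proof -
    \<comment> \<open>The three-term inequality is used with the zero process in the middle, so only
      the distances of both approximants to \<open>X\<close> remain.\<close>
    have "sqnorm (\<lambda>s \<omega>. ?V k s \<omega> - ?V l s \<omega>) \<le> 3 * (?d k + sqnorm (\<lambda>_ _. 0) + sqnorm (\<lambda>s \<omega>. X s \<omega> - ?V l s \<omega>))"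
      by (rule sqnorm_triangle[OF _ jd jointly_measurable_zero jd']) simp
    also have "\<dots> = 3 * (?d k + ?d l)" by (simp add: sqnorm_zero sqnorm_minus_commute[of X])
    finally have "of_nat CARD('d) * sqnorm (\<lambda>s \<omega>. ?V k s \<omega> - ?V l s \<omega>) \<le> of_nat CARD('d) * (3 * (?d k + ?d l))"
      by (rule mult_left_mono) simp
    then show ?thesis using simple_integral_isometry_sqnorm[OF sp[of k] sp[of l]] by (simp add: mult.assoc)
  qed
  have "\<exists>N. \<forall>k\<ge>N. \<forall>l\<ge>N. (\<integral>\<^sup>+\<omega>. ennreal ((?I k \<omega> - ?I l \<omega>)\<^sup>2) \<partial>Q) \<le> ennreal e" if e: "0 < e" for e :: real
  proof -
    have "(\<lambda>k. of_nat CARD('d) * 3 * ?d k) \<longlonglongrightarrow> 0"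
      by (intro ennreal_tendsto_0_cmult conv) (simp add: ennreal_mult_less_top of_nat_less_top)
    then have "\<forall>\<^sub>F k in sequentially. of_nat CARD('d) * 3 * ?d k < ennreal (e / 2)"
      using e by (intro order_tendstoD) auto
    then obtain N where N: "\<And>k. k \<ge> N \<Longrightarrow> of_nat CARD('d) * 3 * ?d k < ennreal (e / 2)"
      by (auto simp: eventually_sequentially)
    have "(\<integral>\<^sup>+\<omega>. ennreal ((?I k \<omega> - ?I l \<omega>)\<^sup>2) \<partial>Q) \<le> ennreal e" if "k \<ge> N" "l \<ge> N" for k l
    proof -
      have "(\<integral>\<^sup>+\<omega>. ennreal ((?I k \<omega> - ?I l \<omega>)\<^sup>2) \<partial>Q) \<le> of_nat CARD('d) * 3 * ?d k + of_nat CARD('d) * 3 * ?d l"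
        using diff[of k l] by (simp add: distrib_left)
      also have "\<dots> \<le> ennreal (e / 2) + ennreal (e / 2)"
        using N[OF that(1)] N[OF that(2)] by (intro add_mono less_imp_le)
      also have "\<dots> = ennreal e" using e by (simp add: ennreal_plus[symmetric] del: ennreal_plus)
      finally show ?thesis .
    qed
    then show ?thesis by blast
  qed
  from L2_complete[OF I this] obtain Y r where Y[measurable]: "Y \<in> borel_measurable Q" and r: "strict_mono (r :: nat \<Rightarrow> nat)"
    and AE: "AE \<omega> in Q. (\<lambda>k. ?I (r k) \<omega>) \<longlonglongrightarrow> Y \<omega>"
    and lim: "(\<lambda>k. \<integral>\<^sup>+\<omega>. ennreal ((?I k \<omega> - Y \<omega>)\<^sup>2) \<partial>Q) \<longlonglongrightarrow> 0" by blast
  have "Y \<in> borel_measurable (F T)" using Y measurable_cong_sets[OF sets_F_T refl] by blast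
  then have ito: "is_ito_integral T P X Y"
    unfolding is_ito_integral_def using sp conv[unfolded sqnorm_def] lim by blast
  moreover have "(\<integral>\<^sup>+\<omega>. ennreal (exp (c * Y \<omega>)) \<partial>Q) \<le> ennreal (exp (c\<^sup>2 * C\<^sup>2 * T / 2))" for c
  proof -
    have "(\<integral>\<^sup>+\<omega>. ennreal (exp (c * Y \<omega>)) \<partial>Q) = (\<integral>\<^sup>+\<omega>. liminf (\<lambda>k. ennreal (exp (c * ?I (r k) \<omega>))) \<partial>Q)"
    proof (rule nn_integral_cong_AE, use AE in eventually_elim)
      fix \<omega> assume "(\<lambda>k. ?I (r k) \<omega>) \<longlonglongrightarrow> Y \<omega>"
      then have "(\<lambda>k. ennreal (exp (c * ?I (r k) \<omega>))) \<longlonglongrightarrow> ennreal (exp (c * Y \<omega>))"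
        by (intro tendsto_ennrealI tendsto_exp tendsto_mult tendsto_const)
      then show "ennreal (exp (c * Y \<omega>)) = liminf (\<lambda>k. ennreal (exp (c * ?I (r k) \<omega>)))"
        by (rule lim_imp_Liminf[OF trivial_limit_sequentially, symmetric])
    qed
    also have "\<dots> \<le> liminf (\<lambda>k. \<integral>\<^sup>+\<omega>. ennreal (exp (c * ?I (r k) \<omega>)) \<partial>Q)"
      by (rule nn_integral_liminf) measurable
    also have "\<dots> \<le> liminf (\<lambda>k. ennreal (exp (c\<^sup>2 * C\<^sup>2 * T / 2)))"
    proof (rule Liminf_mono, rule always_eventually, rule allI)
      fix k
      have t: "\<tau> (r k) 0 = 0" "\<tau> (r k) (m (r k)) = T" "\<forall>j<m (r k). \<tau> (r k) j < \<tau> (r k) (Suc j)"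
        "\<And>j. j < m (r k) \<Longrightarrow> \<eta> (r k) j \<in> borel_measurable (F (\<tau> (r k) j))"
        using sp[of "r k"] by (auto simp: simple_process_def)
      show "(\<integral>\<^sup>+\<omega>. ennreal (exp (c * ?I (r k) \<omega>)) \<partial>Q) \<le> ennreal (exp (c\<^sup>2 * C\<^sup>2 * T / 2))"
        using simple_integral_exp_moment[OF t(3) _ _ t(4) order_refl bd, of c] t(1,2) by simp
    qed
    also have "\<dots> = ennreal (exp (c\<^sup>2 * C\<^sup>2 * T / 2))" by (simp add: Liminf_const)
    finally show ?thesis .
  qed
  ultimately show ?thesis using that by blast
qed

lemma is_ito_integral_measurable:
  "is_ito_integral T P X Y \<Longrightarrow> Y \<in> borel_measurable Q"
  using measurable_cong_sets[OF sets_F_T refl] unfolding is_ito_integral_def by blast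

text \<open>Holds for arbitrary versions with arbitrary approximating sequences. The factor 9 is one
  factor 3 from inserting the two simple integrals and another from inserting the two integrands;
  all errors of approximation vanish in the limit. With \<open>X' = X\<close> it is uniqueness up to
  null sets.\<close>

lemma is_ito_integral_dist:
  assumes Y: "is_ito_integral T P X Y" and Y': "is_ito_integral T P X' Y'"
    and jm: "jointly_measurable X" "jointly_measurable X'"
  shows "(\<integral>\<^sup>+\<omega>. ennreal ((Y \<omega> - Y' \<omega>)\<^sup>2) \<partial>Q) \<le> 9 * of_nat CARD('d) * sqnorm (\<lambda>s \<omega>. X s \<omega> - X' s \<omega>)"
proof -
  obtain m \<tau> \<eta> where sp: "\<And>k. simple_process T P (m k) (\<tau> k) (\<eta> k)"
    and conv: "(\<lambda>k. sqnorm (\<lambda>s \<omega>. simple_value (m k) (\<tau> k) (\<eta> k) s \<omega> - X s \<omega>)) \<longlonglongrightarrow> 0"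
    and lim: "(\<lambda>k. \<integral>\<^sup>+\<omega>. ennreal ((simple_integral (m k) (\<tau> k) (\<eta> k) \<omega> - Y \<omega>)\<^sup>2) \<partial>Q) \<longlonglongrightarrow> 0"
    using Y unfolding is_ito_integral_def sqnorm_def by blast
  obtain m' \<tau>' \<eta>' where sp': "\<And>k. simple_process T P (m' k) (\<tau>' k) (\<eta>' k)"
    and conv': "(\<lambda>k. sqnorm (\<lambda>s \<omega>. simple_value (m' k) (\<tau>' k) (\<eta>' k) s \<omega> - X' s \<omega>)) \<longlonglongrightarrow> 0"
    and lim': "(\<lambda>k. \<integral>\<^sup>+\<omega>. ennreal ((simple_integral (m' k) (\<tau>' k) (\<eta>' k) \<omega> - Y' \<omega>)\<^sup>2) \<partial>Q) \<longlonglongrightarrow> 0"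
    using Y' unfolding is_ito_integral_def sqnorm_def by blast
  let ?V = "\<lambda>k. simple_value (m k) (\<tau> k) (\<eta> k)" and ?V' = "\<lambda>k. simple_value (m' k) (\<tau>' k) (\<eta>' k)"
  let ?I = "\<lambda>k. simple_integral (m k) (\<tau> k) (\<eta> k)" and ?I' = "\<lambda>k. simple_integral (m' k) (\<tau>' k) (\<eta>' k)"
  have [measurable]: "?I k \<in> borel_measurable Q" "?I' k \<in> borel_measurable Q" for k
    by (rule simple_integral_measurable_Q[OF sp] simple_integral_measurable_Q[OF sp'])+
  have [measurable]: "Y \<in> borel_measurable Q" "Y' \<in> borel_measurable Q"
    using is_ito_integral_measurable Y Y' by blast+
  let ?e = "\<lambda>k. \<integral>\<^sup>+\<omega>. ennreal ((?I k \<omega> - Y \<omega>)\<^sup>2) \<partial>Q" and ?e' = "\<lambda>k. \<integral>\<^sup>+\<omega>. ennreal ((?I' k \<omega> - Y' \<omega>)\<^sup>2) \<partial>Q"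
  let ?d = "\<lambda>k. sqnorm (\<lambda>s \<omega>. ?V k s \<omega> - X s \<omega>)" and ?d' = "\<lambda>k. sqnorm (\<lambda>s \<omega>. ?V' k s \<omega> - X' s \<omega>)"
  let ?x = "sqnorm (\<lambda>s \<omega>. X s \<omega> - X' s \<omega>)" and ?n = "of_nat CARD('d) :: ennreal"
  have le: "(\<integral>\<^sup>+\<omega>. ennreal ((Y \<omega> - Y' \<omega>)\<^sup>2) \<partial>Q) \<le> 3 * ?e k + 3 * ?e' k + 9 * ?n * (?d k) + 9 * ?n * ?d' k + 9 * ?n * ?x" for k
  proof -
    have "(\<integral>\<^sup>+\<omega>. ennreal ((Y \<omega> - Y' \<omega>)\<^sup>2) \<partial>Q) \<le>
      (\<integral>\<^sup>+\<omega>. 3 * (ennreal ((?I k \<omega> - Y \<omega>)\<^sup>2) + ennreal ((?I k \<omega> - ?I' k \<omega>)\<^sup>2) + ennreal ((?I' k \<omega> - Y' \<omega>)\<^sup>2)) \<partial>Q)"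
    proof (rule nn_integral_mono)
      fix \<omega>
      have "(Y \<omega> - Y' \<omega>)\<^sup>2 \<le> 3 * ((Y \<omega> - ?I k \<omega>)\<^sup>2 + (?I k \<omega> - ?I' k \<omega>)\<^sup>2 + (?I' k \<omega> - Y' \<omega>)\<^sup>2)"
        using square_sum3_le[of "Y \<omega> - ?I k \<omega>" "?I k \<omega> - ?I' k \<omega>" "?I' k \<omega> - Y' \<omega>"] by simp
      then have "ennreal ((Y \<omega> - Y' \<omega>)\<^sup>2) \<le> ennreal (3 * ((?I k \<omega> - Y \<omega>)\<^sup>2 + (?I k \<omega> - ?I' k \<omega>)\<^sup>2 + (?I' k \<omega> - Y' \<omega>)\<^sup>2))"
        by (intro ennreal_leI) (simp add: power2_commute[of "Y \<omega>"])
      then show "ennreal ((Y \<omega> - Y' \<omega>)\<^sup>2) \<le>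
        3 * (ennreal ((?I k \<omega> - Y \<omega>)\<^sup>2) + ennreal ((?I k \<omega> - ?I' k \<omega>)\<^sup>2) + ennreal ((?I' k \<omega> - Y' \<omega>)\<^sup>2))"
        by (simp add: ennreal_mult)
    qed
    also have "\<dots> = 3 * (?e k + (\<integral>\<^sup>+\<omega>. ennreal ((?I k \<omega> - ?I' k \<omega>)\<^sup>2) \<partial>Q) + ?e' k)"
      by (subst nn_integral_cmult) (simp_all add: nn_integral_add)
    also have "\<dots> \<le> 3 * (?e k + ?n * (3 * (?d k + ?x + ?d' k)) + ?e' k)"
    proof (intro mult_left_mono add_mono order_refl)
      have "sqnorm (\<lambda>s \<omega>. ?V k s \<omega> - ?V' k s \<omega>) \<le> 3 * (?d k + ?x + sqnorm (\<lambda>s \<omega>. X' s \<omega> - ?V' k s \<omega>))"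
        by (rule sqnorm_triangle) (auto intro!: jointly_measurable_diff simple_value_jm sp sp' jm)
      also have "\<dots> = 3 * (?d k + ?x + ?d' k)" by (simp add: sqnorm_minus_commute[of X'])
      finally have "?n * sqnorm (\<lambda>s \<omega>. ?V k s \<omega> - ?V' k s \<omega>) \<le> ?n * (3 * (?d k + ?x + ?d' k))"
        by (rule mult_left_mono) simp
      then show "(\<integral>\<^sup>+\<omega>. ennreal ((?I k \<omega> - ?I' k \<omega>)\<^sup>2) \<partial>Q) \<le> ?n * (3 * (?d k + ?x + ?d' k))"
        using simple_integral_isometry_sqnorm[OF sp[of k] sp'[of k]] by simp
    qed simp
    also have "\<dots> = 3 * ?e k + 3 * ?e' k + 3 * ?n * 3 * (?d k) + 3 * ?n * 3 * ?d' k + 3 * ?n * 3 * ?x"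
      by (simp add: distrib_left mult.assoc add.assoc add.commute add.left_commute)
    also have "3 * ?n * 3 = 9 * ?n" by (simp add: mult.commute mult.left_commute mult.assoc[symmetric])
    finally show ?thesis .
  qed
  have n: "9 * ?n < top" by (simp add: ennreal_mult_less_top of_nat_less_top)
  have "(\<lambda>k. 3 * ?e k + 3 * ?e' k + 9 * ?n * (?d k) + 9 * ?n * ?d' k + 9 * ?n * ?x) \<longlonglongrightarrow> 0 + 0 + 0 + 0 + 9 * ?n * ?x"
    by (intro tendsto_add tendsto_const ennreal_tendsto_0_cmult lim lim' conv conv' n) auto
  then have "(\<lambda>k. 3 * ?e k + 3 * ?e' k + 9 * ?n * (?d k) + 9 * ?n * ?d' k + 9 * ?n * ?x) \<longlonglongrightarrow> 9 * ?n * ?x" by simp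
  then show ?thesis by (rule LIMSEQ_le_const) (use le in blast)
qed

text \<open>\<open>ito_integral\<close> is a choice about which only the defining property is known.
  Uniqueness identifies it almost everywhere with the version constructed before, and the
  exponential moments follow it there.\<close>

lemma ito_integral:
  assumes X: "bounded_progressive C X"
  shows "is_ito_integral T P X (ito_integral T P X)"
    and "ito_integral T P X \<in> borel_measurable Q"
    and "(\<integral>\<^sup>+\<omega>. ennreal (exp (c * ito_integral T P X \<omega>)) \<partial>Q) \<le> ennreal (exp (c\<^sup>2 * C\<^sup>2 * T / 2))"
proof -
  obtain Y where Y: "is_ito_integral T P X Y"
    and eY: "\<And>c. (\<integral>\<^sup>+\<omega>. ennreal (exp (c * Y \<omega>)) \<partial>Q) \<le> ennreal (exp (c\<^sup>2 * C\<^sup>2 * T / 2))"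
    using is_ito_integral_exists[OF X] by blast
  let ?Y = "ito_integral T P X"
  show Y': "is_ito_integral T P X ?Y" unfolding ito_integral_def using Y by (rule someI[of "is_ito_integral T P X"])
  show m[measurable]: "?Y \<in> borel_measurable Q" by (rule is_ito_integral_measurable[OF Y'])
  have m': "Y \<in> borel_measurable Q" by (rule is_ito_integral_measurable[OF Y])
  note m'[measurable]
  have "(\<integral>\<^sup>+\<omega>. ennreal ((?Y \<omega> - Y \<omega>)\<^sup>2) \<partial>Q) \<le> 9 * of_nat CARD('d) * sqnorm (\<lambda>s \<omega>. X s \<omega> - X s \<omega>)"
    using bounded_progressive_jm[OF X] by (intro is_ito_integral_dist Y Y')
  then have "(\<integral>\<^sup>+\<omega>. ennreal ((?Y \<omega> - Y \<omega>)\<^sup>2) \<partial>Q) = 0" by (simp add: sqnorm_zero)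
  then have "AE \<omega> in Q. ennreal ((?Y \<omega> - Y \<omega>)\<^sup>2) = 0" by (subst (asm) nn_integral_0_iff_AE) auto
  then have "AE \<omega> in Q. ?Y \<omega> = Y \<omega>" by eventually_elim (simp add: ennreal_eq_0_iff)
  then have "(\<integral>\<^sup>+\<omega>. ennreal (exp (c * ?Y \<omega>)) \<partial>Q) = (\<integral>\<^sup>+\<omega>. ennreal (exp (c * Y \<omega>)) \<partial>Q)"
    by (intro nn_integral_cong_AE) (auto elim: eventually_mono)
  then show "(\<integral>\<^sup>+\<omega>. ennreal (exp (c * ?Y \<omega>)) \<partial>Q) \<le> ennreal (exp (c\<^sup>2 * C\<^sup>2 * T / 2))" using eY by simp
qed

end

section \<open>Stability of costs under perturbation of drift and payoff\<close>

text \<open>From \<open>1 + x \<le> exp x\<close>. The sum of both exponentials serves as a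
  Lipschitz factor that does not depend on which argument is larger.\<close>

lemma exp_diff_le:
  fixes x y :: real
  shows "\<bar>exp x - exp y\<bar> \<le> (exp x + exp y) * \<bar>x - y\<bar>"
proof -
  have *: "\<bar>exp x - exp y\<bar> \<le> exp y * (y - x)" if "x \<le> y" for x y :: real
  proof -
    have "exp y * (1 + (x - y)) \<le> exp y * exp (x - y)" by (intro mult_left_mono exp_ge_add_one_self) auto
    also have "\<dots> = exp x" by (simp add: exp_diff)
    finally show ?thesis using that by (simp add: abs_if algebra_simps)
  qed
  show ?thesis
  proof (cases "x \<le> y")
    case True
    have "exp y * (y - x) \<le> (exp x + exp y) * (y - x)" using True by (intro mult_right_mono) auto
    moreover have "\<bar>x - y\<bar> = y - x" using True by simp
    ultimately show ?thesis using *[OF True] by simp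
  next
    case False
    have "\<bar>exp x - exp y\<bar> \<le> exp x * (x - y)"
      using *[of y x] False by (simp add: abs_minus_commute)
    also have "\<dots> \<le> (exp x + exp y) * (x - y)" using False by (intro mult_right_mono) auto
    finally show ?thesis using False by simp
  qed
qed

text \<open>Young's inequality with a free weight and an unsharp constant. A small \<open>l\<close>
  will sit on the exponentials, whose second moments are merely bounded, and \<open>1 / l\<close> on
  differences that can be made small.\<close>

lemma mult_le_weighted_squares:
  fixes u v l :: real
  assumes "0 < l" shows "u * v \<le> l * u\<^sup>2 + v\<^sup>2 / l"
proof -
  have "0 \<le> (l * u - v)\<^sup>2 + (l * u)\<^sup>2 + v\<^sup>2" by simp
  then have "l * (u * v) \<le> l * (l * u\<^sup>2 + v\<^sup>2 / l)"
    using assms by (simp add: power2_eq_square algebra_simps)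
  then show ?thesis using assms by simp
qed

text \<open>To be read with \<open>y\<close> an Ito integral, \<open>q\<close> its quadratic
  variation and \<open>p\<close> a payoff. The right side consists of exponentials with the weight
  \<open>l\<close> and of squared differences with the weight \<open>1 / l\<close>; each of these
  has a known expectation bound.\<close>

lemma weighted_difference_le:
  fixes C l :: real
  assumes C: "\<bar>p\<bar> \<le> C" and l: "0 < l" and q: "0 \<le> q" "0 \<le> q'"
  shows "\<bar>exp (y - q / 2) * p - exp (y' - q' / 2) * p'\<bar> \<le>
    l * (2 * C * exp (2 * y) + (2 * C + 1) * exp (2 * y')) + (C * (2 * (y - y')\<^sup>2 + (q - q')\<^sup>2 / 2) + (p - p')\<^sup>2) / l"
proof -
  define D where "D = exp (y - q / 2)"
  define D' where "D' = exp (y' - q' / 2)"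
  define r where "r = \<bar>(y - q / 2) - (y' - q' / 2)\<bar>"
  have C0: "0 \<le> C" using C by simp
  have sq: "exp (2 * z) = (exp z)\<^sup>2" for z :: real by (simp add: power2_eq_square exp_add[symmetric])
  have D2: "D\<^sup>2 \<le> exp (2 * y)" "D'\<^sup>2 \<le> exp (2 * y')"
    unfolding sq D_def D'_def using q by (auto intro!: power_mono)
  have r2: "r\<^sup>2 \<le> 2 * (y - y')\<^sup>2 + (q - q')\<^sup>2 / 2"
  proof -
    have "(a - b / 2)\<^sup>2 \<le> 2 * a\<^sup>2 + b\<^sup>2 / 2" for a b :: real
    proof -
      have "0 \<le> (a + b / 2)\<^sup>2" by simp
      then show ?thesis by (simp add: power2_eq_square field_simps)
    qed
    from this[of "y - y'" "q - q'"] show ?thesis unfolding r_def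
      by (simp add: diff_divide_distrib algebra_simps)
  qed
  \<comment> \<open>The split puts the bounded payoff \<open>p\<close> on the difference of
    densities and keeps \<open>D'\<close> on the difference of payoffs, so a bound is used for one
    payoff only.\<close>
  have "D * p - D' * p' = (D - D') * p + D' * (p - p')" by (simp add: algebra_simps)
  then have "\<bar>D * p - D' * p'\<bar> \<le> \<bar>D - D'\<bar> * \<bar>p\<bar> + D' * \<bar>p - p'\<bar>"
    using abs_triangle_ineq[of "(D - D') * p" "D' * (p - p')"] by (simp add: abs_mult D'_def)
  also have "\<dots> \<le> \<bar>D - D'\<bar> * C + D' * \<bar>p - p'\<bar>" using C by (intro add_right_mono mult_left_mono) auto
  also have "\<dots> \<le> ((D + D') * r) * C + D' * \<bar>p - p'\<bar>"
    using exp_diff_le[of "y - q / 2" "y' - q' / 2"] C0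
    unfolding D_def D'_def r_def by (intro add_right_mono mult_right_mono) auto
  also have "\<dots> \<le> (l * (D + D')\<^sup>2 + r\<^sup>2 / l) * C + (l * D'\<^sup>2 + (\<bar>p - p'\<bar>)\<^sup>2 / l)"
    by (intro add_mono mult_right_mono mult_le_weighted_squares l C0)
  also have "\<dots> \<le> (l * (2 * exp (2 * y) + 2 * exp (2 * y')) + (2 * (y - y')\<^sup>2 + (q - q')\<^sup>2 / 2) / l) * C + (l * exp (2 * y') + (\<bar>p - p'\<bar>)\<^sup>2 / l)"
  proof (intro add_mono mult_right_mono mult_left_mono divide_right_mono r2 C0 order_refl D2)
    have "0 \<le> (D - D')\<^sup>2" by simp
    then have "(D + D')\<^sup>2 \<le> 2 * D\<^sup>2 + 2 * D'\<^sup>2" by (simp add: power2_eq_square algebra_simps)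
    then show "(D + D')\<^sup>2 \<le> 2 * exp (2 * y) + 2 * exp (2 * y')" using D2 by simp
  qed (use l in auto)
  also have "\<dots> = l * (2 * C * exp (2 * y) + (2 * C + 1) * exp (2 * y')) + (C * (2 * (y - y')\<^sup>2 + (q - q')\<^sup>2 / 2) + (p - p')\<^sup>2) / l"
    using l by (simp add: field_simps)
  finally show ?thesis unfolding D_def D'_def .
qed

section \<open>Costs under a Girsanov density as functions of drift and payoff\<close>

context wiener begin

definition quad_var :: "(real \<Rightarrow> 'd path \<Rightarrow> real ^ 'd) \<Rightarrow> 'd path \<Rightarrow> real" where
  "quad_var X \<omega> = (LBINT s:{0..T}. (norm (X s \<omega>))\<^sup>2)"

text \<open>Separates how a cost depends on a drift and a payoff from the game that produces them.
  Each component of \<open>game_cost\<close> has this form.\<close>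

definition drift_cost :: "(real \<Rightarrow> 'd path \<Rightarrow> real ^ 'd) \<Rightarrow> ('d path \<Rightarrow> real) \<Rightarrow> real" where
  "drift_cost X \<Phi> = integral\<^sup>L (density Q (\<lambda>\<omega>. ennreal (exp (ito_integral T P X \<omega> - (1/2) * quad_var X \<omega>)))) \<Phi>"

lemma quad_var_integrable:
  assumes X: "bounded_progressive C X" and \<omega>: "\<omega> \<in> path_space T"
  shows "integrable lborel (\<lambda>s. indicator {0..T} s *\<^sub>R (norm (X s \<omega>))\<^sup>2)"
proof (rule Bochner_Integration.integrable_bound[where f="\<lambda>s. C\<^sup>2 * indicator {0..T} s"])
  show "integrable lborel (\<lambda>s. C\<^sup>2 * indicator {0..T} s)"
    by (intro integrable_mult_right integrable_real_indicator) (auto simp: emeasure_lborel_Icc_eq)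
  have "(\<lambda>s. indicator {0..T} s *\<^sub>R X s \<omega>) \<in> borel_measurable lborel"
    using measurable_Pair2[OF bounded_progressive_jm[OF X, unfolded jointly_measurable_def], of \<omega>] \<omega> by simp
  then have "(\<lambda>s. (norm (indicator {0..T} s *\<^sub>R X s \<omega>))\<^sup>2) \<in> borel_measurable lborel"
    by (rule borel_measurable_power[OF measurable_compose[OF _ borel_measurable_norm]])
  also have "(\<lambda>s. (norm (indicator {0..T} s *\<^sub>R X s \<omega>))\<^sup>2) = (\<lambda>s. indicator {0..T} s *\<^sub>R (norm (X s \<omega>))\<^sup>2)"
    by (auto simp: fun_eq_iff indicator_def)
  finally show "(\<lambda>s. indicator {0..T} s *\<^sub>R (norm (X s \<omega>))\<^sup>2) \<in> borel_measurable lborel" .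
  show "AE s in lborel. norm (indicator {0..T} s *\<^sub>R (norm (X s \<omega>))\<^sup>2) \<le> norm (C\<^sup>2 * indicator {0..T} s)"
  proof (rule AE_I2)
    fix s
    show "norm (indicator {0..T} s *\<^sub>R (norm (X s \<omega>))\<^sup>2) \<le> norm (C\<^sup>2 * indicator {0..T} s)"
    proof (cases "s \<in> {0..T}")
      case True
      then have "(norm (X s \<omega>))\<^sup>2 \<le> C\<^sup>2" using X \<omega> by (intro power_mono) (auto simp: bounded_progressive_def)
      then show ?thesis using True by simp
    qed simp
  qed
qed

lemma quad_var_nonneg: "0 \<le> quad_var X \<omega>"
  unfolding quad_var_def set_lebesgue_integral_def by (intro Bochner_Integration.integral_nonneg) auto

lemma quad_var_measurable:
  assumes X: "jointly_measurable X"
  shows "quad_var X \<in> borel_measurable Q"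
proof -
  have "(\<lambda>x. (norm ((\<lambda>(\<omega>, s). indicator {0..T} s *\<^sub>R X s \<omega>) x))\<^sup>2) \<in> borel_measurable (Q \<Otimes>\<^sub>M lborel)"
    using X unfolding jointly_measurable_def by measurable
  also have "(\<lambda>x. (norm ((\<lambda>(\<omega>, s). indicator {0..T} s *\<^sub>R X s \<omega>) x))\<^sup>2) = (\<lambda>(\<omega>, s). indicator {0..T} s *\<^sub>R (norm (X s \<omega>))\<^sup>2)"
    by (auto simp: fun_eq_iff indicator_def)
  finally show ?thesis unfolding quad_var_def set_lebesgue_integral_def
    by (rule lborel.borel_measurable_lebesgue_integral)
qed

lemma norm_square_diff_le:
  fixes x y :: "real ^ 'd"
  assumes "norm x \<le> C" "norm y \<le> C"
  shows "\<bar>(norm x)\<^sup>2 - (norm y)\<^sup>2\<bar> \<le> 2 * C * norm (x - y)"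
proof -
  have "\<bar>(norm x)\<^sup>2 - (norm y)\<^sup>2\<bar> = (norm x + norm y) * \<bar>norm x - norm y\<bar>"
    by (simp add: power2_eq_square square_diff_square_factored abs_mult)
  also have "\<dots> \<le> (2 * C) * norm (x - y)"
    using assms norm_triangle_ineq3[of x y] by (intro mult_mono) (auto intro: order_trans[OF norm_ge_zero])
  finally show ?thesis .
qed

text \<open>On the ball of radius \<open>C\<close> the squared norm is Lipschitz with constant
  \<open>2 * C\<close>. Cauchy-Schwarz against the indicator of \<open>{0..T}\<close> adds the
  factor \<open>T\<close>.\<close>

lemma quad_var_diff:
  assumes X: "bounded_progressive C X" and X': "bounded_progressive C X'" and \<omega>: "\<omega> \<in> path_space T"
  shows "ennreal ((quad_var X \<omega> - quad_var X' \<omega>)\<^sup>2)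
    \<le> ennreal (4 * C\<^sup>2 * T) * (\<integral>\<^sup>+s\<in>{0..T}. ennreal ((norm (X s \<omega> - X' s \<omega>))\<^sup>2) \<partial>lborel)"
proof -
  note i = quad_var_integrable[OF X \<omega>] and i' = quad_var_integrable[OF X' \<omega>]
  have "norm (X 0 \<omega>) \<le> C" using X \<omega> T_pos by (simp add: bounded_progressive_def)
  then have C0: "0 \<le> C" by (rule order_trans[OF norm_ge_zero])
  have jm: "(\<lambda>s. indicator {0..T} s *\<^sub>R (X s \<omega> - X' s \<omega>)) \<in> borel_measurable lborel"
    using measurable_Pair2[OF jointly_measurable_diff[OF bounded_progressive_jm[OF X] bounded_progressive_jm[OF X'], unfolded jointly_measurable_def], of \<omega>] \<omega> by simp
  let ?h = "\<lambda>s. ennreal (2 * C * norm (indicator {0..T} s *\<^sub>R (X s \<omega> - X' s \<omega>)))"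
  have hm: "?h \<in> borel_measurable lborel" using jm by measurable
  have "ennreal \<bar>quad_var X \<omega> - quad_var X' \<omega>\<bar> \<le> (\<integral>\<^sup>+s. ?h s * indicator {0..T} s \<partial>lborel)"
  proof -
    have "quad_var X \<omega> - quad_var X' \<omega> = (\<integral>s. indicator {0..T} s *\<^sub>R (norm (X s \<omega>))\<^sup>2 - indicator {0..T} s *\<^sub>R (norm (X' s \<omega>))\<^sup>2 \<partial>lborel)"
      unfolding quad_var_def set_lebesgue_integral_def by (rule Bochner_Integration.integral_diff[OF i i', symmetric])
    then have "ennreal \<bar>quad_var X \<omega> - quad_var X' \<omega>\<bar> =
        ennreal (norm (\<integral>s. indicator {0..T} s *\<^sub>R (norm (X s \<omega>))\<^sup>2 - indicator {0..T} s *\<^sub>R (norm (X' s \<omega>))\<^sup>2 \<partial>lborel))"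
      by (simp only: real_norm_def)
    also have "\<dots> \<le> (\<integral>\<^sup>+s. norm (indicator {0..T} s *\<^sub>R (norm (X s \<omega>))\<^sup>2 - indicator {0..T} s *\<^sub>R (norm (X' s \<omega>))\<^sup>2) \<partial>lborel)"
      by (intro integral_norm_bound_ennreal Bochner_Integration.integrable_diff i i')
    also have "\<dots> \<le> (\<integral>\<^sup>+s. ?h s * indicator {0..T} s \<partial>lborel)"
    proof (rule nn_integral_mono)
      fix s
      show "ennreal (norm (indicator {0..T} s *\<^sub>R (norm (X s \<omega>))\<^sup>2 - indicator {0..T} s *\<^sub>R (norm (X' s \<omega>))\<^sup>2)) \<le> ?h s * indicator {0..T} s"
      proof (cases "s \<in> {0..T}")
        case True
        then have "norm (X s \<omega>) \<le> C" "norm (X' s \<omega>) \<le> C" using X X' \<omega> by (auto simp: bounded_progressive_def)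
        from norm_square_diff_le[OF this] show ?thesis using True by (simp add: ennreal_leI)
      qed simp
    qed
    finally show ?thesis .
  qed
  then have "(ennreal \<bar>quad_var X \<omega> - quad_var X' \<omega>\<bar>)\<^sup>2 \<le> (\<integral>\<^sup>+s. ?h s * indicator {0..T} s \<partial>lborel)\<^sup>2"
    by (intro power_mono) auto
  also have "\<dots> \<le> (\<integral>\<^sup>+s. (?h s)\<^sup>2 \<partial>lborel) * (\<integral>\<^sup>+s. (indicator {0..T} s)\<^sup>2 \<partial>lborel)"
    using hm by (intro Cauchy_Schwarz_nn_integral) auto
  also have "(\<integral>\<^sup>+s. (indicator {0..T} s)\<^sup>2 \<partial>lborel) = (\<integral>\<^sup>+s. indicator {0..T} s \<partial>(lborel :: real measure))"
    by (intro nn_integral_cong) (simp add: indicator_def)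
  also have "\<dots> = ennreal T" using T_pos by simp
  also have "(\<integral>\<^sup>+s. (?h s)\<^sup>2 \<partial>lborel) = (\<integral>\<^sup>+s. ennreal (4 * C\<^sup>2) * (ennreal ((norm (X s \<omega> - X' s \<omega>))\<^sup>2) * indicator {0..T} s) \<partial>lborel)"
    using C0 by (intro nn_integral_cong) (auto simp: indicator_def ennreal_power ennreal_mult[symmetric] power_mult_distrib)
  also have "\<dots> = ennreal (4 * C\<^sup>2) * (\<integral>\<^sup>+s\<in>{0..T}. ennreal ((norm (X s \<omega> - X' s \<omega>))\<^sup>2) \<partial>lborel)"
    using measurable_Pair2[OF jointly_measurable_norm_power[OF jointly_measurable_diff[OF bounded_progressive_jm[OF X] bounded_progressive_jm[OF X']]], of \<omega>] \<omega>
    by (intro nn_integral_cmult) simp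
  finally show ?thesis using T_pos by (simp add: ennreal_power ennreal_mult ac_simps)
qed

text \<open>Dropping the nonnegative quadratic variation bounds the density by the exponential of
  the Ito integral, whose expectation is finite.\<close>

lemma drift_cost_eq:
  assumes X: "bounded_progressive C X" and \<Phi>: "\<Phi> \<in> borel_measurable Q"
    and C: "\<And>\<omega>. \<omega> \<in> path_space T \<Longrightarrow> \<bar>\<Phi> \<omega>\<bar> \<le> C"
  shows "drift_cost X \<Phi> = (\<integral>\<omega>. exp (ito_integral T P X \<omega> - quad_var X \<omega> / 2) * \<Phi> \<omega> \<partial>Q)"
    and "integrable Q (\<lambda>\<omega>. exp (ito_integral T P X \<omega> - quad_var X \<omega> / 2) * \<Phi> \<omega>)"
proof -
  note \<Phi>[measurable] ito_integral(2)[OF X, measurable] quad_var_measurable[OF bounded_progressive_jm[OF X], measurable]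
  show "drift_cost X \<Phi> = (\<integral>\<omega>. exp (ito_integral T P X \<omega> - quad_var X \<omega> / 2) * \<Phi> \<omega> \<partial>Q)"
    unfolding drift_cost_def by (subst integral_density) auto
  show "integrable Q (\<lambda>\<omega>. exp (ito_integral T P X \<omega> - quad_var X \<omega> / 2) * \<Phi> \<omega>)"
  proof (rule integrableI_bounded)
    have "(\<integral>\<^sup>+\<omega>. ennreal (norm (exp (ito_integral T P X \<omega> - quad_var X \<omega> / 2) * \<Phi> \<omega>)) \<partial>Q)
      \<le> (\<integral>\<^sup>+\<omega>. ennreal C * ennreal (exp (1 * ito_integral T P X \<omega>)) \<partial>Q)"
    proof (rule nn_integral_mono)
      fix \<omega> assume "\<omega> \<in> space Q"
      then have "\<bar>\<Phi> \<omega>\<bar> \<le> C" using C by simp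
      moreover have "exp (ito_integral T P X \<omega> - quad_var X \<omega> / 2) \<le> exp (ito_integral T P X \<omega>)"
        using quad_var_nonneg[of X \<omega>] by simp
      ultimately have "exp (ito_integral T P X \<omega> - quad_var X \<omega> / 2) * \<bar>\<Phi> \<omega>\<bar> \<le> exp (ito_integral T P X \<omega>) * C"
        by (intro mult_mono) auto
      moreover have "0 \<le> C" using \<open>\<bar>\<Phi> \<omega>\<bar> \<le> C\<close> by simp
      ultimately show "ennreal (norm (exp (ito_integral T P X \<omega> - quad_var X \<omega> / 2) * \<Phi> \<omega>)) \<le> ennreal C * ennreal (exp (1 * ito_integral T P X \<omega>))"
        by (simp add: ennreal_mult[symmetric] abs_mult mult.commute ennreal_leI)
    qed
    also have "\<dots> = ennreal C * (\<integral>\<^sup>+\<omega>. ennreal (exp (1 * ito_integral T P X \<omega>)) \<partial>Q)"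
      by (rule nn_integral_cmult) measurable
    also have "\<dots> \<le> ennreal C * ennreal (exp (1\<^sup>2 * C\<^sup>2 * T / 2))"
      by (intro mult_left_mono ito_integral(3)[OF X]) simp
    also have "\<dots> < \<infinity>" by (simp add: ennreal_mult_less_top)
    finally show "(\<integral>\<^sup>+\<omega>. ennreal (norm (exp (ito_integral T P X \<omega> - quad_var X \<omega> / 2) * \<Phi> \<omega>)) \<partial>Q) < \<infinity>" .
  qed measurable
qed

text \<open>\<delta> is fixed by \<open>C\<close> and \<open>e\<close> before drifts and payoffs
  appear. This order of choices is the uniformity in the control.\<close>

lemma drift_cost_stability:
  fixes C e :: real
  assumes C: "0 \<le> C" and e: "0 < e"
  obtains \<delta> where "0 < \<delta>"
    "\<And>X X' \<Phi> \<Phi>'. bounded_progressive C X \<Longrightarrow> bounded_progressive C X' \<Longrightarrow>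
      \<Phi> \<in> borel_measurable Q \<Longrightarrow> \<Phi>' \<in> borel_measurable Q \<Longrightarrow>
      (\<And>\<omega>. \<omega> \<in> path_space T \<Longrightarrow> \<bar>\<Phi> \<omega>\<bar> \<le> C) \<Longrightarrow> (\<And>\<omega>. \<omega> \<in> path_space T \<Longrightarrow> \<bar>\<Phi>' \<omega>\<bar> \<le> C) \<Longrightarrow>
      sqnorm (\<lambda>s \<omega>. X s \<omega> - X' s \<omega>) \<le> ennreal \<delta> \<Longrightarrow>
      (\<integral>\<^sup>+\<omega>. ennreal ((\<Phi> \<omega> - \<Phi>' \<omega>)\<^sup>2) \<partial>Q) \<le> ennreal \<delta> \<Longrightarrow>
      \<bar>drift_cost X \<Phi> - drift_cost X' \<Phi>'\<bar> \<le> e"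
proof -
  \<comment> \<open>The bound on the expectation of \<open>exp (2 * Y)\<close> for the Ito integral
    \<open>Y\<close> of a drift bounded by \<open>C\<close>.\<close>
  define G where "G = exp (2\<^sup>2 * C\<^sup>2 * T / 2)"
  \<comment> \<open>The two exponentials enter with weights \<open>2 * C\<close> and
    \<open>2 * C + 1\<close>; this \<open>l\<close> lets them contribute \<open>e / 2\<close>
    together.\<close>
  define l where "l = e / (2 * ((4 * C + 1) * G))"
  \<comment> \<open>Collects what stands over \<open>l\<close>: the Ito difference with factor
    \<open>2 * C\<close> and distance constant \<open>9 * CARD('d)\<close>, the quadratic variations
    with \<open>C / 2\<close> and \<open>4 * C\<^sup>2 * T\<close>, and the payoffs with 1. \<delta>
    is then chosen to make their total \<open>e / 2\<close>.\<close>
  define K where "K = C * (2 * (9 * real CARD('d)) + 4 * C\<^sup>2 * T / 2) + 1"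
  define \<delta> where "\<delta> = l * e / (2 * K)"
  have G: "0 < G" by (simp add: G_def)
  have l: "0 < l" "l * ((4 * C + 1) * G) = e / 2" using e C G by (auto simp: l_def)
  have K: "0 < K" unfolding K_def using C T_pos by (intro add_nonneg_pos mult_nonneg_nonneg add_nonneg_nonneg) auto
  have \<delta>: "0 < \<delta>" "K * \<delta> / l = e / 2" using l K e by (auto simp: \<delta>_def)
  show ?thesis
  proof (rule that[OF \<delta>(1)])
    fix X X' :: "real \<Rightarrow> 'd path \<Rightarrow> real ^ 'd" and \<Phi> \<Phi>'
    assume X: "bounded_progressive C X" and X': "bounded_progressive C X'"
      and \<Phi>m[measurable]: "\<Phi> \<in> borel_measurable Q" and \<Phi>m'[measurable]: "\<Phi>' \<in> borel_measurable Q"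
      and \<Phi>: "\<And>\<omega>. \<omega> \<in> path_space T \<Longrightarrow> \<bar>\<Phi> \<omega>\<bar> \<le> C" and \<Phi>': "\<And>\<omega>. \<omega> \<in> path_space T \<Longrightarrow> \<bar>\<Phi>' \<omega>\<bar> \<le> C"
      and dX: "sqnorm (\<lambda>s \<omega>. X s \<omega> - X' s \<omega>) \<le> ennreal \<delta>"
      and d\<Phi>: "(\<integral>\<^sup>+\<omega>. ennreal ((\<Phi> \<omega> - \<Phi>' \<omega>)\<^sup>2) \<partial>Q) \<le> ennreal \<delta>"
    define Y where "Y = ito_integral T P X"
    define Y' where "Y' = ito_integral T P X'"
    define q where "q = quad_var X"
    define q' where "q' = quad_var X'"
    have [measurable]: "Y \<in> borel_measurable Q" "Y' \<in> borel_measurable Q" "q \<in> borel_measurable Q" "q' \<in> borel_measurable Q"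
      unfolding Y_def Y'_def q_def q'_def
      by (rule ito_integral(2)[OF X] ito_integral(2)[OF X'] quad_var_measurable bounded_progressive_jm[OF X] bounded_progressive_jm[OF X'])+
    have jm: "jointly_measurable (\<lambda>s \<omega>. X s \<omega> - X' s \<omega>)"
      by (intro jointly_measurable_diff bounded_progressive_jm[OF X] bounded_progressive_jm[OF X'])
    have E: "(\<integral>\<^sup>+\<omega>. ennreal (exp (2 * Y \<omega>)) \<partial>Q) \<le> ennreal G" "(\<integral>\<^sup>+\<omega>. ennreal (exp (2 * Y' \<omega>)) \<partial>Q) \<le> ennreal G"
      unfolding Y_def Y'_def G_def by (rule ito_integral(3)[OF X] ito_integral(3)[OF X'])+
    have dY: "(\<integral>\<^sup>+\<omega>. ennreal ((Y \<omega> - Y' \<omega>)\<^sup>2) \<partial>Q) \<le> ennreal (9 * real CARD('d) * \<delta>)"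
    proof -
      have "(\<integral>\<^sup>+\<omega>. ennreal ((Y \<omega> - Y' \<omega>)\<^sup>2) \<partial>Q) \<le> 9 * of_nat CARD('d) * sqnorm (\<lambda>s \<omega>. X s \<omega> - X' s \<omega>)"
        unfolding Y_def Y'_def
        by (intro is_ito_integral_dist ito_integral(1)[OF X] ito_integral(1)[OF X'] bounded_progressive_jm[OF X] bounded_progressive_jm[OF X'])
      also have "\<dots> \<le> 9 * of_nat CARD('d) * ennreal \<delta>" using dX by (rule mult_left_mono) simp
      also have "\<dots> = ennreal (9 * real CARD('d) * \<delta>)" using \<delta> by (simp add: ennreal_mult ennreal_of_nat_eq_real_of_nat)
      finally show ?thesis .
    qed
    have dq: "(\<integral>\<^sup>+\<omega>. ennreal ((q \<omega> - q' \<omega>)\<^sup>2) \<partial>Q) \<le> ennreal (4 * C\<^sup>2 * T * \<delta>)"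
    proof -
      have "(\<integral>\<^sup>+\<omega>. ennreal ((q \<omega> - q' \<omega>)\<^sup>2) \<partial>Q) \<le> (\<integral>\<^sup>+\<omega>. ennreal (4 * C\<^sup>2 * T) * (\<integral>\<^sup>+s\<in>{0..T}. ennreal ((norm (X s \<omega> - X' s \<omega>))\<^sup>2) \<partial>lborel) \<partial>Q)"
        unfolding q_def q'_def by (intro nn_integral_mono quad_var_diff[OF X X']) simp
      also have "\<dots> = ennreal (4 * C\<^sup>2 * T) * sqnorm (\<lambda>s \<omega>. X s \<omega> - X' s \<omega>)"
        unfolding sqnorm_def by (rule nn_integral_cmult[OF sqnorm_inner_measurable[OF jm]])
      also have "\<dots> \<le> ennreal (4 * C\<^sup>2 * T) * ennreal \<delta>" using dX by (rule mult_left_mono) simp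
      also have "\<dots> = ennreal (4 * C\<^sup>2 * T * \<delta>)" using \<delta> T_pos by (simp add: ennreal_mult)
      finally show ?thesis .
    qed
    let ?D = "\<lambda>\<omega>. exp (Y \<omega> - q \<omega> / 2) * \<Phi> \<omega>" and ?D' = "\<lambda>\<omega>. exp (Y' \<omega> - q' \<omega> / 2) * \<Phi>' \<omega>"
    have int: "integrable Q ?D" "integrable Q ?D'"
      unfolding Y_def Y'_def q_def q'_def by (rule drift_cost_eq(2)[OF X \<Phi>m \<Phi>] drift_cost_eq(2)[OF X' \<Phi>m' \<Phi>'], assumption)+
    have "drift_cost X \<Phi> - drift_cost X' \<Phi>' = (\<integral>\<omega>. ?D \<omega> - ?D' \<omega> \<partial>Q)"
      using drift_cost_eq(1)[OF X \<Phi>m \<Phi>] drift_cost_eq(1)[OF X' \<Phi>m' \<Phi>'] int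
      unfolding Y_def Y'_def q_def q'_def by simp
    then have "ennreal \<bar>drift_cost X \<Phi> - drift_cost X' \<Phi>'\<bar> \<le> (\<integral>\<^sup>+\<omega>. ennreal (norm (?D \<omega> - ?D' \<omega>)) \<partial>Q)"
      using integral_norm_bound_ennreal[of Q "\<lambda>\<omega>. ?D \<omega> - ?D' \<omega>"] int by simp
    also have "\<dots> \<le> (\<integral>\<^sup>+\<omega>. ennreal (2 * C * l) * ennreal (exp (2 * Y \<omega>)) + ennreal ((2 * C + 1) * l) * ennreal (exp (2 * Y' \<omega>))
       + ennreal (2 * C / l) * ennreal ((Y \<omega> - Y' \<omega>)\<^sup>2) + ennreal (C / (2 * l)) * ennreal ((q \<omega> - q' \<omega>)\<^sup>2) + ennreal (1 / l) * ennreal ((\<Phi> \<omega> - \<Phi>' \<omega>)\<^sup>2) \<partial>Q)"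
    proof (rule nn_integral_mono)
      fix \<omega> assume "\<omega> \<in> space Q"
      then have "\<bar>\<Phi> \<omega>\<bar> \<le> C" using \<Phi> by simp
      from weighted_difference_le[OF this l(1), of "q \<omega>" "q' \<omega>" "Y \<omega>" "Y' \<omega>" "\<Phi>' \<omega>"]
      have "\<bar>?D \<omega> - ?D' \<omega>\<bar> \<le> l * (2 * C * exp (2 * Y \<omega>) + (2 * C + 1) * exp (2 * Y' \<omega>)) + (C * (2 * (Y \<omega> - Y' \<omega>)\<^sup>2 + (q \<omega> - q' \<omega>)\<^sup>2 / 2) + (\<Phi> \<omega> - \<Phi>' \<omega>)\<^sup>2) / l"
        by (simp add: q_def q'_def quad_var_nonneg)
      also have "\<dots> = 2 * C * l * exp (2 * Y \<omega>) + (2 * C + 1) * l * exp (2 * Y' \<omega>)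
         + 2 * C / l * (Y \<omega> - Y' \<omega>)\<^sup>2 + C / (2 * l) * (q \<omega> - q' \<omega>)\<^sup>2 + 1 / l * (\<Phi> \<omega> - \<Phi>' \<omega>)\<^sup>2"
        using l(1) by (simp add: field_simps)
      finally have "ennreal \<bar>?D \<omega> - ?D' \<omega>\<bar> \<le> ennreal \<dots>" by (rule ennreal_leI)
      then show "ennreal (norm (?D \<omega> - ?D' \<omega>)) \<le> ennreal (2 * C * l) * ennreal (exp (2 * Y \<omega>)) + ennreal ((2 * C + 1) * l) * ennreal (exp (2 * Y' \<omega>))
       + ennreal (2 * C / l) * ennreal ((Y \<omega> - Y' \<omega>)\<^sup>2) + ennreal (C / (2 * l)) * ennreal ((q \<omega> - q' \<omega>)\<^sup>2) + ennreal (1 / l) * ennreal ((\<Phi> \<omega> - \<Phi>' \<omega>)\<^sup>2)"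
        using C l(1) by (simp add: ennreal_mult[symmetric] ennreal_plus[symmetric] del: ennreal_plus)
    qed
    also have "\<dots> = ennreal (2 * C * l) * (\<integral>\<^sup>+\<omega>. ennreal (exp (2 * Y \<omega>)) \<partial>Q) + ennreal ((2 * C + 1) * l) * (\<integral>\<^sup>+\<omega>. ennreal (exp (2 * Y' \<omega>)) \<partial>Q)
       + ennreal (2 * C / l) * (\<integral>\<^sup>+\<omega>. ennreal ((Y \<omega> - Y' \<omega>)\<^sup>2) \<partial>Q) + ennreal (C / (2 * l)) * (\<integral>\<^sup>+\<omega>. ennreal ((q \<omega> - q' \<omega>)\<^sup>2) \<partial>Q)
       + ennreal (1 / l) * (\<integral>\<^sup>+\<omega>. ennreal ((\<Phi> \<omega> - \<Phi>' \<omega>)\<^sup>2) \<partial>Q)"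
      by (simp add: nn_integral_add nn_integral_cmult)
    also have "\<dots> \<le> ennreal (2 * C * l) * ennreal G + ennreal ((2 * C + 1) * l) * ennreal G
       + ennreal (2 * C / l) * ennreal (9 * real CARD('d) * \<delta>) + ennreal (C / (2 * l)) * ennreal (4 * C\<^sup>2 * T * \<delta>) + ennreal (1 / l) * ennreal \<delta>"
      by (intro add_mono mult_left_mono E dY dq d\<Phi>) auto
    also have "\<dots> = ennreal (2 * C * l * G + (2 * C + 1) * l * G + 2 * C / l * (9 * real CARD('d) * \<delta>) + C / (2 * l) * (4 * C\<^sup>2 * T * \<delta>) + 1 / l * \<delta>)"
      using C l(1) G \<delta>(1) T_pos by (simp add: ennreal_mult[symmetric] ennreal_plus[symmetric] del: ennreal_plus)
    also have "2 * C * l * G + (2 * C + 1) * l * G + 2 * C / l * (9 * real CARD('d) * \<delta>) + C / (2 * l) * (4 * C\<^sup>2 * T * \<delta>) + 1 / l * \<delta>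
       = l * ((4 * C + 1) * G) + K * \<delta> / l"
      using l(1) by (simp add: K_def field_simps)
    also have "\<dots> = e" unfolding l(2) \<delta>(2) by simp
    finally show "\<bar>drift_cost X \<Phi> - drift_cost X' \<Phi>'\<bar> \<le> e" using e by simp
  qed
qed

end

section \<open>Concatenated paths and measurability of shifted data\<close>

lemma path_spaceD:
  assumes "\<omega> \<in> path_space T"
  shows "continuous_on {0..T} \<omega>" "\<omega> 0 = 0"
  using assms by (auto simp: path_space_def)

lemma norm_le_path_norm:
  assumes "continuous_on {0..T} g" "s \<in> {0..T}"
  shows "norm (g s) \<le> path_norm T g"
proof -
  have "compact ((\<lambda>s. norm (g s)) ` {0..T})"
    using assms(1) by (intro compact_continuous_image continuous_on_norm) auto
  then have "bdd_above ((\<lambda>s. norm (g s)) ` {0..T})" by (intro bounded_imp_bdd_above compact_imp_bounded)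
  then show ?thesis unfolding path_norm_def using assms(2) by (intro cSUP_upper)
qed

lemma path_norm_le:
  assumes "0 \<le> T" "\<And>s. s \<in> {0..T} \<Longrightarrow> norm (g s) \<le> c"
  shows "path_norm T g \<le> c"
  unfolding path_norm_def using assms by (intro cSUP_least) auto

lemma path_norm_nonneg:
  assumes "0 \<le> T" "continuous_on {0..T} g" shows "0 \<le> path_norm T g"
  using norm_le_path_norm[OF assms(2), of 0] assms(1) order_trans[OF norm_ge_zero] by auto

lemma continuous_stopped_path:
  assumes "\<omega> \<in> path_space T" "t \<in> {0..T}"
  shows "continuous_on {0..T} (\<lambda>s. \<omega> (min t s))"
  by (rule continuous_on_compose2[OF path_spaceD(1)[OF assms(1)]]) (use assms(2) in \<open>auto intro!: continuous_intros\<close>)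

lemma continuous_stopped_diff:
  assumes "\<omega> \<in> path_space T" "\<omega>' \<in> path_space T" "t \<in> {0..T}" "t' \<in> {0..T}"
  shows "continuous_on {0..T} (\<lambda>s. \<omega> (min t s) - \<omega>' (min t' s))"
  by (intro continuous_on_diff continuous_stopped_path assms)

lemma path_dist_nonneg:
  assumes "\<omega> \<in> path_space T" "\<omega>' \<in> path_space T" "t \<in> {0..T}" "t' \<in> {0..T}"
  shows "0 \<le> path_dist T t \<omega> t' \<omega>'"
  unfolding path_dist_def using assms
  by (intro add_nonneg_nonneg path_norm_nonneg continuous_stopped_diff) auto

lemma path_dist_commute: "path_dist T t \<omega> t' \<omega>' = path_dist T t' \<omega>' t \<omega>"
  unfolding path_dist_def path_norm_def by (simp add: norm_minus_commute abs_minus_commute)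

text \<open>Since the second path starts at 0, the two branches of the concatenation merge into one
  formula in which continuity and stopping are visible.\<close>

lemma concat_path_eq:
  assumes "\<omega>' \<in> path_space T" "s \<in> {0..T}"
  shows "concat_path T t \<omega> \<omega>' s = \<omega> (min t s) + \<omega>' (max 0 (s - t))"
  using assms path_spaceD(2)[OF assms(1)] by (auto simp: concat_path_def min_def max_def)

lemma concat_path_in_path_space:
  assumes "\<omega> \<in> path_space T" "\<omega>' \<in> path_space T" "t \<in> {0..T}"
  shows "concat_path T t \<omega> \<omega>' \<in> path_space T"
proof -
  have "continuous_on {0..T} (\<lambda>s. \<omega>' (max 0 (s - t)))"
    by (rule continuous_on_compose2[OF path_spaceD(1)[OF assms(2)]]) (use assms(3) in \<open>auto intro!: continuous_intros\<close>)
  then have "continuous_on {0..T} (\<lambda>s. \<omega> (min t s) + \<omega>' (max 0 (s - t)))"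
    using continuous_stopped_path[OF assms(1,3)] by (intro continuous_on_add)
  then have "continuous_on {0..T} (concat_path T t \<omega> \<omega>')"
    by (rule continuous_on_eq) (simp add: concat_path_eq[OF assms(2)])
  moreover have "concat_path T t \<omega> \<omega>' 0 = 0"
    using assms path_spaceD(2)[OF assms(1)] by (simp add: concat_path_def)
  ultimately show ?thesis by (simp add: path_space_def concat_path_def)
qed

text \<open>Shifting two games to different base points \<open>(t,\<omega>)\<close>, \<open>(t',\<omega>')\<close> costs, besides the distance
  of the base points, only the oscillation of the driving path over time lags \<open>\<bar>t - t'\<bar> + \<bar>s - s'\<bar>\<close>.\<close>

lemma path_dist_concat_le:
  assumes t: "0 \<le> t" "0 \<le> s" "t + s \<le> T" "0 \<le> t'" "0 \<le> s'" "t' + s' \<le> T"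
    and r: "s \<le> r" "s' \<le> r" "r \<le> T"
    and \<omega>: "\<omega> \<in> path_space T" "\<omega>' \<in> path_space T" "\<eta> \<in> path_space T" "\<eta>' \<in> path_space T"
    and a: "\<And>v. v \<in> {0..r} \<Longrightarrow> norm (\<eta> v - \<eta>' v) \<le> a"
    and c: "\<And>v v'. v \<in> {0..r} \<Longrightarrow> v' \<in> {0..r} \<Longrightarrow> \<bar>v - v'\<bar> \<le> \<bar>t - t'\<bar> + \<bar>s - s'\<bar> \<Longrightarrow> norm (\<eta> v - \<eta> v') \<le> c"
  shows "path_dist T (t + s) (concat_path T t \<omega> \<eta>) (t' + s') (concat_path T t' \<omega>' \<eta>')
    \<le> sqrt (\<bar>t - t'\<bar> + \<bar>s - s'\<bar>) + path_norm T (\<lambda>v. \<omega> (min t v) - \<omega>' (min t' v)) + a + c"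
proof -
  let ?p = "path_norm T (\<lambda>v. \<omega> (min t v) - \<omega>' (min t' v))"
  have "path_norm T (\<lambda>v. concat_path T t \<omega> \<eta> (min (t + s) v) - concat_path T t' \<omega>' \<eta>' (min (t' + s') v)) \<le> ?p + a + c"
  proof (rule path_norm_le)
    fix v assume v: "v \<in> {0..T}"
    \<comment> \<open>How long the driving path has run inside the stopped concatenation at time
      \<open>v\<close>. The two stopped paths split into base points at stopped times plus driving
      paths at \<open>x\<close> and \<open>x'\<close>.\<close>
    define x where "x = max 0 (min (t + s) v - t)"
    define x' where "x' = max 0 (min (t' + s') v - t')"
    have x: "x \<in> {0..r}" "x' \<in> {0..r}" using t r by (auto simp: x_def x'_def)
    have "\<bar>x - x'\<bar> \<le> \<bar>t - t'\<bar> + \<bar>s - s'\<bar>"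
    proof -
      have "\<bar>min s (v - t) - min s' (v - t')\<bar> \<le> \<bar>t - t'\<bar> + \<bar>s - s'\<bar>"
        by (auto simp: min_def)
      moreover have "\<bar>max 0 p - max 0 p'\<bar> \<le> \<bar>p - p'\<bar>" for p p' :: real by (auto simp: max_def)
      moreover have "x = max 0 (min s (v - t))" "x' = max 0 (min s' (v - t'))"
        unfolding x_def x'_def by (auto simp: min_def max_def)
      ultimately show ?thesis by (simp only:) (rule order_trans)
    qed
    then have c': "norm (\<eta> x - \<eta> x') \<le> c" using c x by blast
    have a': "norm (\<eta> x' - \<eta>' x') \<le> a" using a x by blast
    have p': "norm (\<omega> (min t v) - \<omega>' (min t' v)) \<le> ?p"
      by (rule norm_le_path_norm[OF continuous_stopped_diff[OF \<omega>(1,2)] v]) (use t in auto)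
    have m: "min t (min (t + s) v) = min t v" "min t' (min (t' + s') v) = min t' v" using t by auto
    have 1: "concat_path T t \<omega> \<eta> (min (t + s) v) = \<omega> (min t v) + \<eta> x"
      using v t m concat_path_eq[OF \<omega>(3), of "min (t + s) v" t \<omega>] by (simp add: x_def)
    have 2: "concat_path T t' \<omega>' \<eta>' (min (t' + s') v) = \<omega>' (min t' v) + \<eta>' x'"
      using v t m concat_path_eq[OF \<omega>(4), of "min (t' + s') v" t' \<omega>'] by (simp add: x'_def)
    have "norm (concat_path T t \<omega> \<eta> (min (t + s) v) - concat_path T t' \<omega>' \<eta>' (min (t' + s') v))
        = norm ((\<omega> (min t v) - \<omega>' (min t' v)) + (\<eta> x' - \<eta>' x') + (\<eta> x - \<eta> x'))"
      unfolding 1 2 by (simp add: algebra_simps)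
    also have "\<dots> \<le> norm (\<omega> (min t v) - \<omega>' (min t' v)) + norm (\<eta> x' - \<eta>' x') + norm (\<eta> x - \<eta> x')"
      by (rule norm_add3_le)
    also have "\<dots> \<le> ?p + a + c" using p' a' c' by simp
    finally show "norm (concat_path T t \<omega> \<eta> (min (t + s) v) - concat_path T t' \<omega>' \<eta>' (min (t' + s') v)) \<le> ?p + a + c" .
  qed (use t in simp)
  moreover have "sqrt \<bar>(t + s) - (t' + s')\<bar> \<le> sqrt (\<bar>t - t'\<bar> + \<bar>s - s'\<bar>)" by simp
  ultimately show ?thesis unfolding path_dist_def by linarith
qed

text \<open>Treats the terminal payoff as a coefficient frozen at time \<open>T\<close>, so that one
  estimate of \<open>path_dist\<close> serves running and terminal data.\<close>

lemma path_norm_diff_eq_path_dist: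
  assumes "0 \<le> T" shows "path_norm T (\<lambda>s. \<omega> s - \<omega>' s) = path_dist T T \<omega> T \<omega>'"
  using assms by (auto simp: path_dist_def path_norm_def min_absorb2 intro!: SUP_cong)

lemma modulus_small:
  assumes "modulus_of_continuity \<rho>" "0 < e"
  obtains \<delta> where "0 < \<delta>" "\<And>x. 0 \<le> x \<Longrightarrow> x \<le> \<delta> \<Longrightarrow> \<rho> x \<le> e"
proof -
  have "\<forall>\<^sub>F x in at_right 0. \<rho> x < e"
    using assms by (auto simp: modulus_of_continuity_def intro: order_tendstoD)
  then obtain d where d: "0 < d" "\<And>x. 0 < x \<Longrightarrow> x < d \<Longrightarrow> \<rho> x < e"
    unfolding eventually_at_right_field by blast
  \<comment> \<open>The limit from the right says nothing about \<open>x = 0\<close>; there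
    \<open>\<rho> 0 = 0\<close> enters. Halving \<open>d\<close> turns the strict bound on
    \<open>x\<close> into a weak one.\<close>
  have "\<rho> x \<le> e" if "0 \<le> x" "x \<le> d / 2" for x
    using d(2)[of x] that d(1) assms by (cases "x = 0") (auto simp: modulus_of_continuity_def)
  then show ?thesis using that[of "d / 2"] d(1) by simp
qed

text \<open>Rational times turn the condition into a countable intersection, hence a measurable
  event. The time lag is strict, so it survives moving both times slightly; the bound on the
  oscillation is weak, so it survives a limit.\<close>

definition tight_path :: "real \<Rightarrow> real \<Rightarrow> real \<Rightarrow> 'd::finite path \<Rightarrow> bool" where
  "tight_path r \<delta> c \<omega> \<longleftrightarrow> (\<forall>v\<in>{0..r} \<inter> \<rat>. \<forall>v'\<in>{0..r} \<inter> \<rat>. \<bar>v - v'\<bar> < \<delta> \<longrightarrow> norm (\<omega> v - \<omega> v') \<le> c)"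

lemma rat_near:
  fixes v r e :: real
  assumes "v \<in> {0..r}" "0 < r" "0 < e"
  obtains q where "q \<in> {0..r} \<inter> \<rat>" "\<bar>q - v\<bar> < e"
proof -
  have "max 0 (v - e) < min r (v + e)" using assms by auto
  then obtain q where "q \<in> \<rat>" "max 0 (v - e) < q" "q < min r (v + e)" using Rats_dense_in_real by blast
  then show ?thesis using that[of q] by auto
qed

text \<open>Real times are approximated by rational ones that keep the strict lag, and continuity
  transports the bound. If the bound failed, half of the excess would be available as an error on
  each side.\<close>

lemma tight_pathD:
  assumes tight: "tight_path r \<delta> c \<omega>" and cont: "continuous_on {0..r} \<omega>" and c: "0 \<le> c"
    and v: "v \<in> {0..r}" "v' \<in> {0..r}" "\<bar>v - v'\<bar> < \<delta>"
  shows "norm (\<omega> v - \<omega> v') \<le> c"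
proof (cases "0 < r")
  case False
  then have "v = v'" using v by auto
  then show ?thesis using c by simp
next
  case r: True
  show ?thesis
  proof (rule ccontr)
    assume "\<not> norm (\<omega> v - \<omega> v') \<le> c"
    then have e: "0 < (norm (\<omega> v - \<omega> v') - c) / 2" (is "0 < ?e") by simp
    obtain d where d: "0 < d" "\<And>x. x \<in> {0..r} \<Longrightarrow> dist x v < d \<Longrightarrow> dist (\<omega> x) (\<omega> v) < ?e"
      using cont v(1) e unfolding continuous_on_iff by blast
    obtain d' where d': "0 < d'" "\<And>x. x \<in> {0..r} \<Longrightarrow> dist x v' < d' \<Longrightarrow> dist (\<omega> x) (\<omega> v') < ?e"
      using cont v(2) e unfolding continuous_on_iff by blast
    \<comment> \<open>Half of the slack in the lag for each of the two rational
      approximations.\<close>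
    have g: "0 < (\<delta> - \<bar>v - v'\<bar>) / 2" using v(3) by simp
    obtain q where q: "q \<in> {0..r} \<inter> \<rat>" "\<bar>q - v\<bar> < min d ((\<delta> - \<bar>v - v'\<bar>) / 2)"
      by (rule rat_near[OF v(1) r, of "min d ((\<delta> - \<bar>v - v'\<bar>) / 2)"]) (use d g in auto)
    obtain q' where q': "q' \<in> {0..r} \<inter> \<rat>" "\<bar>q' - v'\<bar> < min d' ((\<delta> - \<bar>v - v'\<bar>) / 2)"
      by (rule rat_near[OF v(2) r, of "min d' ((\<delta> - \<bar>v - v'\<bar>) / 2)"]) (use d' g in auto)
    have "\<bar>q - v\<bar> < (\<delta> - \<bar>v - v'\<bar>) / 2" "\<bar>q' - v'\<bar> < (\<delta> - \<bar>v - v'\<bar>) / 2"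
      using q(2) q'(2) by simp_all
    moreover have "\<bar>q - q'\<bar> \<le> \<bar>q - v\<bar> + \<bar>v - v'\<bar> + \<bar>q' - v'\<bar>" by linarith
    ultimately have "\<bar>q - q'\<bar> < \<delta>" by (simp add: field_simps)
    then have "norm (\<omega> q - \<omega> q') \<le> c" using tight q(1) q'(1) unfolding tight_path_def by blast
    moreover have "dist (\<omega> q) (\<omega> v) < ?e" "dist (\<omega> q') (\<omega> v') < ?e"
      using d(2)[of q] d'(2)[of q'] q q' by (auto simp: dist_real_def)
    moreover have "norm (\<omega> v - \<omega> v') \<le> norm (\<omega> q - \<omega> q') + dist (\<omega> q) (\<omega> v) + dist (\<omega> q') (\<omega> v')"
      unfolding dist_norm[symmetric] using dist_triangle[of "\<omega> v" "\<omega> v'" "\<omega> q"] dist_triangle[of "\<omega> q" "\<omega> v'" "\<omega> q'"]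
      by (simp add: dist_commute)
    ultimately show False by (simp add: field_simps)
  qed
qed

lemma tight_path_exists:
  assumes cont: "continuous_on {0..r} \<omega>" and c: "0 < c"
  shows "\<exists>n. tight_path r (1 / real (Suc n)) c \<omega>"
proof -
  have "uniformly_continuous_on {0..r} \<omega>" using cont by (intro compact_uniformly_continuous) auto
  then obtain d where d: "0 < d" "\<And>x x'. x \<in> {0..r} \<Longrightarrow> x' \<in> {0..r} \<Longrightarrow> dist x' x < d \<Longrightarrow> dist (\<omega> x') (\<omega> x) < c"
    using c unfolding uniformly_continuous_on_def by meson
  obtain n where "inverse (real (Suc n)) < d" using reals_Archimedean[OF d(1)] by blast
  then have "tight_path r (1 / real (Suc n)) c \<omega>"
    unfolding tight_path_def using d(2) by (force simp: dist_real_def dist_norm inverse_eq_divide intro: less_imp_le)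
  then show ?thesis by blast
qed

lemma tight_path_antimono: "tight_path r \<delta> c \<omega> \<Longrightarrow> \<delta>' \<le> \<delta> \<Longrightarrow> tight_path r \<delta>' c \<omega>"
  by (auto simp: tight_path_def)

lemma tight_path_measurable:
  "Measurable.pred (raw_filtration T r :: 'a::finite path measure) (tight_path r \<delta> c)"
proof -
  have "countable ({0..r} \<inter> \<rat>)" by (intro countable_Int2 countable_rat)
  moreover have "Measurable.pred (raw_filtration T r :: 'a path measure) (\<lambda>\<omega>. \<bar>v - v'\<bar> < \<delta> \<longrightarrow> norm (\<omega> v - \<omega> v') \<le> c)"
    if "v \<in> {0..r} \<inter> \<rat>" "v' \<in> {0..r} \<inter> \<rat>" for v v'
  proof -
    have "Measurable.pred M (\<lambda>\<omega>. \<bar>v - v'\<bar> < \<delta> \<longrightarrow> norm (p \<omega> - p' \<omega>) \<le> c)"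
      if [measurable]: "p \<in> borel_measurable M" "p' \<in> borel_measurable M"
      for M :: "'a path measure" and p p' :: "'a path \<Rightarrow> real ^ 'a"
      by measurable
    moreover have "(\<lambda>\<omega>. \<omega> v) \<in> borel_measurable (raw_filtration T r :: 'a path measure)"
      using that(1) by (intro measurable_eval_raw) simp_all
    moreover have "(\<lambda>\<omega>. \<omega> v') \<in> borel_measurable (raw_filtration T r :: 'a path measure)"
      using that(2) by (intro measurable_eval_raw) simp_all
    ultimately show ?thesis by blast
  qed
  ultimately show ?thesis unfolding tight_path_def pred_def
    by (intro sets.sets_Collect_countable_All')
qed

text \<open>\<open>g\<close> is replaced by its value at a representative with the same code. For
  each \<open>k\<close> this is a countable case distinction between measurable functions of
  \<open>a\<close>, hence jointly measurable, and finer codes give pointwise convergence. The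
  representatives may be chosen arbitrarily since each code class is measurable.\<close>

lemma measurable_of_countable_codes:
  fixes g :: "'z \<Rightarrow> 'a \<Rightarrow> 'b::euclidean_space" and code :: "nat \<Rightarrow> 'z \<Rightarrow> 'c::countable"
  assumes code: "\<And>k. code k \<in> measurable M (count_space UNIV)"
    and g: "\<And>z. z \<in> space M \<Longrightarrow> g z \<in> borel_measurable N"
    and conv: "\<And>z a w. z \<in> space M \<Longrightarrow> a \<in> space N \<Longrightarrow> (\<And>k. w k \<in> space M) \<Longrightarrow>
      (\<And>k. code k (w k) = code k z) \<Longrightarrow> (\<lambda>k. g (w k) a) \<longlonglongrightarrow> g z a"
  shows "(\<lambda>x. g (fst x) (snd x)) \<in> borel_measurable (M \<Otimes>\<^sub>M N)"
proof -
  define rep where "rep = (\<lambda>k c. SOME w. w \<in> space M \<and> code k w = c)"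
  \<comment> \<open>Codes that no point attains get the default 0, because \<open>rep\<close> means
    nothing there.\<close>
  define G where "G = (\<lambda>k c a. if \<exists>w\<in>space M. code k w = c then g (rep k c) a else 0)"
  have rep: "rep k c \<in> space M" "code k (rep k c) = c" if "\<exists>w\<in>space M. code k w = c" for k c
    using someI_ex[of "\<lambda>w. w \<in> space M \<and> code k w = c"] that unfolding rep_def by blast+
  have G: "G k c \<in> borel_measurable N" for k c
    unfolding G_def using g rep(1)[of k c] by (cases "\<exists>w\<in>space M. code k w = c") simp_all
  have "(\<lambda>x. G k (code k (fst x)) (snd x)) \<in> borel_measurable (M \<Otimes>\<^sub>M N)" for k
  proof (rule measurable_compose_countable[where f="\<lambda>c x. G k c (snd x)" and g="\<lambda>x. code k (fst x)"])
    show "(\<lambda>x. G k c (snd x)) \<in> borel_measurable (M \<Otimes>\<^sub>M N)" for c by (rule measurable_compose[OF measurable_snd G])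
    show "(\<lambda>x. code k (fst x)) \<in> measurable (M \<Otimes>\<^sub>M N) (count_space UNIV)" by (rule measurable_compose[OF measurable_fst code])
  qed
  then show ?thesis
  proof (rule borel_measurable_LIMSEQ_metric)
    fix x assume x: "x \<in> space (M \<Otimes>\<^sub>M N)"
    then have z: "fst x \<in> space M" "snd x \<in> space N" by (auto simp: space_pair_measure)
    have ex: "\<exists>w\<in>space M. code k w = code k (fst x)" for k using z(1) by blast
    have "(\<lambda>k. g (rep k (code k (fst x))) (snd x)) \<longlonglongrightarrow> g (fst x) (snd x)"
      by (intro conv z rep ex)
    then show "(\<lambda>k. G k (code k (fst x)) (snd x)) \<longlonglongrightarrow> g (fst x) (snd x)"
      using ex by (simp add: G_def)
  qed
qed

lemma floor_eq_imp_abs_diff_less: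
  fixes x y :: real
  assumes "\<lfloor>x\<rfloor> = \<lfloor>y\<rfloor>" shows "\<bar>x - y\<bar> < 1"
  using assms floor_correct[of x] floor_correct[of y] by linarith

lemma floor_level_measurable:
  fixes h :: "'z \<Rightarrow> real"
  assumes [measurable]: "h \<in> borel_measurable M"
  shows "Measurable.pred M (\<lambda>z. \<lfloor>c * h z\<rfloor> = n)"
  by measurable

text \<open>The minimum exists for continuous paths by \<open>tight_path_exists\<close>; taking the
  least index makes it a measurable function of the path.\<close>

definition tight_index :: "real \<Rightarrow> nat \<Rightarrow> 'd::finite path \<Rightarrow> nat" where
  "tight_index r k \<omega> = (LEAST n. tight_path r (1 / real (Suc n)) (1 / real (Suc k)) \<omega>)"

text \<open>Counts the mesh points \<open>j / (2 * (n + 1))\<close> in \<open>{0..r}\<close>, with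
  \<open>Suc\<close> for \<open>j = 0\<close>. The mesh is half of the lag
  \<open>1 / (n + 1)\<close> that belongs to the index \<open>n\<close>.\<close>

definition code_length :: "real \<Rightarrow> nat \<Rightarrow> nat" where
  "code_length r n = Suc (nat \<lfloor>r * (2 * real (Suc n))\<rfloor>)"

text \<open>A countable code of a path on \<open>[0,r]\<close>: a mesh on which the path oscillates by at most
  \<open>1/(k+1)\<close> and its values there up to \<open>1/(k+1)\<close>. Paths with the same code are uniformly close.\<close>

definition path_code :: "real \<Rightarrow> nat \<Rightarrow> 'd::finite path \<Rightarrow> nat \<times> (int ^ 'd) list" where
  "path_code r k \<omega> = (tight_index r k \<omega>,
     map (\<lambda>j. \<chi> i. \<lfloor>real (Suc k) * (\<omega> (real j / (2 * real (Suc (tight_index r k \<omega>))))) $ i\<rfloor>)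
       [0..<code_length r (tight_index r k \<omega>)])"

lemma grid_point_le:
  assumes r: "0 \<le> r" and "j < code_length r n"
  shows "real j / (2 * real (Suc n)) \<in> {0..r}"
proof -
  have "j \<le> nat \<lfloor>r * (2 * real (Suc n))\<rfloor>" using assms(2) by (simp add: code_length_def)
  then have "real j \<le> real_of_int \<lfloor>r * (2 * real (Suc n))\<rfloor>"
    using r by (metis le_nat_iff mult_nonneg_nonneg of_int_le_iff of_int_of_nat_eq of_nat_0_le_iff zero_le_floor zero_le_numeral)
  also have "\<dots> \<le> r * (2 * real (Suc n))" by (rule of_int_floor_le)
  finally show ?thesis by (simp add: divide_le_eq)
qed

text \<open>There are countably many codes, so single codes suffice. Once the index is fixed to
  \<open>n\<close>, the mesh is deterministic and the event concerns finitely many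
  evaluations.\<close>

lemma path_code_measurable:
  assumes r: "0 \<le> r"
  shows "path_code r k \<in> measurable (raw_filtration T r :: 'd::finite path measure) (count_space UNIV)"
proof -
  let ?M = "raw_filtration T r :: 'd path measure"
  have ti[measurable]: "tight_index r k \<in> measurable ?M (count_space UNIV)"
    unfolding tight_index_def by (intro measurable_Least tight_path_measurable)
  have "path_code r k -` {c} \<inter> space ?M \<in> sets ?M" for c :: "nat \<times> (int ^ 'd) list"
  proof -
    obtain n l where c: "c = (n, l)" by (cases c)
    have ev: "(\<lambda>\<omega>. \<omega> (real j / (2 * real (Suc n)))) \<in> borel_measurable ?M" if "j < code_length r n" for j
      using grid_point_le[OF r that] by (intro measurable_eval_raw) auto
    have eq: "path_code r k -` {c} \<inter> space ?M = {\<omega> \<in> space ?M. tight_index r k \<omega> = n \<and> length l = code_length r n \<and>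
        (\<forall>j\<in>{..<code_length r n}. \<forall>i. \<lfloor>real (Suc k) * (\<omega> (real j / (2 * real (Suc n)))) $ i\<rfloor> = (l ! j) $ i)}"
      unfolding c path_code_def by (auto simp: list_eq_iff_nth_eq vec_eq_iff)
    have "Measurable.pred ?M (\<lambda>\<omega>. \<forall>j\<in>{..<code_length r n}. \<forall>i. \<lfloor>real (Suc k) * (\<omega> (real j / (2 * real (Suc n)))) $ i\<rfloor> = (l ! j) $ i)"
    proof (rule pred_intros_finite(3), simp)
      fix j assume j: "j \<in> {..<code_length r n}"
      have "Measurable.pred ?M (\<lambda>\<omega>. \<lfloor>real (Suc k) * (p \<omega> $ i)\<rfloor> = (l ! j) $ i)"
        if p: "p \<in> borel_measurable ?M" for p :: "'d path \<Rightarrow> real ^ 'd" and i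
      proof -
        have "(\<lambda>\<omega>. p \<omega> $ i) \<in> borel_measurable ?M" by (rule measurable_compose[OF p borel_measurable_nth])
        then show ?thesis by (rule floor_level_measurable)
      qed
      from this[OF ev] j
      have "Measurable.pred ?M (\<lambda>\<omega>. \<lfloor>real (Suc k) * (\<omega> (real j / (2 * real (Suc n)))) $ i\<rfloor> = (l ! j) $ i)" for i
        by simp
      then have "Measurable.pred ?M (\<lambda>\<omega>. \<forall>i\<in>UNIV. \<lfloor>real (Suc k) * (\<omega> (real j / (2 * real (Suc n)))) $ i\<rfloor> = (l ! j) $ i)"
        by (intro pred_intros_finite(3)) simp_all
      then show "Measurable.pred ?M (\<lambda>\<omega>. \<forall>i. \<lfloor>real (Suc k) * (\<omega> (real j / (2 * real (Suc n)))) $ i\<rfloor> = (l ! j) $ i)"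
        by simp
    qed
    then have "{\<omega> \<in> space ?M. tight_index r k \<omega> = n} \<inter> {\<omega> \<in> space ?M. length l = code_length r n} \<inter>
       {\<omega> \<in> space ?M. \<forall>j\<in>{..<code_length r n}. \<forall>i. \<lfloor>real (Suc k) * (\<omega> (real j / (2 * real (Suc n)))) $ i\<rfloor> = (l ! j) $ i} \<in> sets ?M"
      unfolding pred_def
    proof (intro sets.Int)
      show "{\<omega> \<in> space ?M. tight_index r k \<omega> = n} \<in> sets ?M" by measurable
      show "{\<omega> \<in> space ?M. length l = code_length r n} \<in> sets ?M" by measurable
    qed
    then show ?thesis unfolding eq by (rule back_subst[where P="\<lambda>S. S \<in> sets ?M"]) blast
  qed
  then show ?thesis by (subst measurable_count_space_eq2_countable) auto
qed

text \<open>Every time has a mesh point within the common lag. Moving there and back costs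
  \<open>1 / (k + 1)\<close> for each path, and at the mesh point each of the
  \<open>CARD('d)\<close> coordinates differs by less than \<open>1 / (k + 1)\<close>.\<close>

lemma path_code_eq_imp_close:
  fixes \<omega> \<omega>' :: "'d::finite path"
  assumes r: "0 \<le> r" "r \<le> T" and \<omega>: "\<omega> \<in> path_space T" "\<omega>' \<in> path_space T"
    and eq: "path_code r k \<omega> = path_code r k \<omega>'" and v: "v \<in> {0..r}"
  shows "norm (\<omega> v - \<omega>' v) \<le> (2 + real CARD('d)) / real (Suc k)"
proof -
  define n where "n = tight_index r k \<omega>"
  have n': "tight_index r k \<omega>' = n" using eq by (simp add: path_code_def n_def)
  have cont: "continuous_on {0..r} \<omega>" "continuous_on {0..r} \<omega>'"
    using path_spaceD(1)[OF \<omega>(1)] path_spaceD(1)[OF \<omega>(2)] r by (auto intro: continuous_on_subset)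
  have tight: "tight_path r (1 / real (Suc n)) (1 / real (Suc k)) \<omega>" "tight_path r (1 / real (Suc n)) (1 / real (Suc k)) \<omega>'"
    using LeastI_ex[OF tight_path_exists[OF cont(1), of "1 / real (Suc k)"]]
      LeastI_ex[OF tight_path_exists[OF cont(2), of "1 / real (Suc k)"]] n'
    unfolding n_def tight_index_def by simp_all
  define j where "j = nat \<lfloor>v * (2 * real (Suc n))\<rfloor>"
  define u where "u = real j / (2 * real (Suc n))"
  have v0: "0 \<le> v * (2 * real (Suc n))" using v by simp
  have "\<lfloor>v * (2 * real (Suc n))\<rfloor> \<le> \<lfloor>r * (2 * real (Suc n))\<rfloor>" using v by (intro floor_mono mult_right_mono) auto
  then have j: "j < code_length r n" unfolding j_def code_length_def by (simp add: less_Suc_eq_le nat_mono)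
  have u: "u \<in> {0..r}" unfolding u_def by (rule grid_point_le[OF r(1) j])
  have "real j = of_int \<lfloor>v * (2 * real (Suc n))\<rfloor>" unfolding j_def using v0 by simp
  then have "\<bar>v * (2 * real (Suc n)) - real j\<bar> < 1" using floor_correct[of "v * (2 * real (Suc n))"] by linarith
  moreover have "v * (2 * real (Suc n)) - real j = (v - u) * (2 * real (Suc n))" by (simp add: u_def field_simps)
  ultimately have "\<bar>v - u\<bar> * (2 * real (Suc n)) < 1" by (simp add: abs_mult)
  moreover have "\<bar>v - u\<bar> * real (Suc n) \<le> \<bar>v - u\<bar> * (2 * real (Suc n))" by (intro mult_left_mono) auto
  ultimately have "\<bar>v - u\<bar> * real (Suc n) < 1" by linarith
  then have vu: "\<bar>v - u\<bar> < 1 / real (Suc n)" by (simp only: pos_less_divide_eq of_nat_0_less_iff zero_less_Suc)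
  have "map (\<lambda>j. \<chi> i. \<lfloor>real (Suc k) * (\<omega> (real j / (2 * real (Suc n)))) $ i\<rfloor>) [0..<code_length r n]
      = map (\<lambda>j. \<chi> i. \<lfloor>real (Suc k) * (\<omega>' (real j / (2 * real (Suc n)))) $ i\<rfloor>) [0..<code_length r n]"
    using arg_cong[OF eq, of snd] unfolding path_code_def snd_conv n' n_def[symmetric] .
  from arg_cong[OF this, of "\<lambda>l. l ! j"]
  have "(\<chi> i. \<lfloor>real (Suc k) * (\<omega> u) $ i\<rfloor>) = (\<chi> i. \<lfloor>real (Suc k) * (\<omega>' u) $ i\<rfloor>)"
    using j unfolding u_def by (simp only: nth_map length_upt diff_zero nth_upt add_0)
  then have "\<lfloor>real (Suc k) * (\<omega> u) $ i\<rfloor> = \<lfloor>real (Suc k) * (\<omega>' u) $ i\<rfloor>" for i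
    by (simp only: vec_eq_iff vec_lambda_beta)
  from floor_eq_imp_abs_diff_less[OF this]
  have "\<bar>(\<omega> u - \<omega>' u) $ i\<bar> \<le> 1 / real (Suc k)" for i
  proof -
    have "\<bar>real (Suc k) * ((\<omega> u - \<omega>' u) $ i)\<bar> < 1"
      using \<open>\<And>i. \<bar>real (Suc k) * (\<omega> u) $ i - real (Suc k) * (\<omega>' u) $ i\<bar> < 1\<close>[of i] by (simp add: right_diff_distrib)
    then show ?thesis by (simp add: abs_mult pos_le_divide_eq mult.commute)
  qed
  then have "(\<Sum>i\<in>UNIV. \<bar>(\<omega> u - \<omega>' u) $ i\<bar>) \<le> (\<Sum>i\<in>(UNIV::'d set). 1 / real (Suc k))" by (rule sum_mono)
  then have 1: "norm (\<omega> u - \<omega>' u) \<le> real CARD('d) / real (Suc k)"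
    using norm_le_l1_cart[of "\<omega> u - \<omega>' u"] by simp
  have 2: "norm (\<omega> v - \<omega> u) \<le> 1 / real (Suc k)" by (rule tight_pathD[OF tight(1) cont(1) _ v u vu]) simp
  have 3: "norm (\<omega>' v - \<omega>' u) \<le> 1 / real (Suc k)" by (rule tight_pathD[OF tight(2) cont(2) _ v u vu]) simp
  have "norm (\<omega> v - \<omega>' v) \<le> norm (\<omega> v - \<omega> u) + norm (\<omega> u - \<omega>' u) + norm (\<omega>' v - \<omega>' u)"
    using norm_add3_le[of "\<omega> v - \<omega> u" "\<omega> u - \<omega>' u" "\<omega>' u - \<omega>' v"] by (simp add: norm_minus_commute[of "\<omega>' v"])
  also have "\<dots> \<le> 1 / real (Suc k) + real CARD('d) / real (Suc k) + 1 / real (Suc k)" using 1 2 3 by simp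
  also have "\<dots> = (2 + real CARD('d)) / real (Suc k)" by (simp add: add_divide_distrib)
  finally show ?thesis .
qed

text \<open>The code records the path, the time up to \<open>1 / (k + 1)\<close>, and whether the
  time has passed \<open>L\<close>. The last bit is there because shifted data drop to 0 after the
  horizon, so continuity is asked for on each side of \<open>L\<close> separately. \<delta> may
  depend on the point, since pointwise convergence is enough.\<close>

lemma raw_measurable_of_continuous:
  fixes g :: "real \<Rightarrow> 'd::finite path \<Rightarrow> 'a \<Rightarrow> 'b::euclidean_space"
  assumes r: "0 \<le> r" "r \<le> T"
    and g: "\<And>s \<omega>. s \<in> {0..r} \<Longrightarrow> \<omega> \<in> path_space T \<Longrightarrow> g s \<omega> \<in> borel_measurable N"
    and cont: "\<And>s \<omega> a e. s \<in> {0..r} \<Longrightarrow> \<omega> \<in> path_space T \<Longrightarrow> a \<in> space N \<Longrightarrow> 0 < e \<Longrightarrow>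
      \<exists>\<delta>>0. \<forall>s'\<in>{0..r}. \<forall>\<omega>'\<in>path_space T. (s \<le> L \<longleftrightarrow> s' \<le> L) \<longrightarrow> \<bar>s - s'\<bar> \<le> \<delta> \<longrightarrow>
        (\<forall>v\<in>{0..r}. norm (\<omega> v - \<omega>' v) \<le> \<delta>) \<longrightarrow> dist (g s' \<omega>' a) (g s \<omega> a) \<le> e"
  shows "(\<lambda>((s, \<omega>), a). g s \<omega> a) \<in> borel_measurable ((restrict_space borel {0..r} \<Otimes>\<^sub>M raw_filtration T r) \<Otimes>\<^sub>M N)"
proof -
  let ?M = "restrict_space borel {0..r} \<Otimes>\<^sub>M (raw_filtration T r :: 'd path measure)"
  let ?code = "\<lambda>k (z :: real \<times> 'd path). ((\<lfloor>real (Suc k) * fst z\<rfloor>, fst z \<le> L), path_code r k (snd z))"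
  have sp: "z \<in> space ?M \<longleftrightarrow> fst z \<in> {0..r} \<and> snd z \<in> path_space T" for z
    by (auto simp: space_pair_measure space_restrict_space mem_Times_iff)
  have id: "(\<lambda>s. s) \<in> borel_measurable (restrict_space borel {0..r})" by (rule measurable_restrict_space1) simp
  have "(\<lambda>x. (\<lambda>z. g (fst z) (snd z)) (fst x) (snd x)) \<in> borel_measurable (?M \<Otimes>\<^sub>M N)"
  proof (rule measurable_of_countable_codes[where code="?code"])
    fix k
    have f: "fst \<in> borel_measurable ?M" by (rule measurable_compose[OF measurable_fst id])
    have pc: "(\<lambda>z. path_code r k (snd z)) \<in> measurable ?M (count_space UNIV)"
      by (rule measurable_compose[OF measurable_snd path_code_measurable[OF r(1)]])
    have 1: "{z \<in> space ?M. \<lfloor>real (Suc k) * fst z\<rfloor> = n} \<in> sets ?M" for n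
      using floor_level_measurable[OF f] unfolding pred_def .
    have 2: "{z \<in> space ?M. (fst z \<le> L) = p} \<in> sets ?M" for p
    proof -
      have "{z \<in> space ?M. h z \<le> L} \<in> sets ?M" if [measurable]: "h \<in> borel_measurable ?M" for h :: "real \<times> 'd path \<Rightarrow> real"
        by measurable
      from this[OF f] have "{z \<in> space ?M. fst z \<le> L} \<in> sets ?M" .
      moreover from this have "space ?M - {z \<in> space ?M. fst z \<le> L} \<in> sets ?M" by (rule sets.compl_sets)
      moreover have "space ?M - {z \<in> space ?M. fst z \<le> L} = {z \<in> space ?M. \<not> fst z \<le> L}" by blast
      ultimately show ?thesis by (cases p) simp_all
    qed
    have 3: "{z \<in> space ?M. path_code r k (snd z) = c} \<in> sets ?M" for c
    proof -
      have "(\<lambda>z. path_code r k (snd z)) -` {c} \<inter> space ?M \<in> sets ?M" by (rule measurable_sets[OF pc]) simp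
      moreover have "(\<lambda>z. path_code r k (snd z)) -` {c} \<inter> space ?M = {z \<in> space ?M. path_code r k (snd z) = c}" by blast
      ultimately show ?thesis by simp
    qed
    have eq: "?code k -` {((n, p), c)} \<inter> space ?M =
      {z \<in> space ?M. \<lfloor>real (Suc k) * fst z\<rfloor> = n} \<inter> {z \<in> space ?M. (fst z \<le> L) = p} \<inter> {z \<in> space ?M. path_code r k (snd z) = c}" for n p c
      by auto
    then have "?code k -` {x} \<inter> space ?M \<in> sets ?M" for x
    proof -
      obtain y c where "x = (y, c)" by (cases x)
      moreover obtain n p where "y = (n, p)" by (cases y)
      ultimately have x: "x = ((n, p), c)" by simp
      show ?thesis unfolding x eq by (intro sets.Int 1 2 3)
    qed
    then show "?code k \<in> measurable ?M (count_space UNIV)"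
      by (subst measurable_count_space_eq2_countable) auto
  next
    fix z assume "z \<in> space ?M"
    then show "g (fst z) (snd z) \<in> borel_measurable N" using g by (simp add: sp)
  next
    fix z a and w :: "nat \<Rightarrow> real \<times> 'd path"
    assume z: "z \<in> space ?M" and a: "a \<in> space N" and w: "\<And>k. w k \<in> space ?M" and eq: "\<And>k. ?code k (w k) = ?code k z"
    show "(\<lambda>k. g (fst (w k)) (snd (w k)) a) \<longlonglongrightarrow> g (fst z) (snd z) a"
    proof (rule metric_LIMSEQ_I)
      fix e :: real assume e: "0 < e"
      then have "0 < e / 2" by simp
      from cont[of "fst z" "snd z" a, OF _ _ a this] z obtain \<delta> where \<delta>: "0 < \<delta>"
        "\<And>s' \<omega>'. s' \<in> {0..r} \<Longrightarrow> \<omega>' \<in> path_space T \<Longrightarrow> (fst z \<le> L \<longleftrightarrow> s' \<le> L) \<Longrightarrow> \<bar>fst z - s'\<bar> \<le> \<delta> \<Longrightarrow>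
          (\<forall>v\<in>{0..r}. norm (snd z v - \<omega>' v) \<le> \<delta>) \<Longrightarrow> dist (g s' \<omega>' a) (g (fst z) (snd z) a) \<le> e / 2"
        unfolding sp by blast
      have "(\<lambda>k. (2 + real CARD('d)) / real (Suc k)) \<longlonglongrightarrow> 0" by (rule LIMSEQ_Suc) (rule lim_const_over_n)
      then obtain K where K: "\<And>k. k \<ge> K \<Longrightarrow> (2 + real CARD('d)) / real (Suc k) < \<delta>"
        using order_tendstoD(2)[OF _ \<delta>(1)] by (metis eventually_sequentially)
      have "dist (g (fst (w k)) (snd (w k)) a) (g (fst z) (snd z) a) < e" if k: "k \<ge> K" for k
      proof -
        have "\<lfloor>real (Suc k) * fst z\<rfloor> = \<lfloor>real (Suc k) * fst (w k)\<rfloor>" and fl: "fst z \<le> L \<longleftrightarrow> fst (w k) \<le> L"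
          and pc: "path_code r k (snd z) = path_code r k (snd (w k))" using eq[of k] by auto
        from floor_eq_imp_abs_diff_less[OF this(1)] have "real (Suc k) * \<bar>fst z - fst (w k)\<bar> < 1"
          by (simp add: right_diff_distrib[symmetric] abs_mult)
        then have "\<bar>fst z - fst (w k)\<bar> \<le> 1 / real (Suc k)" by (simp add: pos_le_divide_eq mult.commute)
        also have "\<dots> \<le> (2 + real CARD('d)) / real (Suc k)" by (intro divide_right_mono) auto
        finally have 1: "\<bar>fst z - fst (w k)\<bar> \<le> \<delta>" using K[OF k] by simp
        have 2: "\<forall>v\<in>{0..r}. norm (snd z v - snd (w k) v) \<le> \<delta>"
          using path_code_eq_imp_close[OF r _ _ pc] z w[of k] K[OF k] unfolding sp by fastforce
        have "dist (g (fst (w k)) (snd (w k)) a) (g (fst z) (snd z) a) \<le> e / 2"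
          using w[of k] fl 1 2 unfolding sp by (intro \<delta>(2)) auto
        then show ?thesis using e by simp
      qed
      then show "\<exists>K. \<forall>k\<ge>K. dist (g (fst (w k)) (snd (w k)) a) (g (fst z) (snd z) a) < e" by blast
    qed
  qed
  then show ?thesis by (simp add: split_beta')
qed

section \<open>Stability of game costs\<close>

lemma borel_measurable_vec_components:
  fixes f :: "'x \<Rightarrow> ('a::euclidean_space) ^ 'n::finite"
  assumes "\<And>i. (\<lambda>x. f x $ i) \<in> borel_measurable M"
  shows "f \<in> borel_measurable M"
  unfolding borel_measurable_euclidean_space[of f]
proof
  fix b :: "'a ^ 'n" assume "b \<in> Basis"
  then obtain i u where b: "b = axis i u" by (auto simp: Basis_vec_def)
  have "(\<lambda>x. f x $ i \<bullet> u) \<in> borel_measurable M" by (intro borel_measurable_inner assms borel_measurable_const)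
  then show "(\<lambda>x. f x \<bullet> b) \<in> borel_measurable M" by (simp add: b inner_axis)
qed

section \<open>Shifted coefficients along a control\<close>

context wiener begin

text \<open>Bundles the assumptions with an explicit common bound \<open>C\<close>, so that the
  constants of the stability estimates can be chosen from \<open>C\<close> alone.\<close>

definition regular_game :: "real \<Rightarrow> ('n::finite \<Rightarrow> 'a::euclidean_space set) \<Rightarrow>
   (real \<Rightarrow> 'd path \<Rightarrow> 'a ^ 'n \<Rightarrow> real ^ 'd) \<Rightarrow> (real \<Rightarrow> 'd path \<Rightarrow> 'a ^ 'n \<Rightarrow> real ^ 'n) \<Rightarrow>
   ('d path \<Rightarrow> real ^ 'n) \<Rightarrow> (real \<Rightarrow> real) \<Rightarrow> bool" where
  "regular_game C A b f \<xi> \<rho> \<longleftrightarrow> game_data T P A b f \<xi> \<and> modulus_of_continuity \<rho> \<and> state_modulus T A b f \<xi> \<rho> \<and>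
     (\<forall>s\<in>{0..T}. \<forall>\<omega>\<in>path_space T. \<forall>a\<in>action_set A. norm (b s \<omega> a) \<le> C \<and> norm (f s \<omega> a) \<le> C) \<and>
     (\<forall>\<omega>\<in>path_space T. norm (\<xi> \<omega>) \<le> C)"

text \<open>Extended by 0 beyond the horizon just as the drift is, so running costs and drifts with
  different horizons are processes on the same interval.\<close>

definition shifted_cost :: "(real \<Rightarrow> 'd path \<Rightarrow> 'x \<Rightarrow> real ^ 'n::finite) \<Rightarrow> real \<Rightarrow> 'd path \<Rightarrow>
   (real \<Rightarrow> 'd path \<Rightarrow> 'x) \<Rightarrow> 'n \<Rightarrow> real \<Rightarrow> 'd path \<Rightarrow> real" where
  "shifted_cost f t \<omega> \<alpha> i s \<omega>' = indicator {0..T - t} s *\<^sub>R (f (t + s) (concat_path T t \<omega> \<omega>') (\<alpha> s \<omega>') $ i)"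

definition payoff :: "('d path \<Rightarrow> real) \<Rightarrow> (real \<Rightarrow> 'd path \<Rightarrow> real) \<Rightarrow> 'd path \<Rightarrow> real" where
  "payoff \<Xi> U \<omega> = \<Xi> \<omega> + (LBINT s:{0..T}. U s \<omega>)"

lemma game_data_section_measurable:
  assumes "game_data T P A b f \<xi>" "s \<in> {0..T}" "\<omega> \<in> path_space T"
  shows "b s \<omega> \<in> borel_measurable (restrict_space borel (action_set A))"
    and "f s \<omega> \<in> borel_measurable (restrict_space borel (action_set A))"
proof -
  have T: "T \<in> {0..T}" using T_pos by simp
  have sp: "(s, \<omega>) \<in> space (restrict_space borel {0..T} \<Otimes>\<^sub>M F T)"
    using assms by (simp add: space_pair_measure space_restrict_space)
  have m: "(\<lambda>((s, \<omega>), a). b s \<omega> a) \<in> borel_measurable ((restrict_space borel {0..T} \<Otimes>\<^sub>M F T) \<Otimes>\<^sub>M restrict_space borel (action_set A))"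
    "(\<lambda>((s, \<omega>), a). f s \<omega> a) \<in> borel_measurable ((restrict_space borel {0..T} \<Otimes>\<^sub>M F T) \<Otimes>\<^sub>M restrict_space borel (action_set A))"
    using assms(1) T unfolding game_data_def by blast+
  show "b s \<omega> \<in> borel_measurable (restrict_space borel (action_set A))"
    using measurable_Pair2[OF m(1) sp] by simp
  show "f s \<omega> \<in> borel_measurable (restrict_space borel (action_set A))"
    using measurable_Pair2[OF m(2) sp] by simp
qed

text \<open>The law of the concatenated path is singular to \<open>P\<close>, so measurability of the data for the
  augmented filtration says nothing about the shifted data; it is the continuity in the state
  that makes them measurable, even for the unaugmented filtration.\<close>

lemma shifted_raw_measurable:
  fixes h :: "real \<Rightarrow> 'd path \<Rightarrow> 'x \<Rightarrow> 'b::euclidean_space"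
  assumes sec: "\<And>s \<omega>. s \<in> {0..T} \<Longrightarrow> \<omega> \<in> path_space T \<Longrightarrow> h s \<omega> \<in> borel_measurable N"
    and \<rho>: "modulus_of_continuity \<rho>"
    and mod: "\<And>s s' \<omega> \<omega>' a. s \<in> {0..T} \<Longrightarrow> s' \<in> {0..T} \<Longrightarrow> \<omega> \<in> path_space T \<Longrightarrow> \<omega>' \<in> path_space T \<Longrightarrow> a \<in> space N \<Longrightarrow>
      norm (h s \<omega> a - h s' \<omega>' a) \<le> \<rho> (path_dist T s \<omega> s' \<omega>')"
    and t: "t \<in> {0..T}" and \<omega>: "\<omega> \<in> path_space T" and r: "r \<in> {0..T}"
  shows "(\<lambda>((s, \<omega>'), a). indicator {0..T - t} s *\<^sub>R h (t + s) (concat_path T t \<omega> \<omega>') a)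
    \<in> borel_measurable ((restrict_space borel {0..r} \<Otimes>\<^sub>M raw_filtration T r) \<Otimes>\<^sub>M N)"
proof (rule raw_measurable_of_continuous[where L="T - t"])
  show "0 \<le> r" "r \<le> T" using r by auto
  show "(\<lambda>a. indicator {0..T - t} s *\<^sub>R h (t + s) (concat_path T t \<omega> \<omega>') a) \<in> borel_measurable N"
    if "s \<in> {0..r}" "\<omega>' \<in> path_space T" for s \<omega>'
  proof (cases "s \<in> {0..T - t}")
    case True
    have "h (t + s) (concat_path T t \<omega> \<omega>') \<in> borel_measurable N"
      using True t by (intro sec concat_path_in_path_space[OF \<omega> that(2) t]) auto
    then show ?thesis using True by simp
  qed simp
next
  fix s and \<omega>' :: "'d path" and a and e :: real
  assume s: "s \<in> {0..r}" and \<omega>': "\<omega>' \<in> path_space T" and a: "a \<in> space N" and e: "0 < e"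
  show "\<exists>\<delta>>0. \<forall>s'\<in>{0..r}. \<forall>\<omega>''\<in>path_space T. (s \<le> T - t \<longleftrightarrow> s' \<le> T - t) \<longrightarrow> \<bar>s - s'\<bar> \<le> \<delta> \<longrightarrow>
        (\<forall>v\<in>{0..r}. norm (\<omega>' v - \<omega>'' v) \<le> \<delta>) \<longrightarrow>
        dist (indicator {0..T - t} s' *\<^sub>R h (t + s') (concat_path T t \<omega> \<omega>'') a) (indicator {0..T - t} s *\<^sub>R h (t + s) (concat_path T t \<omega> \<omega>') a) \<le> e"
  proof (cases "s \<le> T - t")
    \<comment> \<open>Beyond the horizon both values are 0, because the condition on
      \<open>L\<close> puts \<open>s'\<close> on the same side.\<close>
    case False
    then show ?thesis using e by (intro exI[of _ 1]) auto
  next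
    case True
    obtain \<delta>\<^sub>0 where \<delta>\<^sub>0: "0 < \<delta>\<^sub>0" "\<And>x. 0 \<le> x \<Longrightarrow> x \<le> \<delta>\<^sub>0 \<Longrightarrow> \<rho> x \<le> e"
      using modulus_small[OF \<rho> e] by blast
    have cont: "continuous_on {0..r} \<omega>'" using path_spaceD(1)[OF \<omega>'] r by (auto intro: continuous_on_subset)
    obtain n where n: "tight_path r (1 / real (Suc n)) (\<delta>\<^sub>0 / 4) \<omega>'"
      using tight_path_exists[OF cont, of "\<delta>\<^sub>0 / 4"] \<delta>\<^sub>0(1) by auto
    \<comment> \<open>Three contributions of at most a quarter of \<open>\<delta>\<^sub>0\<close>
      each: the distance of the driving paths, the oscillation over a lag below
      \<open>1 / (n + 1)\<close>, and the square root of the time difference. The base point is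
      common and contributes nothing.\<close>
    define \<delta> where "\<delta> = min (\<delta>\<^sub>0 / 4) (min (1 / (2 * real (Suc n))) ((\<delta>\<^sub>0 / 4)\<^sup>2))"
    have \<delta>: "0 < \<delta>" "\<delta> \<le> \<delta>\<^sub>0 / 4" "\<delta> \<le> (\<delta>\<^sub>0 / 4)\<^sup>2" "\<delta> < 1 / real (Suc n)"
    proof -
      show "0 < \<delta>" "\<delta> \<le> \<delta>\<^sub>0 / 4" "\<delta> \<le> (\<delta>\<^sub>0 / 4)\<^sup>2" using \<delta>\<^sub>0(1) by (auto simp: \<delta>_def)
      have "\<delta> \<le> 1 / (2 * real (Suc n))" by (simp add: \<delta>_def)
      also have "\<dots> < 1 / real (Suc n)" by (intro divide_strict_left_mono) auto
      finally show "\<delta> < 1 / real (Suc n)" .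
    qed
    have "dist (h (t + s') (concat_path T t \<omega> \<omega>'') a) (h (t + s) (concat_path T t \<omega> \<omega>') a) \<le> e"
      if s': "s' \<in> {0..r}" "s' \<le> T - t" "\<bar>s - s'\<bar> \<le> \<delta>" and \<omega>'': "\<omega>'' \<in> path_space T" "\<forall>v\<in>{0..r}. norm (\<omega>' v - \<omega>'' v) \<le> \<delta>"
      for s' \<omega>''
    proof -
      let ?D = "path_dist T (t + s) (concat_path T t \<omega> \<omega>') (t + s') (concat_path T t \<omega> \<omega>'')"
      have ts: "t + s \<in> {0..T}" "t + s' \<in> {0..T}" using t s s' True by auto
      note c = concat_path_in_path_space[OF \<omega> \<omega>' t] concat_path_in_path_space[OF \<omega> \<omega>''(1) t]
      have "?D \<le> sqrt (\<bar>t - t\<bar> + \<bar>s - s'\<bar>) + path_norm T (\<lambda>v. \<omega> (min t v) - \<omega> (min t v)) + \<delta> + \<delta>\<^sub>0 / 4"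
      proof (rule path_dist_concat_le[where r=r])
        show "norm (\<omega>' v - \<omega>' v') \<le> \<delta>\<^sub>0 / 4" if "v \<in> {0..r}" "v' \<in> {0..r}" "\<bar>v - v'\<bar> \<le> \<bar>t - t\<bar> + \<bar>s - s'\<bar>" for v v'
          using that s'(3) \<delta>(4) \<delta>\<^sub>0(1) by (intro tight_pathD[OF n cont]) auto
      qed (use s s' t r True \<omega> \<omega>' \<omega>'' in auto)
      also have "path_norm T (\<lambda>v. \<omega> (min t v) - \<omega> (min t v)) \<le> 0" using T_pos by (intro path_norm_le) auto
      also have "sqrt (\<bar>t - t\<bar> + \<bar>s - s'\<bar>) \<le> \<delta>\<^sub>0 / 4"
        using s'(3) \<delta>(3) \<delta>\<^sub>0(1) by (intro real_le_lsqrt) auto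
      finally have "?D \<le> \<delta>\<^sub>0" using \<delta>(2) \<delta>\<^sub>0(1) by simp
      then have "\<rho> ?D \<le> e" by (intro \<delta>\<^sub>0(2) path_dist_nonneg c ts)
      then show ?thesis using mod[OF ts c a] by (simp add: dist_norm norm_minus_commute)
    qed
    then show ?thesis using \<delta>(1) s True by (intro exI[of _ \<delta>]) (auto simp: indicator_def)
  qed
qed

text \<open>The control is progressive for the augmented filtration only. Joint measurability in
  state and action is what allows it to be substituted for the action.\<close>

lemma shifted_prog_measurable:
  fixes h :: "real \<Rightarrow> 'd path \<Rightarrow> 'x \<Rightarrow> 'b::euclidean_space"
  assumes h: "\<And>r. r \<in> {0..T} \<Longrightarrow> (\<lambda>((s, \<omega>'), a). indicator {0..T - t} s *\<^sub>R h (t + s) (concat_path T t \<omega> \<omega>') a)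
      \<in> borel_measurable ((restrict_space borel {0..r} \<Otimes>\<^sub>M raw_filtration T r) \<Otimes>\<^sub>M N)"
    and \<alpha>: "\<alpha> \<in> prog_measurable T P N"
  shows "(\<lambda>s \<omega>'. indicator {0..T - t} s *\<^sub>R h (t + s) (concat_path T t \<omega> \<omega>') (\<alpha> s \<omega>')) \<in> prog_measurable T P borel"
  unfolding prog_measurable_def
proof (intro CollectI ballI)
  fix r assume r: "r \<in> {0..T}"
  let ?R = "restrict_space borel {0..r} :: real measure"
  have \<alpha>r: "(\<lambda>x. \<alpha> (fst x) (snd x)) \<in> measurable (?R \<Otimes>\<^sub>M F r) N"
    using \<alpha> r by (simp add: prog_measurable_def split_beta')
  have id: "(\<lambda>\<omega>. \<omega>) \<in> measurable (F r) (raw_filtration T r)"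
    by (rule measurable_raw_F) simp
  have "(\<lambda>x. ((fst x, snd x), \<alpha> (fst x) (snd x))) \<in> measurable (?R \<Otimes>\<^sub>M F r) ((?R \<Otimes>\<^sub>M raw_filtration T r) \<Otimes>\<^sub>M N)"
    by (intro measurable_Pair measurable_fst \<alpha>r measurable_compose[OF measurable_snd id])
  from measurable_compose[OF this h[OF r]]
  show "(\<lambda>(s, \<omega>'). indicator {0..T - t} s *\<^sub>R h (t + s) (concat_path T t \<omega> \<omega>') (\<alpha> s \<omega>')) \<in> borel_measurable (?R \<Otimes>\<^sub>M F r)"
    by (simp add: split_beta')
qed

lemma player_controls_value:
  assumes "\<beta> \<in> player_controls T P A i" "s \<in> {0..T}" "\<omega> \<in> path_space T"
  shows "\<beta> s \<omega> \<in> A i"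
proof -
  have "(\<lambda>(s, \<omega>). \<beta> s \<omega>) \<in> measurable (restrict_space borel {0..T} \<Otimes>\<^sub>M F T) (restrict_space borel (A i))"
    using assms T_pos unfolding player_controls_def prog_measurable_def by simp
  from measurable_space[OF this, of "(s, \<omega>)"] show ?thesis
    using assms(2,3) by (simp add: space_pair_measure space_restrict_space)
qed

lemma controls_value:
  assumes "\<alpha> \<in> controls T P A" "s \<in> {0..T}" "\<omega> \<in> path_space T"
  shows "\<alpha> s \<omega> \<in> action_set A"
  using assms player_controls_value[of "\<lambda>s \<omega>. \<alpha> s \<omega> $ i" A i for i] by (auto simp: controls_def action_set_def)

lemma controls_prog_measurable:
  assumes \<alpha>: "\<alpha> \<in> controls T P A"
  shows "\<alpha> \<in> prog_measurable T P (restrict_space borel (action_set A))"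
  unfolding prog_measurable_def
proof (intro CollectI ballI measurable_restrict_space2)
  fix r assume r: "r \<in> {0..T}"
  let ?R = "restrict_space borel {0..r} :: real measure"
  have "\<And>s \<omega>. s \<in> {0..r} \<Longrightarrow> \<omega> \<in> path_space T \<Longrightarrow> \<alpha> s \<omega> \<in> action_set A"
    using controls_value[OF \<alpha>] r by auto
  then show "(\<lambda>(s, \<omega>). \<alpha> s \<omega>) \<in> space (?R \<Otimes>\<^sub>M F r) \<rightarrow> action_set A"
    by (auto simp: space_pair_measure space_restrict_space)
  show "(\<lambda>(s, \<omega>). \<alpha> s \<omega>) \<in> borel_measurable (?R \<Otimes>\<^sub>M F r)"
  proof (rule borel_measurable_vec_components)
    fix i
    have "(\<lambda>(s, \<omega>). \<alpha> s \<omega> $ i) \<in> measurable (?R \<Otimes>\<^sub>M F r) (restrict_space borel (A i))"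
      using \<alpha> r by (simp add: controls_def player_controls_def prog_measurable_def)
    then show "(\<lambda>x. (case x of (s, \<omega>) \<Rightarrow> \<alpha> s \<omega>) $ i) \<in> borel_measurable (?R \<Otimes>\<^sub>M F r)"
      unfolding split_beta' measurable_restrict_space2_iff by blast
  qed
qed

lemma replace_control_in_controls:
  assumes "\<alpha> \<in> controls T P A" "\<beta> \<in> player_controls T P A i"
  shows "replace_control \<alpha> i \<beta> \<in> controls T P A"
  unfolding controls_def
proof (intro CollectI allI)
  fix j
  show "(\<lambda>s \<omega>. replace_control \<alpha> i \<beta> s \<omega> $ j) \<in> player_controls T P A j"
    using assms by (cases "j = i") (auto simp: replace_control_def controls_def)
qed

lemma regular_gameD:
  assumes "regular_game C A b f \<xi> \<rho>"
  shows "game_data T P A b f \<xi>" "modulus_of_continuity \<rho>"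
    "\<And>t t' \<omega> \<omega>' a. t \<in> {0..T} \<Longrightarrow> t' \<in> {0..T} \<Longrightarrow> \<omega> \<in> path_space T \<Longrightarrow> \<omega>' \<in> path_space T \<Longrightarrow> a \<in> action_set A \<Longrightarrow>
      norm (b t \<omega> a - b t' \<omega>' a) \<le> \<rho> (path_dist T t \<omega> t' \<omega>')"
    "\<And>t t' \<omega> \<omega>' a. t \<in> {0..T} \<Longrightarrow> t' \<in> {0..T} \<Longrightarrow> \<omega> \<in> path_space T \<Longrightarrow> \<omega>' \<in> path_space T \<Longrightarrow> a \<in> action_set A \<Longrightarrow>
      norm (f t \<omega> a - f t' \<omega>' a) \<le> \<rho> (path_dist T t \<omega> t' \<omega>')"
    "\<And>\<omega> \<omega>'. \<omega> \<in> path_space T \<Longrightarrow> \<omega>' \<in> path_space T \<Longrightarrow> norm (\<xi> \<omega> - \<xi> \<omega>') \<le> \<rho> (path_dist T T \<omega> T \<omega>')"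
    "\<And>t \<omega> a. t \<in> {0..T} \<Longrightarrow> \<omega> \<in> path_space T \<Longrightarrow> a \<in> action_set A \<Longrightarrow> norm (b t \<omega> a) \<le> C"
    "\<And>t \<omega> a. t \<in> {0..T} \<Longrightarrow> \<omega> \<in> path_space T \<Longrightarrow> a \<in> action_set A \<Longrightarrow> norm (f t \<omega> a) \<le> C"
    "\<And>\<omega>. \<omega> \<in> path_space T \<Longrightarrow> norm (\<xi> \<omega>) \<le> C"
  using assms T_pos unfolding regular_game_def state_modulus_def by (simp_all add: path_norm_diff_eq_path_dist[symmetric])

lemma path_space_nonempty: "\<exists>\<omega>. \<omega> \<in> (path_space T :: 'd path set)"
  using Q.not_empty by auto

lemma regular_game_nonneg:
  assumes "regular_game C A b f \<xi> \<rho>" shows "0 \<le> C"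
  using path_space_nonempty regular_gameD(8)[OF assms] order_trans[OF norm_ge_zero] by blast

lemma shifted_bounded_progressive:
  fixes h :: "real \<Rightarrow> 'd path \<Rightarrow> 'a::euclidean_space ^ 'n::finite \<Rightarrow> 'b::euclidean_space"
  assumes sec: "\<And>s \<omega>. s \<in> {0..T} \<Longrightarrow> \<omega> \<in> path_space T \<Longrightarrow> h s \<omega> \<in> borel_measurable (restrict_space borel (action_set A))"
    and \<rho>: "modulus_of_continuity \<rho>"
    and mod: "\<And>s s' \<omega> \<omega>' a. s \<in> {0..T} \<Longrightarrow> s' \<in> {0..T} \<Longrightarrow> \<omega> \<in> path_space T \<Longrightarrow> \<omega>' \<in> path_space T \<Longrightarrow> a \<in> action_set A \<Longrightarrow>
      norm (h s \<omega> a - h s' \<omega>' a) \<le> \<rho> (path_dist T s \<omega> s' \<omega>')"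
    and bd: "\<And>s \<omega> a. s \<in> {0..T} \<Longrightarrow> \<omega> \<in> path_space T \<Longrightarrow> a \<in> action_set A \<Longrightarrow> norm (h s \<omega> a) \<le> C" and C: "0 \<le> C"
    and t: "t \<in> {0..T}" and \<omega>: "\<omega> \<in> path_space T" and \<alpha>: "\<alpha> \<in> controls T P A"
  shows "bounded_progressive C (\<lambda>s \<omega>'. indicator {0..T - t} s *\<^sub>R h (t + s) (concat_path T t \<omega> \<omega>') (\<alpha> s \<omega>'))"
  unfolding bounded_progressive_def
proof (intro conjI ballI)
  show "(\<lambda>s \<omega>'. indicator {0..T - t} s *\<^sub>R h (t + s) (concat_path T t \<omega> \<omega>') (\<alpha> s \<omega>')) \<in> prog_measurable T P borel"
  proof (rule shifted_prog_measurable[OF _ controls_prog_measurable[OF \<alpha>]])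
    fix r assume "r \<in> {0..T}"
    then show "(\<lambda>((s, \<omega>'), a). indicator {0..T - t} s *\<^sub>R h (t + s) (concat_path T t \<omega> \<omega>') a)
      \<in> borel_measurable ((restrict_space borel {0..r} \<Otimes>\<^sub>M raw_filtration T r) \<Otimes>\<^sub>M restrict_space borel (action_set A))"
      using mod by (intro shifted_raw_measurable[OF sec \<rho>] t \<omega>) (auto simp: space_restrict_space)
  qed
  fix s and \<omega>' :: "'d path" assume s: "s \<in> {0..T}" and \<omega>': "\<omega>' \<in> path_space T"
  show "norm (indicator {0..T - t} s *\<^sub>R h (t + s) (concat_path T t \<omega> \<omega>') (\<alpha> s \<omega>')) \<le> C"
  proof (cases "s \<in> {0..T - t}")
    case True
    then have "t + s \<in> {0..T}" using t by auto
    from bd[OF this concat_path_in_path_space[OF \<omega> \<omega>' t] controls_value[OF \<alpha> s \<omega>']] True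
    show ?thesis by simp
  qed (use C in simp)
qed

lemma shifted_drift_bounded_progressive:
  assumes g: "regular_game C A b f \<xi> \<rho>" and t: "t \<in> {0..T}" "\<omega> \<in> path_space T" and \<alpha>: "\<alpha> \<in> controls T P A"
  shows "bounded_progressive C (shifted_drift T b t \<omega> \<alpha>)"
proof -
  have "shifted_drift T b t \<omega> \<alpha> = (\<lambda>s \<omega>'. indicator {0..T - t} s *\<^sub>R b (t + s) (concat_path T t \<omega> \<omega>') (\<alpha> s \<omega>'))"
    by (intro ext) (simp add: shifted_drift_def)
  moreover have "bounded_progressive C (\<lambda>s \<omega>'. indicator {0..T - t} s *\<^sub>R b (t + s) (concat_path T t \<omega> \<omega>') (\<alpha> s \<omega>'))"
  proof (rule shifted_bounded_progressive[OF _ regular_gameD(2)[OF g] _ _ regular_game_nonneg[OF g] t \<alpha>])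
    show "b s \<omega> \<in> borel_measurable (restrict_space borel (action_set A))" if "s \<in> {0..T}" "\<omega> \<in> path_space T" for s \<omega>
      by (rule game_data_section_measurable(1)[OF regular_gameD(1)[OF g] that])
  qed (rule regular_gameD(3,6)[OF g], assumption+)+
  ultimately show ?thesis by simp
qed

lemma shifted_cost_bounded_progressive:
  assumes g: "regular_game C A b f \<xi> \<rho>" and t: "t \<in> {0..T}" "\<omega> \<in> path_space T" and \<alpha>: "\<alpha> \<in> controls T P A"
  shows "bounded_progressive C (shifted_cost f t \<omega> \<alpha> i)"
proof -
  have "shifted_cost f t \<omega> \<alpha> i = (\<lambda>s \<omega>'. indicator {0..T - t} s *\<^sub>R (\<lambda>s \<omega> a. f s \<omega> a $ i) (t + s) (concat_path T t \<omega> \<omega>') (\<alpha> s \<omega>'))"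
    by (intro ext) (simp add: shifted_cost_def)
  moreover have "bounded_progressive C (\<lambda>s \<omega>'. indicator {0..T - t} s *\<^sub>R (\<lambda>s \<omega> a. f s \<omega> a $ i) (t + s) (concat_path T t \<omega> \<omega>') (\<alpha> s \<omega>'))"
  proof (rule shifted_bounded_progressive[OF _ regular_gameD(2)[OF g] _ _ regular_game_nonneg[OF g] t \<alpha>])
    show "(\<lambda>a. f s \<omega> a $ i) \<in> borel_measurable (restrict_space borel (action_set A))" if "s \<in> {0..T}" "\<omega> \<in> path_space T" for s \<omega>
      by (rule measurable_compose[OF game_data_section_measurable(2)[OF regular_gameD(1)[OF g] that] borel_measurable_nth])
    show "norm (f s \<omega> a $ i - f s' \<omega>' a $ i) \<le> \<rho> (path_dist T s \<omega> s' \<omega>')"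
      if "s \<in> {0..T}" "s' \<in> {0..T}" "\<omega> \<in> path_space T" "\<omega>' \<in> path_space T" "a \<in> action_set A" for s s' \<omega> \<omega>' a
      using regular_gameD(4)[OF g that] component_le_norm_cart[of "f s \<omega> a - f s' \<omega>' a" i] by simp
    show "norm (f s \<omega> a $ i) \<le> C" if "s \<in> {0..T}" "\<omega> \<in> path_space T" "a \<in> action_set A" for s \<omega> a
      using regular_gameD(7)[OF g that] component_le_norm_cart[of "f s \<omega> a" i] by simp
  qed
  ultimately show ?thesis by simp
qed

text \<open>Reuses the criterion for running data with a dummy time and a one-point action space. At
  time 0 the indicator of \<open>{0..T - T}\<close> is 1, and \<open>L = 0\<close> separates this
  time from the later ones, where the function is 0.\<close>

lemma shifted_terminal_measurable:
  assumes g: "regular_game C A b f \<xi> \<rho>" and t: "t \<in> {0..T}" "\<omega> \<in> path_space T"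
  shows "(\<lambda>\<omega>'. \<xi> (concat_path T t \<omega> \<omega>') $ i) \<in> borel_measurable Q"
proof -
  define N :: "unit measure" where "N = count_space UNIV"
  have "(\<lambda>((s, \<omega>'), a). indicator {0..T - T} s *\<^sub>R (\<xi> (concat_path T t \<omega> \<omega>') $ i))
    \<in> borel_measurable ((restrict_space borel {0..T} \<Otimes>\<^sub>M raw_filtration T T) \<Otimes>\<^sub>M N)"
  proof (rule raw_measurable_of_continuous[where L=0])
    fix s and \<omega>' :: "'d path" and a and e :: real
    assume s: "s \<in> {0..T}" and \<omega>': "\<omega>' \<in> path_space T" and e: "0 < e"
    obtain \<delta>\<^sub>0 where \<delta>\<^sub>0: "0 < \<delta>\<^sub>0" "\<And>x. 0 \<le> x \<Longrightarrow> x \<le> \<delta>\<^sub>0 \<Longrightarrow> \<rho> x \<le> e"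
      using modulus_small[OF regular_gameD(2)[OF g] e] by blast
    have "dist (\<xi> (concat_path T t \<omega> \<omega>'') $ i) (\<xi> (concat_path T t \<omega> \<omega>') $ i) \<le> e"
      if \<omega>'': "\<omega>'' \<in> path_space T" "\<forall>v\<in>{0..T}. norm (\<omega>' v - \<omega>'' v) \<le> \<delta>\<^sub>0" for \<omega>''
    proof -
      let ?c = "concat_path T t \<omega> \<omega>'" and ?c' = "concat_path T t \<omega> \<omega>''"
      note c = concat_path_in_path_space[OF t(2) \<omega>' t(1)] concat_path_in_path_space[OF t(2) \<omega>''(1) t(1)]
      have T: "T \<in> {0..T}" using T_pos by simp
      have "path_dist T T ?c T ?c' \<le> \<delta>\<^sub>0"
        unfolding path_norm_diff_eq_path_dist[OF less_imp_le[OF T_pos], symmetric]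
      proof (rule path_norm_le)
        fix v assume v: "v \<in> {0..T}"
        have "max 0 (v - t) \<in> {0..T}" using v t by auto
        then show "norm (?c v - ?c' v) \<le> \<delta>\<^sub>0"
          using \<omega>''(2) v by (simp add: concat_path_eq[OF \<omega>'] concat_path_eq[OF \<omega>''(1)])
      qed (use T_pos in simp)
      then have "\<rho> (path_dist T T ?c T ?c') \<le> e" by (intro \<delta>\<^sub>0(2) path_dist_nonneg c T)
      then have "norm (\<xi> ?c - \<xi> ?c') \<le> e" using regular_gameD(5)[OF g c] by simp
      then show ?thesis using component_le_norm_cart[of "\<xi> ?c - \<xi> ?c'" i] by (simp add: dist_real_def abs_minus_commute)
    qed
    then show "\<exists>\<delta>>0. \<forall>s'\<in>{0..T}. \<forall>\<omega>''\<in>path_space T. (s \<le> 0 \<longleftrightarrow> s' \<le> 0) \<longrightarrow> \<bar>s - s'\<bar> \<le> \<delta> \<longrightarrow>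
        (\<forall>v\<in>{0..T}. norm (\<omega>' v - \<omega>'' v) \<le> \<delta>) \<longrightarrow>
        dist (indicator {0..T - T} s' *\<^sub>R (\<xi> (concat_path T t \<omega> \<omega>'') $ i)) (indicator {0..T - T} s *\<^sub>R (\<xi> (concat_path T t \<omega> \<omega>') $ i)) \<le> e"
      using \<delta>\<^sub>0(1) s e by (intro exI[of _ \<delta>\<^sub>0]) (auto simp: indicator_def)
  qed (use T_pos in \<open>auto simp: N_def\<close>)
  moreover have "(\<lambda>\<omega>'. ((0, \<omega>'), ())) \<in> measurable Q ((restrict_space borel {0..T} \<Otimes>\<^sub>M raw_filtration T T) \<Otimes>\<^sub>M N)"
  proof (intro measurable_Pair)
    show "(\<lambda>\<omega>'. 0) \<in> measurable Q (restrict_space borel {0..T})"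
      using T_pos by (intro measurable_const) (simp add: space_restrict_space)
    have "(\<lambda>\<omega>. \<omega>) \<in> measurable (F T) (raw_filtration T T)" by (rule measurable_raw_F) simp
    then show "(\<lambda>\<omega>. \<omega>) \<in> measurable Q (raw_filtration T T)" by (rule measurable_F_Q) simp
    show "(\<lambda>\<omega>'. ()) \<in> measurable Q N" by (simp add: N_def)
  qed
  ultimately have "(\<lambda>\<omega>'. (\<lambda>((s, \<omega>'), a). indicator {0..T - T} s *\<^sub>R (\<xi> (concat_path T t \<omega> \<omega>') $ i)) ((0, \<omega>'), ())) \<in> borel_measurable Q"
    by (rule measurable_compose[rotated])
  then show ?thesis by simp
qed

lemma game_cost_eq:
  assumes "t \<in> {0..T}"
  shows "game_cost T P b f \<xi> t \<omega> \<alpha> $ i =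
    drift_cost (shifted_drift T b t \<omega> \<alpha>) (payoff (\<lambda>\<omega>'. \<xi> (concat_path T t \<omega> \<omega>') $ i) (shifted_cost f t \<omega> \<alpha> i))"
proof -
  have "(LBINT s:{0..T - t}. f (t + s) (concat_path T t \<omega> \<omega>') (\<alpha> s \<omega>') $ i) = (LBINT s:{0..T}. shifted_cost f t \<omega> \<alpha> i s \<omega>')" for \<omega>'
    unfolding set_lebesgue_integral_def shifted_cost_def
    using assms by (intro Bochner_Integration.integral_cong) (auto simp: indicator_def)
  then show ?thesis
    by (simp add: game_cost_def drift_cost_def controlled_measure_def quad_var_def payoff_def[abs_def])
qed

section \<open>Payoffs, and stability of costs up to small exceptional sets\<close>

lemma running_integrable:
  assumes U: "bounded_progressive C U" and \<omega>: "\<omega> \<in> path_space T"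
  shows "integrable lborel (\<lambda>s. indicator {0..T} s *\<^sub>R (U s \<omega> :: real))"
proof (rule Bochner_Integration.integrable_bound[where f="\<lambda>s. C * indicator {0..T} s"])
  show "integrable lborel (\<lambda>s. C * indicator {0..T} s)"
    by (intro integrable_mult_right integrable_real_indicator) (auto simp: emeasure_lborel_Icc_eq)
  show "(\<lambda>s. indicator {0..T} s *\<^sub>R U s \<omega>) \<in> borel_measurable lborel"
    using measurable_Pair2[OF bounded_progressive_jm[OF U, unfolded jointly_measurable_def], of \<omega>] \<omega> by simp
  show "AE s in lborel. norm (indicator {0..T} s *\<^sub>R U s \<omega>) \<le> norm (C * indicator {0..T} s)"
  proof (rule AE_I2)
    fix s
    show "norm (indicator {0..T} s *\<^sub>R U s \<omega>) \<le> norm (C * indicator {0..T} s)"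
    proof (cases "s \<in> {0..T}")
      case True
      then have "norm (U s \<omega>) \<le> C" using U \<omega> by (simp add: bounded_progressive_def)
      then show ?thesis using True by simp
    qed simp
  qed
qed

text \<open>\<open>J\<close> gathers the times at which nothing better than the trivial bound
  \<open>2 * C\<close> is known.\<close>

lemma running_diff_le:
  assumes U: "bounded_progressive C U" and U': "bounded_progressive C U'" and \<omega>: "\<omega> \<in> path_space T"
    and C: "0 \<le> C" and \<kappa>: "0 \<le> \<kappa>" and j: "0 \<le> j"
    and J: "J \<in> sets borel" "emeasure lborel J \<le> ennreal j"
    and close: "\<And>s. s \<in> {0..T} - J \<Longrightarrow> \<bar>U s \<omega> - U' s \<omega>\<bar> \<le> \<kappa>"
  shows "\<bar>(LBINT s:{0..T}. U s \<omega>) - (LBINT s:{0..T}. U' s \<omega>)\<bar> \<le> \<kappa> * T + 2 * C * j"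
proof -
  note i = running_integrable[OF U \<omega>] running_integrable[OF U' \<omega>]
  have "(LBINT s:{0..T}. U s \<omega>) - (LBINT s:{0..T}. U' s \<omega>) = (\<integral>s. indicator {0..T} s *\<^sub>R U s \<omega> - indicator {0..T} s *\<^sub>R U' s \<omega> \<partial>lborel)"
    unfolding set_lebesgue_integral_def by (rule Bochner_Integration.integral_diff[OF i, symmetric])
  then have "ennreal \<bar>(LBINT s:{0..T}. U s \<omega>) - (LBINT s:{0..T}. U' s \<omega>)\<bar>
      = ennreal (norm (\<integral>s. indicator {0..T} s *\<^sub>R U s \<omega> - indicator {0..T} s *\<^sub>R U' s \<omega> \<partial>lborel))"
    by (simp only: real_norm_def)
  also have "\<dots> \<le> (\<integral>\<^sup>+s. ennreal (norm (indicator {0..T} s *\<^sub>R U s \<omega> - indicator {0..T} s *\<^sub>R U' s \<omega>)) \<partial>lborel)"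
    by (intro integral_norm_bound_ennreal Bochner_Integration.integrable_diff i)
  also have "\<dots> \<le> (\<integral>\<^sup>+s. ennreal \<kappa> * indicator {0..T} s + ennreal (2 * C) * indicator J s \<partial>lborel)"
  proof (rule nn_integral_mono)
    fix s
    show "ennreal (norm (indicator {0..T} s *\<^sub>R U s \<omega> - indicator {0..T} s *\<^sub>R U' s \<omega>)) \<le> ennreal \<kappa> * indicator {0..T} s + ennreal (2 * C) * indicator J s"
    proof (cases "s \<in> {0..T}")
      case True
      show ?thesis
      proof (cases "s \<in> J")
        case False
        then show ?thesis using True close[of s] by (simp add: ennreal_leI)
      next
        case J: True
        have "norm (U s \<omega>) \<le> C" "norm (U' s \<omega>) \<le> C" using U U' \<omega> True by (auto simp: bounded_progressive_def)
        then have "\<bar>U s \<omega> - U' s \<omega>\<bar> \<le> 2 * C" by (simp add: abs_le_iff)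
        then have "ennreal \<bar>U s \<omega> - U' s \<omega>\<bar> \<le> ennreal (2 * C)" by (rule ennreal_leI)
        also have "\<dots> \<le> ennreal \<kappa> + ennreal (2 * C)" by simp
        finally show ?thesis using True J by simp
      qed
    qed simp
  qed
  also have "\<dots> = ennreal \<kappa> * ennreal T + ennreal (2 * C) * emeasure lborel J"
    using J(1) T_pos by (simp add: nn_integral_add nn_integral_cmult)
  also have "\<dots> \<le> ennreal \<kappa> * ennreal T + ennreal (2 * C) * ennreal j"
    using J(2) by (intro add_left_mono mult_left_mono) auto
  also have "\<dots> = ennreal (\<kappa> * T + 2 * C * j)"
    using \<kappa> T_pos C j by (simp add: ennreal_mult[symmetric] ennreal_plus[symmetric] del: ennreal_plus)
  finally show ?thesis
    by (rule ennreal_le_iff[THEN iffD1, rotated]) (use \<kappa> T_pos C j in auto)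
qed

lemma bounded_progressive_zero: "0 \<le> C \<Longrightarrow> bounded_progressive C (\<lambda>_ _. 0)"
  by (simp add: bounded_progressive_def prog_measurable_def split_beta')

lemma payoff_bound:
  assumes U: "bounded_progressive C U" and \<omega>: "\<omega> \<in> path_space T" and C: "0 \<le> C" and \<Xi>: "\<bar>\<Xi> \<omega>\<bar> \<le> C"
  shows "\<bar>payoff \<Xi> U \<omega>\<bar> \<le> C * (1 + T)"
proof -
  \<comment> \<open>The bound on the running cost is its distance to the cost of the zero
    process.\<close>
  have "\<bar>(LBINT s:{0..T}. U s \<omega>) - (LBINT s:{0..T}. 0)\<bar> \<le> C * T + 2 * C * 0"
  proof (rule running_diff_le[OF U bounded_progressive_zero[OF C] \<omega> C C _ _, of 0 "{}"])
    show "\<bar>U s \<omega> - 0\<bar> \<le> C" if "s \<in> {0..T} - {}" for s using U \<omega> that by (simp add: bounded_progressive_def)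
  qed auto
  then have "\<bar>LBINT s:{0..T}. U s \<omega>\<bar> \<le> C * T" by (simp add: set_lebesgue_integral_def)
  then show ?thesis using \<Xi> unfolding payoff_def by (simp add: algebra_simps)
qed

lemma payoff_measurable:
  assumes U: "bounded_progressive C U" and \<Xi>: "\<Xi> \<in> borel_measurable Q"
  shows "payoff \<Xi> U \<in> borel_measurable Q"
proof -
  have "(\<lambda>\<omega>. LBINT s:{0..T}. U s \<omega>) \<in> borel_measurable Q"
    unfolding set_lebesgue_integral_def
    using bounded_progressive_jm[OF U] unfolding jointly_measurable_def
    by (rule lborel.borel_measurable_lebesgue_integral)
  then show ?thesis using \<Xi> unfolding payoff_def by (rule borel_measurable_add[rotated])
qed

lemma bounded_progressive_mono: "bounded_progressive C X \<Longrightarrow> C \<le> C' \<Longrightarrow> bounded_progressive C' X"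
  unfolding bounded_progressive_def by (meson order_trans)

text \<open>Closeness is asked for only on the event \<open>H\<close> and at times outside
  \<open>J\<close>. One \<kappa> measures the closeness, the probability of leaving \<open>H\<close>
  and the length of \<open>J\<close>; boundedness turns all three into small second moments.\<close>

lemma payoff_cost_stability:
  fixes C e :: real
  assumes C: "0 \<le> C" and e: "0 < e"
  obtains \<kappa> where "0 < \<kappa>"
    "\<And>X X' U U' \<Xi> \<Xi>' H J. bounded_progressive C X \<Longrightarrow> bounded_progressive C X' \<Longrightarrow>
      bounded_progressive C U \<Longrightarrow> bounded_progressive C U' \<Longrightarrow>
      \<Xi> \<in> borel_measurable Q \<Longrightarrow> \<Xi>' \<in> borel_measurable Q \<Longrightarrow>
      (\<And>\<omega>. \<omega> \<in> path_space T \<Longrightarrow> \<bar>\<Xi> \<omega>\<bar> \<le> C) \<Longrightarrow> (\<And>\<omega>. \<omega> \<in> path_space T \<Longrightarrow> \<bar>\<Xi>' \<omega>\<bar> \<le> C) \<Longrightarrow>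
      H \<in> sets Q \<Longrightarrow> emeasure Q (space Q - H) \<le> ennreal \<kappa> \<Longrightarrow> J \<in> sets borel \<Longrightarrow> emeasure lborel J \<le> ennreal \<kappa> \<Longrightarrow>
      (\<And>s \<omega>. \<omega> \<in> H \<Longrightarrow> s \<in> {0..T} - J \<Longrightarrow> norm (X s \<omega> - X' s \<omega>) \<le> \<kappa> \<and> \<bar>U s \<omega> - U' s \<omega>\<bar> \<le> \<kappa>) \<Longrightarrow>
      (\<And>\<omega>. \<omega> \<in> H \<Longrightarrow> \<bar>\<Xi> \<omega> - \<Xi>' \<omega>\<bar> \<le> \<kappa>) \<Longrightarrow>
      \<bar>drift_cost X (payoff \<Xi> U) - drift_cost X' (payoff \<Xi>' U')\<bar> \<le> e"
proof -
  \<comment> \<open>Bounds the payoffs and dominates \<open>C\<close>, because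
    \<open>drift_cost_stability\<close> takes one bound for drifts and payoffs together.\<close>
  define C1 where "C1 = C * (1 + T)"
  have C1: "0 \<le> C1" "C \<le> C1" using C T_pos by (auto simp: C1_def algebra_simps)
  obtain \<delta> where \<delta>: "0 < \<delta>"
    and stab: "\<And>X X' \<Phi> \<Phi>'. bounded_progressive C1 X \<Longrightarrow> bounded_progressive C1 X' \<Longrightarrow>
      \<Phi> \<in> borel_measurable Q \<Longrightarrow> \<Phi>' \<in> borel_measurable Q \<Longrightarrow>
      (\<And>\<omega>. \<omega> \<in> path_space T \<Longrightarrow> \<bar>\<Phi> \<omega>\<bar> \<le> C1) \<Longrightarrow> (\<And>\<omega>. \<omega> \<in> path_space T \<Longrightarrow> \<bar>\<Phi>' \<omega>\<bar> \<le> C1) \<Longrightarrow>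
      sqnorm (\<lambda>s \<omega>. X s \<omega> - X' s \<omega>) \<le> ennreal \<delta> \<Longrightarrow>
      (\<integral>\<^sup>+\<omega>. ennreal ((\<Phi> \<omega> - \<Phi>' \<omega>)\<^sup>2) \<partial>Q) \<le> ennreal \<delta> \<Longrightarrow>
      \<bar>drift_cost X \<Phi> - drift_cost X' \<Phi>'\<bar> \<le> e"
    using drift_cost_stability[OF C1(1) e] by blast
  \<comment> \<open>The summands are the contributions of good times on \<open>H\<close>, of the
    times in \<open>J\<close>, and of the paths outside \<open>H\<close>. In \<open>K2\<close>
    likewise the first square belongs to \<open>H\<close> and the second to its complement. Keeping
    \<kappa> at most 1 allows \<open>\<kappa>\<^sup>2 \<le> \<kappa>\<close>, so all contributions
    are linear in \<kappa>.\<close>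
  define K1 where "K1 = T + 4 * C\<^sup>2 + 4 * C\<^sup>2 * T"
  define K2 where "K2 = (1 + T + 2 * C)\<^sup>2 + (2 * C1)\<^sup>2"
  have K: "0 \<le> K1" "0 \<le> K2" unfolding K1_def K2_def using T_pos by (auto intro!: add_nonneg_nonneg mult_nonneg_nonneg)
  define \<kappa> where "\<kappa> = min 1 (\<delta> / (1 + K1 + K2))"
  have \<kappa>: "0 < \<kappa>" "\<kappa> \<le> 1" using \<delta> K by (auto simp: \<kappa>_def)
  have "\<kappa> \<le> \<delta> / (1 + K1 + K2)" by (simp add: \<kappa>_def)
  then have "\<kappa> * (1 + K1 + K2) \<le> \<delta>" using K by (subst (asm) pos_le_divide_eq) auto
  moreover have "\<kappa> * K1 \<le> \<kappa> * (1 + K1 + K2)" "\<kappa> * K2 \<le> \<kappa> * (1 + K1 + K2)"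
    using \<kappa> K by (auto intro!: mult_left_mono)
  ultimately have \<kappa>K: "\<kappa> * K1 \<le> \<delta>" "\<kappa> * K2 \<le> \<delta>" by linarith+
  have \<kappa>2: "\<kappa>\<^sup>2 \<le> \<kappa>" using \<kappa> by (simp add: power2_eq_square mult_left_le)
  show ?thesis
  proof (rule that[OF \<kappa>(1)])
    fix X X' :: "real \<Rightarrow> 'd path \<Rightarrow> real ^ 'd" and U U' \<Xi> \<Xi>' H and J :: "real set"
    assume X: "bounded_progressive C X" "bounded_progressive C X'"
      and U: "bounded_progressive C U" "bounded_progressive C U'"
      and \<Xi>m: "\<Xi> \<in> borel_measurable Q" "\<Xi>' \<in> borel_measurable Q"
      and \<Xi>: "\<And>\<omega>. \<omega> \<in> path_space T \<Longrightarrow> \<bar>\<Xi> \<omega>\<bar> \<le> C" "\<And>\<omega>. \<omega> \<in> path_space T \<Longrightarrow> \<bar>\<Xi>' \<omega>\<bar> \<le> C"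
      and H: "H \<in> sets Q" "emeasure Q (space Q - H) \<le> ennreal \<kappa>"
      and J: "J \<in> sets borel" "emeasure lborel J \<le> ennreal \<kappa>"
      and close: "\<And>s \<omega>. \<omega> \<in> H \<Longrightarrow> s \<in> {0..T} - J \<Longrightarrow> norm (X s \<omega> - X' s \<omega>) \<le> \<kappa> \<and> \<bar>U s \<omega> - U' s \<omega>\<bar> \<le> \<kappa>"
      and close\<Xi>: "\<And>\<omega>. \<omega> \<in> H \<Longrightarrow> \<bar>\<Xi> \<omega> - \<Xi>' \<omega>\<bar> \<le> \<kappa>"
    have compl: "path_space T - H \<in> sets Q" using sets.compl_sets[OF H(1)] by simp
    have off_H: "(\<integral>\<^sup>+\<omega>. ennreal p + ennreal q * indicator (space Q - H) \<omega> \<partial>Q) \<le> ennreal (p + q * \<kappa>)"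
      if "0 \<le> p" "0 \<le> q" for p q
    proof -
      have "(\<integral>\<^sup>+\<omega>. ennreal p + ennreal q * indicator (space Q - H) \<omega> \<partial>Q) = ennreal p + ennreal q * emeasure Q (space Q - H)"
        using compl Q.emeasure_space_1 by (simp add: nn_integral_add nn_integral_cmult)
      also have "\<dots> \<le> ennreal p + ennreal q * ennreal \<kappa>" using H(2) by (intro add_left_mono mult_left_mono) auto
      also have "\<dots> = ennreal (p + q * \<kappa>)" using that \<kappa> by (simp add: ennreal_mult)
      finally show ?thesis .
    qed
    have dX: "sqnorm (\<lambda>s \<omega>. X s \<omega> - X' s \<omega>) \<le> ennreal \<delta>"
    proof -
      have "sqnorm (\<lambda>s \<omega>. X s \<omega> - X' s \<omega>) \<le> (\<integral>\<^sup>+\<omega>. ennreal (\<kappa> * T + 4 * C\<^sup>2 * \<kappa>) + ennreal (4 * C\<^sup>2 * T) * indicator (space Q - H) \<omega> \<partial>Q)"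
        unfolding sqnorm_def
      proof (rule nn_integral_mono)
        fix \<omega> assume "\<omega> \<in> space Q"
        then have \<omega>: "\<omega> \<in> path_space T" by simp
        have 2: "(norm (X s \<omega> - X' s \<omega>))\<^sup>2 \<le> 4 * C\<^sup>2" if "s \<in> {0..T}" for s
        proof -
          have "norm (X s \<omega>) \<le> C" "norm (X' s \<omega>) \<le> C" using X \<omega> that by (auto simp: bounded_progressive_def)
          then have "norm (X s \<omega> - X' s \<omega>) \<le> 2 * C" using norm_triangle_ineq4[of "X s \<omega>" "X' s \<omega>"] by simp
          then have "(norm (X s \<omega> - X' s \<omega>))\<^sup>2 \<le> (2 * C)\<^sup>2" by (rule power_mono) simp
          then show ?thesis by simp
        qed
        show "(\<integral>\<^sup>+s\<in>{0..T}. ennreal ((norm (X s \<omega> - X' s \<omega>))\<^sup>2) \<partial>lborel)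
          \<le> ennreal (\<kappa> * T + 4 * C\<^sup>2 * \<kappa>) + ennreal (4 * C\<^sup>2 * T) * indicator (space Q - H) \<omega>"
        proof (cases "\<omega> \<in> H")
          case True
          have "(\<integral>\<^sup>+s\<in>{0..T}. ennreal ((norm (X s \<omega> - X' s \<omega>))\<^sup>2) \<partial>lborel)
            \<le> (\<integral>\<^sup>+s. ennreal \<kappa> * indicator {0..T} s + ennreal (4 * C\<^sup>2) * indicator J s \<partial>lborel)"
          proof (rule nn_integral_mono)
            fix s
            consider "s \<notin> {0..T}" | "s \<in> {0..T} - J" | "s \<in> {0..T}" "s \<in> J" by blast
            then show "ennreal ((norm (X s \<omega> - X' s \<omega>))\<^sup>2) * indicator {0..T} s \<le> ennreal \<kappa> * indicator {0..T} s + ennreal (4 * C\<^sup>2) * indicator J s"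
            proof cases
              case 2
              then have "(norm (X s \<omega> - X' s \<omega>))\<^sup>2 \<le> \<kappa>\<^sup>2" using close[OF True] by (intro power_mono) auto
              then have "(norm (X s \<omega> - X' s \<omega>))\<^sup>2 \<le> \<kappa>" using \<kappa>2 by simp
              then show ?thesis using 2 by (simp add: ennreal_leI)
            next
              case 3
              have "ennreal ((norm (X s \<omega> - X' s \<omega>))\<^sup>2) \<le> ennreal (4 * C\<^sup>2)" using 2[OF 3(1)] by (rule ennreal_leI)
              also have "\<dots> \<le> ennreal \<kappa> + ennreal (4 * C\<^sup>2)" by simp
              finally show ?thesis using 3 by simp
            qed simp
          qed
          also have "\<dots> = ennreal \<kappa> * ennreal T + ennreal (4 * C\<^sup>2) * emeasure lborel J"
            using J(1) T_pos by (simp add: nn_integral_add nn_integral_cmult)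
          also have "\<dots> \<le> ennreal \<kappa> * ennreal T + ennreal (4 * C\<^sup>2) * ennreal \<kappa>"
            using J(2) by (intro add_left_mono mult_left_mono) auto
          also have "\<dots> = ennreal (\<kappa> * T + 4 * C\<^sup>2 * \<kappa>)"
            using \<kappa> T_pos by (simp add: ennreal_mult[symmetric] ennreal_plus[symmetric] del: ennreal_plus)
          finally show ?thesis using True by simp
        next
          case False
          have "(\<integral>\<^sup>+s\<in>{0..T}. ennreal ((norm (X s \<omega> - X' s \<omega>))\<^sup>2) \<partial>lborel) \<le> (\<integral>\<^sup>+s. ennreal (4 * C\<^sup>2) * indicator {0..T} s \<partial>lborel)"
            using 2 by (intro nn_integral_mono) (simp add: indicator_def ennreal_leI)
          also have "\<dots> = ennreal (4 * C\<^sup>2 * T)" using T_pos by (simp add: nn_integral_cmult ennreal_mult)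
          also have "\<dots> \<le> ennreal (\<kappa> * T + 4 * C\<^sup>2 * \<kappa>) + ennreal (4 * C\<^sup>2 * T)" by simp
          finally show ?thesis using False \<omega> by simp
        qed
      qed
      also have "\<dots> \<le> ennreal (\<kappa> * T + 4 * C\<^sup>2 * \<kappa> + 4 * C\<^sup>2 * T * \<kappa>)"
        using \<kappa> T_pos by (intro off_H) auto
      also have "\<dots> \<le> ennreal \<delta>" using \<kappa>K(1) by (intro ennreal_leI) (simp add: K1_def algebra_simps)
      finally show ?thesis .
    qed
    have \<Phi>b: "\<bar>payoff \<Xi> U \<omega>\<bar> \<le> C1" "\<bar>payoff \<Xi>' U' \<omega>\<bar> \<le> C1" if "\<omega> \<in> path_space T" for \<omega>
      unfolding C1_def by (rule payoff_bound[where \<Xi>=\<Xi>, OF U(1) that C \<Xi>(1)[OF that]] payoff_bound[where \<Xi>=\<Xi>', OF U(2) that C \<Xi>(2)[OF that]])+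
    have d\<Phi>: "(\<integral>\<^sup>+\<omega>. ennreal ((payoff \<Xi> U \<omega> - payoff \<Xi>' U' \<omega>)\<^sup>2) \<partial>Q) \<le> ennreal \<delta>"
    proof -
      have "(\<integral>\<^sup>+\<omega>. ennreal ((payoff \<Xi> U \<omega> - payoff \<Xi>' U' \<omega>)\<^sup>2) \<partial>Q)
        \<le> (\<integral>\<^sup>+\<omega>. ennreal (\<kappa> * (1 + T + 2 * C)\<^sup>2) + ennreal ((2 * C1)\<^sup>2) * indicator (space Q - H) \<omega> \<partial>Q)"
      proof (rule nn_integral_mono)
        fix \<omega> assume "\<omega> \<in> space Q"
        then have \<omega>: "\<omega> \<in> path_space T" by simp
        show "ennreal ((payoff \<Xi> U \<omega> - payoff \<Xi>' U' \<omega>)\<^sup>2) \<le> ennreal (\<kappa> * (1 + T + 2 * C)\<^sup>2) + ennreal ((2 * C1)\<^sup>2) * indicator (space Q - H) \<omega>"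
        proof (cases "\<omega> \<in> H")
          case True
          have "\<bar>(LBINT s:{0..T}. U s \<omega>) - (LBINT s:{0..T}. U' s \<omega>)\<bar> \<le> \<kappa> * T + 2 * C * \<kappa>"
            using \<kappa> close[OF True] by (intro running_diff_le[OF U \<omega> C _ _ J]) auto
          then have "\<bar>payoff \<Xi> U \<omega> - payoff \<Xi>' U' \<omega>\<bar> \<le> \<kappa> * (1 + T + 2 * C)"
            using close\<Xi>[OF True] unfolding payoff_def by (simp add: algebra_simps)
          then have "\<bar>payoff \<Xi> U \<omega> - payoff \<Xi>' U' \<omega>\<bar>\<^sup>2 \<le> (\<kappa> * (1 + T + 2 * C))\<^sup>2" by (rule power_mono) simp
          also have "\<dots> = \<kappa>\<^sup>2 * (1 + T + 2 * C)\<^sup>2" by (rule power_mult_distrib)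
          also have "\<dots> \<le> \<kappa> * (1 + T + 2 * C)\<^sup>2" using \<kappa>2 by (intro mult_right_mono) auto
          finally show ?thesis using True by (simp add: ennreal_leI)
        next
          case False
          have "\<bar>payoff \<Xi> U \<omega> - payoff \<Xi>' U' \<omega>\<bar> \<le> 2 * C1" using \<Phi>b[OF \<omega>] by (simp add: abs_le_iff)
          then have "\<bar>payoff \<Xi> U \<omega> - payoff \<Xi>' U' \<omega>\<bar>\<^sup>2 \<le> (2 * C1)\<^sup>2" by (rule power_mono) simp
          then have "ennreal ((payoff \<Xi> U \<omega> - payoff \<Xi>' U' \<omega>)\<^sup>2) \<le> ennreal ((2 * C1)\<^sup>2)" by (intro ennreal_leI) simp
          also have "\<dots> \<le> ennreal (\<kappa> * (1 + T + 2 * C)\<^sup>2) + ennreal ((2 * C1)\<^sup>2)" by simp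
          finally show ?thesis using False \<omega> by simp
        qed
      qed
      also have "\<dots> \<le> ennreal (\<kappa> * (1 + T + 2 * C)\<^sup>2 + (2 * C1)\<^sup>2 * \<kappa>)"
        using \<kappa> by (intro off_H) auto
      also have "\<dots> \<le> ennreal \<delta>" using \<kappa>K(2) by (intro ennreal_leI) (simp add: K2_def distrib_left mult.commute)
      finally show ?thesis .
    qed
    show "\<bar>drift_cost X (payoff \<Xi> U) - drift_cost X' (payoff \<Xi>' U')\<bar> \<le> e"
      using \<Phi>b by (intro stab bounded_progressive_mono[OF _ C1(2)] X payoff_measurable[OF U(1) \<Xi>m(1)] payoff_measurable[OF U(2) \<Xi>m(2)] dX d\<Phi>) auto
  qed
qed

text \<open>Every path is uniformly continuous, so these events increase to the whole path space as
  \<open>n\<close> grows, and continuity from above applies to their complements.\<close>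

lemma tight_paths_probability:
  assumes c: "0 < c" and \<kappa>: "0 < \<kappa>"
  obtains n where "{\<omega> \<in> path_space T. tight_path T (1 / real (Suc n)) c \<omega>} \<in> sets Q"
    "emeasure Q (space Q - {\<omega> \<in> path_space T. tight_path T (1 / real (Suc n)) c \<omega>}) \<le> ennreal \<kappa>"
proof -
  define H where "H = (\<lambda>n. {\<omega> \<in> (path_space T :: 'd path set). tight_path T (1 / real (Suc n)) c \<omega>})"
  have H: "H n \<in> sets Q" for n
  proof -
    have "H n \<in> sets (raw_filtration T T)"
      using tight_path_measurable[where T=T and r=T and \<delta>="1 / real (Suc n)" and c=c] unfolding H_def pred_def by simp
    then show ?thesis using sets_P by auto
  qed
  have "(\<lambda>n. emeasure Q (space Q - H n)) \<longlonglongrightarrow> emeasure Q (\<Inter>n. space Q - H n)"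
  proof (rule Lim_emeasure_decseq)
    show "range (\<lambda>n. space Q - H n) \<subseteq> sets Q" using H by blast
    show "decseq (\<lambda>n. space Q - H n)"
    proof (rule decseq_SucI)
      fix n
      have "1 / real (Suc (Suc n)) \<le> 1 / real (Suc n)" by (intro divide_left_mono) auto
      then have "H n \<subseteq> H (Suc n)" unfolding H_def using tight_path_antimono by blast
      then show "space Q - H (Suc n) \<subseteq> space Q - H n" by blast
    qed
  qed simp
  moreover have eq: "(\<Inter>n. space Q - H n) = {}"
    unfolding H_def using tight_path_exists[OF path_spaceD(1) c] by auto
  ultimately have "(\<lambda>n. emeasure Q (space Q - H n)) \<longlonglongrightarrow> 0"
    by (simp only: eq emeasure_empty)
  then have "\<forall>\<^sub>F n in sequentially. emeasure Q (space Q - H n) < ennreal \<kappa>"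
    using \<kappa> by (intro order_tendstoD) auto
  then obtain n where "emeasure Q (space Q - H n) < ennreal \<kappa>" by (auto simp: eventually_sequentially)
  then show ?thesis using that[of n] H[of n] by (simp add: H_def less_imp_le)
qed

text \<open>On tight paths the two shifted games see states at a distance within
  \<open>\<delta>\<^sub>0\<close>, whatever the control does. The paths that are not tight and the
  strip between the horizons are the exceptional sets of
  \<open>payoff_cost_stability\<close>.\<close>

lemma game_cost_continuous:
  assumes g: "regular_game C A b f \<xi> \<rho>" and e: "0 < e"
  obtains \<delta> where "0 < \<delta>"
    "\<And>t t' \<omega> \<omega>' \<alpha> i. t \<in> {0..T} \<Longrightarrow> t' \<in> {0..T} \<Longrightarrow> \<omega> \<in> path_space T \<Longrightarrow> \<omega>' \<in> path_space T \<Longrightarrow>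
      path_dist T t \<omega> t' \<omega>' \<le> \<delta> \<Longrightarrow> \<alpha> \<in> controls T P A \<Longrightarrow>
      \<bar>game_cost T P b f \<xi> t \<omega> \<alpha> $ i - game_cost T P b f \<xi> t' \<omega>' \<alpha> $ i\<bar> \<le> e"
proof -
  have C: "0 \<le> C" by (rule regular_game_nonneg[OF g])
  obtain \<kappa> where \<kappa>: "0 < \<kappa>" and stab: "\<And>X X' U U' \<Xi> \<Xi>' H J. bounded_progressive C X \<Longrightarrow> bounded_progressive C X' \<Longrightarrow>
      bounded_progressive C U \<Longrightarrow> bounded_progressive C U' \<Longrightarrow>
      \<Xi> \<in> borel_measurable Q \<Longrightarrow> \<Xi>' \<in> borel_measurable Q \<Longrightarrow>
      (\<And>\<omega>. \<omega> \<in> path_space T \<Longrightarrow> \<bar>\<Xi> \<omega>\<bar> \<le> C) \<Longrightarrow> (\<And>\<omega>. \<omega> \<in> path_space T \<Longrightarrow> \<bar>\<Xi>' \<omega>\<bar> \<le> C) \<Longrightarrow>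
      H \<in> sets Q \<Longrightarrow> emeasure Q (space Q - H) \<le> ennreal \<kappa> \<Longrightarrow> J \<in> sets borel \<Longrightarrow> emeasure lborel J \<le> ennreal \<kappa> \<Longrightarrow>
      (\<And>s \<omega>. \<omega> \<in> H \<Longrightarrow> s \<in> {0..T} - J \<Longrightarrow> norm (X s \<omega> - X' s \<omega>) \<le> \<kappa> \<and> \<bar>U s \<omega> - U' s \<omega>\<bar> \<le> \<kappa>) \<Longrightarrow>
      (\<And>\<omega>. \<omega> \<in> H \<Longrightarrow> \<bar>\<Xi> \<omega> - \<Xi>' \<omega>\<bar> \<le> \<kappa>) \<Longrightarrow>
      \<bar>drift_cost X (payoff \<Xi> U) - drift_cost X' (payoff \<Xi>' U')\<bar> \<le> e"
    using payoff_cost_stability[OF C e] by blast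
  obtain \<delta>\<^sub>0 where \<delta>\<^sub>0: "0 < \<delta>\<^sub>0" "\<And>x. 0 \<le> x \<Longrightarrow> x \<le> \<delta>\<^sub>0 \<Longrightarrow> \<rho> x \<le> \<kappa>"
    using modulus_small[OF regular_gameD(2)[OF g] \<kappa>] by blast
  obtain n where n: "{\<omega> \<in> path_space T. tight_path T (1 / real (Suc n)) (\<delta>\<^sub>0 / 2) \<omega>} \<in> sets Q"
    "emeasure Q (space Q - {\<omega> \<in> path_space T. tight_path T (1 / real (Suc n)) (\<delta>\<^sub>0 / 2) \<omega>}) \<le> ennreal \<kappa>"
    using tight_paths_probability[of "\<delta>\<^sub>0 / 2" \<kappa>] \<delta>\<^sub>0(1) \<kappa> by auto
  define H where "H = {\<omega> \<in> (path_space T :: 'd path set). tight_path T (1 / real (Suc n)) (\<delta>\<^sub>0 / 2) \<omega>}"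
  \<comment> \<open>The bound 1 gives \<open>\<bar>t - t'\<bar> \<le> \<delta>\<close>; \<kappa>
    bounds the strip between the horizons; \<open>\<delta>\<^sub>0 / 4\<close> pays for twice the
    distance of the base points, leaving \<open>\<delta>\<^sub>0 / 2\<close> for the oscillation;
    the last term keeps the lag \<open>2 * \<delta>\<close> below
    \<open>1 / (n + 1)\<close>.\<close>
  define \<delta> where "\<delta> = min (min 1 \<kappa>) (min (\<delta>\<^sub>0 / 4) (1 / (4 * real (Suc n))))"
  have \<delta>: "0 < \<delta>" "\<delta> \<le> 1" "\<delta> \<le> \<kappa>" "\<delta> \<le> \<delta>\<^sub>0 / 4" "\<delta> \<le> 1 / (4 * real (Suc n))"
    using \<kappa> \<delta>\<^sub>0(1) by (auto simp: \<delta>_def)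
  have n\<delta>: "2 * \<delta> < 1 / real (Suc n)"
  proof -
    have "2 * \<delta> \<le> 1 / (2 * real (Suc n))" using \<delta>(5) by (simp add: field_simps)
    also have "\<dots> < 1 / real (Suc n)" by (intro divide_strict_left_mono) auto
    finally show ?thesis .
  qed
  show ?thesis
  proof (rule that[OF \<delta>(1)])
    fix t t' i and \<omega> \<omega>' :: "'d path" and \<alpha>
    assume t: "t \<in> {0..T}" "t' \<in> {0..T}" and \<omega>: "\<omega> \<in> path_space T" "\<omega>' \<in> path_space T"
      and d: "path_dist T t \<omega> t' \<omega>' \<le> \<delta>" and \<alpha>: "\<alpha> \<in> controls T P A"
    let ?pn = "path_norm T (\<lambda>v. \<omega> (min t v) - \<omega>' (min t' v))"
    have pn: "0 \<le> ?pn" using T_pos by (intro path_norm_nonneg continuous_stopped_diff \<omega> t) simp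
    have dd: "sqrt \<bar>t - t'\<bar> + ?pn \<le> \<delta>" using d by (simp add: path_dist_def)
    have "(sqrt \<bar>t - t'\<bar>)\<^sup>2 \<le> \<delta>\<^sup>2" using dd pn by (intro power_mono) auto
    then have "\<bar>t - t'\<bar> \<le> \<delta> * \<delta>" by (simp add: power2_eq_square)
    also have "\<dots> \<le> \<delta> * 1" using \<delta> by (intro mult_left_mono) auto
    finally have tt: "\<bar>t - t'\<bar> \<le> \<delta>" by simp
    \<comment> \<open>Two elapsed times are allowed so that one estimate covers both data: running
      data use \<open>s = s'\<close>, the terminal payoff uses \<open>s = T - t\<close> and
      \<open>s' = T - t'\<close>.\<close>
    have dist_small: "path_dist T (t + s) (concat_path T t \<omega> \<eta>) (t' + s') (concat_path T t' \<omega>' \<eta>) \<le> \<delta>\<^sub>0"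
      if \<eta>: "\<eta> \<in> H" and s: "0 \<le> s" "t + s \<le> T" "0 \<le> s'" "t' + s' \<le> T" "\<bar>s - s'\<bar> \<le> \<bar>t - t'\<bar>" for s s' and \<eta> :: "'d path"
    proof -
      have \<eta>P: "\<eta> \<in> path_space T" and tight: "tight_path T (1 / real (Suc n)) (\<delta>\<^sub>0 / 2) \<eta>" using \<eta> by (auto simp: H_def)
      have "path_dist T (t + s) (concat_path T t \<omega> \<eta>) (t' + s') (concat_path T t' \<omega>' \<eta>) \<le>
         sqrt (\<bar>t - t'\<bar> + \<bar>s - s'\<bar>) + ?pn + 0 + \<delta>\<^sub>0 / 2"
      proof (rule path_dist_concat_le[where r=T])
        show "norm (\<eta> v - \<eta> v') \<le> \<delta>\<^sub>0 / 2" if "v \<in> {0..T}" "v' \<in> {0..T}" "\<bar>v - v'\<bar> \<le> \<bar>t - t'\<bar> + \<bar>s - s'\<bar>" for v v'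
          using that tt n\<delta> s(5) \<delta>\<^sub>0(1) by (intro tight_pathD[OF tight path_spaceD(1)[OF \<eta>P]]) auto
      qed (use s t \<omega> \<eta>P in auto)
      also have "sqrt (\<bar>t - t'\<bar> + \<bar>s - s'\<bar>) \<le> 2 * sqrt \<bar>t - t'\<bar>"
      proof (rule real_le_lsqrt)
        have "1 * \<bar>t - t'\<bar> \<le> 3 * \<bar>t - t'\<bar>" by (intro mult_right_mono) auto
        then have "\<bar>s - s'\<bar> \<le> 3 * \<bar>t - t'\<bar>" unfolding mult_1 by (rule order_trans[OF s(5)])
        then show "\<bar>t - t'\<bar> + \<bar>s - s'\<bar> \<le> (2 * sqrt \<bar>t - t'\<bar>)\<^sup>2" by (simp add: power_mult_distrib)
      qed simp
      finally show ?thesis using dd pn \<delta>(4) by simp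
    qed
    \<comment> \<open>Between the two horizons one drift and running cost are switched off and the
      other are not.\<close>
    define J where "J = {T - max t t'<..T - min t t'}"
    have J: "J \<in> sets borel" "emeasure lborel J \<le> ennreal \<kappa>"
    proof -
      have "emeasure lborel J = ennreal \<bar>t - t'\<bar>"
        unfolding J_def by (subst emeasure_lborel_Ioc) (auto simp: max_def min_def)
      also have "\<dots> \<le> ennreal \<kappa>" using tt \<delta>(3) by (intro ennreal_leI) simp
      finally show "emeasure lborel J \<le> ennreal \<kappa>" .
    qed (simp add: J_def)
    have HP: "\<eta> \<in> path_space T" if "\<eta> \<in> H" for \<eta> using that by (simp add: H_def)
    have \<xi>b: "\<bar>\<xi> (concat_path T t \<omega> \<eta>) $ i\<bar> \<le> C" if "t \<in> {0..T}" "\<omega> \<in> path_space T" "\<eta> \<in> path_space T" for t and \<omega> \<eta> :: "'d path"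
      using regular_gameD(8)[OF g concat_path_in_path_space[OF that(2,3,1)]] component_le_norm_cart[of "\<xi> (concat_path T t \<omega> \<eta>)" i] by simp
    show "\<bar>game_cost T P b f \<xi> t \<omega> \<alpha> $ i - game_cost T P b f \<xi> t' \<omega>' \<alpha> $ i\<bar> \<le> e"
      unfolding game_cost_eq[OF t(1)] game_cost_eq[OF t(2)]
    proof (rule stab[OF shifted_drift_bounded_progressive[OF g t(1) \<omega>(1) \<alpha>] shifted_drift_bounded_progressive[OF g t(2) \<omega>(2) \<alpha>]
          shifted_cost_bounded_progressive[OF g t(1) \<omega>(1) \<alpha>] shifted_cost_bounded_progressive[OF g t(2) \<omega>(2) \<alpha>]
          shifted_terminal_measurable[OF g t(1) \<omega>(1)] shifted_terminal_measurable[OF g t(2) \<omega>(2)]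
          \<xi>b[OF t(1) \<omega>(1)] \<xi>b[OF t(2) \<omega>(2)] n[folded H_def] J])
      fix s \<eta> assume \<eta>: "\<eta> \<in> H" and s: "s \<in> {0..T} - J"
      note c = concat_path_in_path_space[OF \<omega>(1) HP[OF \<eta>] t(1)] concat_path_in_path_space[OF \<omega>(2) HP[OF \<eta>] t(2)]
      consider "s \<in> {0..T - t}" "s \<in> {0..T - t'}" | "s \<notin> {0..T - t}" "s \<notin> {0..T - t'}"
        using s t unfolding J_def by fastforce
      then show "norm (shifted_drift T b t \<omega> \<alpha> s \<eta> - shifted_drift T b t' \<omega>' \<alpha> s \<eta>) \<le> \<kappa> \<and>
          \<bar>shifted_cost f t \<omega> \<alpha> i s \<eta> - shifted_cost f t' \<omega>' \<alpha> i s \<eta>\<bar> \<le> \<kappa>"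
      proof cases
        case 1
        then have ts: "t + s \<in> {0..T}" "t' + s \<in> {0..T}" using t by auto
        have a: "\<alpha> s \<eta> \<in> action_set A" using s by (intro controls_value[OF \<alpha> _ HP[OF \<eta>]]) auto
        have "path_dist T (t + s) (concat_path T t \<omega> \<eta>) (t' + s) (concat_path T t' \<omega>' \<eta>) \<le> \<delta>\<^sub>0"
          using 1 by (intro dist_small[OF \<eta>]) auto
        then have \<rho>: "\<rho> (path_dist T (t + s) (concat_path T t \<omega> \<eta>) (t' + s) (concat_path T t' \<omega>' \<eta>)) \<le> \<kappa>"
          by (intro \<delta>\<^sub>0(2) path_dist_nonneg c ts)
        have "\<bar>(f (t + s) (concat_path T t \<omega> \<eta>) (\<alpha> s \<eta>) - f (t' + s) (concat_path T t' \<omega>' \<eta>) (\<alpha> s \<eta>)) $ i\<bar> \<le> \<kappa>"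
          by (rule order_trans[OF component_le_norm_cart order_trans[OF regular_gameD(4)[OF g ts c a] \<rho>]])
        moreover have "norm (b (t + s) (concat_path T t \<omega> \<eta>) (\<alpha> s \<eta>) - b (t' + s) (concat_path T t' \<omega>' \<eta>) (\<alpha> s \<eta>)) \<le> \<kappa>"
          by (rule order_trans[OF regular_gameD(3)[OF g ts c a] \<rho>])
        ultimately show ?thesis using 1 by (simp add: shifted_drift_def shifted_cost_def)
      next
        case 2
        then show ?thesis using \<kappa> by (simp add: shifted_drift_def shifted_cost_def)
      qed
    next
      fix \<eta> assume \<eta>: "\<eta> \<in> H"
      note c = concat_path_in_path_space[OF \<omega>(1) HP[OF \<eta>] t(1)] concat_path_in_path_space[OF \<omega>(2) HP[OF \<eta>] t(2)]
      have "path_dist T (t + (T - t)) (concat_path T t \<omega> \<eta>) (t' + (T - t')) (concat_path T t' \<omega>' \<eta>) \<le> \<delta>\<^sub>0"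
        using t by (intro dist_small[OF \<eta>]) auto
      then have "path_dist T T (concat_path T t \<omega> \<eta>) T (concat_path T t' \<omega>' \<eta>) \<le> \<delta>\<^sub>0" by simp
      then have "\<rho> (path_dist T T (concat_path T t \<omega> \<eta>) T (concat_path T t' \<omega>' \<eta>)) \<le> \<kappa>"
        using T_pos by (intro \<delta>\<^sub>0(2) path_dist_nonneg c) auto
      from order_trans[OF component_le_norm_cart order_trans[OF regular_gameD(5)[OF g c] this], of i]
      show "\<bar>\<xi> (concat_path T t \<omega> \<eta>) $ i - \<xi> (concat_path T t' \<omega>' \<eta>) $ i\<bar> \<le> \<kappa>" by simp
    qed
  qed
qed

text \<open>Base point and control are the same in both games, so the coefficients are compared at
  one and the same state and action. The exceptional sets are empty; the two moduli may differ,
  while \<open>C\<close> is shared and determines \<kappa> together with \<open>e\<close>.\<close>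

lemma game_cost_data_stability:
  fixes A :: "'n::finite \<Rightarrow> 'a::euclidean_space set"
  assumes C: "0 \<le> C" and e: "0 < e"
  obtains \<kappa> where "0 < \<kappa>"
    "\<And>b f \<xi> \<rho> b' f' \<xi>' \<rho>' t \<omega> \<alpha> i. regular_game C A b f \<xi> \<rho> \<Longrightarrow> regular_game C A b' f' \<xi>' \<rho>' \<Longrightarrow>
      (\<And>s \<omega> a. s \<in> {0..T} \<Longrightarrow> \<omega> \<in> path_space T \<Longrightarrow> a \<in> action_set A \<Longrightarrow>
        norm (b s \<omega> a - b' s \<omega> a) \<le> \<kappa> \<and> norm (f s \<omega> a - f' s \<omega> a) \<le> \<kappa>) \<Longrightarrow>
      (\<And>\<omega>. \<omega> \<in> path_space T \<Longrightarrow> norm (\<xi> \<omega> - \<xi>' \<omega>) \<le> \<kappa>) \<Longrightarrow>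
      t \<in> {0..T} \<Longrightarrow> \<omega> \<in> path_space T \<Longrightarrow> \<alpha> \<in> controls T P A \<Longrightarrow>
      \<bar>game_cost T P b f \<xi> t \<omega> \<alpha> $ i - game_cost T P b' f' \<xi>' t \<omega> \<alpha> $ i\<bar> \<le> e"
proof -
  obtain \<kappa> where \<kappa>: "0 < \<kappa>" and stab: "\<And>X X' U U' \<Xi> \<Xi>' H J. bounded_progressive C X \<Longrightarrow> bounded_progressive C X' \<Longrightarrow>
      bounded_progressive C U \<Longrightarrow> bounded_progressive C U' \<Longrightarrow>
      \<Xi> \<in> borel_measurable Q \<Longrightarrow> \<Xi>' \<in> borel_measurable Q \<Longrightarrow>
      (\<And>\<omega>. \<omega> \<in> path_space T \<Longrightarrow> \<bar>\<Xi> \<omega>\<bar> \<le> C) \<Longrightarrow> (\<And>\<omega>. \<omega> \<in> path_space T \<Longrightarrow> \<bar>\<Xi>' \<omega>\<bar> \<le> C) \<Longrightarrow>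
      H \<in> sets Q \<Longrightarrow> emeasure Q (space Q - H) \<le> ennreal \<kappa> \<Longrightarrow> J \<in> sets borel \<Longrightarrow> emeasure lborel J \<le> ennreal \<kappa> \<Longrightarrow>
      (\<And>s \<omega>. \<omega> \<in> H \<Longrightarrow> s \<in> {0..T} - J \<Longrightarrow> norm (X s \<omega> - X' s \<omega>) \<le> \<kappa> \<and> \<bar>U s \<omega> - U' s \<omega>\<bar> \<le> \<kappa>) \<Longrightarrow>
      (\<And>\<omega>. \<omega> \<in> H \<Longrightarrow> \<bar>\<Xi> \<omega> - \<Xi>' \<omega>\<bar> \<le> \<kappa>) \<Longrightarrow>
      \<bar>drift_cost X (payoff \<Xi> U) - drift_cost X' (payoff \<Xi>' U')\<bar> \<le> e"
    using payoff_cost_stability[OF C e] by blast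
  show ?thesis
  proof (rule that[OF \<kappa>])
    fix b f \<xi> \<rho> b' f' \<xi>' \<rho>' t and \<omega> :: "'d path" and \<alpha> :: "real \<Rightarrow> 'd path \<Rightarrow> 'a ^ 'n" and i
    assume g: "regular_game C A b f \<xi> \<rho>" and g': "regular_game C A b' f' \<xi>' \<rho>'"
      and close: "\<And>s \<omega> a. s \<in> {0..T} \<Longrightarrow> \<omega> \<in> path_space T \<Longrightarrow> a \<in> action_set A \<Longrightarrow>
        norm (b s \<omega> a - b' s \<omega> a) \<le> \<kappa> \<and> norm (f s \<omega> a - f' s \<omega> a) \<le> \<kappa>"
      and close\<xi>: "\<And>\<omega>. \<omega> \<in> path_space T \<Longrightarrow> norm (\<xi> \<omega> - \<xi>' \<omega>) \<le> \<kappa>"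
      and t: "t \<in> {0..T}" and \<omega>: "\<omega> \<in> path_space T" and \<alpha>: "\<alpha> \<in> controls T P A"
    have \<xi>b: "\<bar>\<xi> (concat_path T t \<omega> \<eta>) $ i\<bar> \<le> C" if "regular_game C A b f \<xi> \<rho>" "\<eta> \<in> path_space T" for b f \<xi> \<rho> and \<eta> :: "'d path"
      using regular_gameD(8)[OF that(1) concat_path_in_path_space[OF \<omega> that(2) t]] component_le_norm_cart[of "\<xi> (concat_path T t \<omega> \<eta>)" i] by simp
    show "\<bar>game_cost T P b f \<xi> t \<omega> \<alpha> $ i - game_cost T P b' f' \<xi>' t \<omega> \<alpha> $ i\<bar> \<le> e"
      unfolding game_cost_eq[OF t]
    proof (rule stab[OF shifted_drift_bounded_progressive[OF g t \<omega> \<alpha>] shifted_drift_bounded_progressive[OF g' t \<omega> \<alpha>]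
          shifted_cost_bounded_progressive[OF g t \<omega> \<alpha>] shifted_cost_bounded_progressive[OF g' t \<omega> \<alpha>]
          shifted_terminal_measurable[OF g t \<omega>] shifted_terminal_measurable[OF g' t \<omega>]
          \<xi>b[OF g] \<xi>b[OF g'], of "space Q" "{}"])
      fix s \<eta> assume "\<eta> \<in> space Q" and s: "s \<in> {0..T} - {}"
      then have \<eta>: "\<eta> \<in> path_space T" by simp
      note c = concat_path_in_path_space[OF \<omega> \<eta> t]
      show "norm (shifted_drift T b t \<omega> \<alpha> s \<eta> - shifted_drift T b' t \<omega> \<alpha> s \<eta>) \<le> \<kappa> \<and>
          \<bar>shifted_cost f t \<omega> \<alpha> i s \<eta> - shifted_cost f' t \<omega> \<alpha> i s \<eta>\<bar> \<le> \<kappa>"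
      proof (cases "s \<in> {0..T - t}")
        case True
        then have ts: "t + s \<in> {0..T}" using t by auto
        have a: "\<alpha> s \<eta> \<in> action_set A" using s by (intro controls_value[OF \<alpha> _ \<eta>]) auto
        have "\<bar>(f (t + s) (concat_path T t \<omega> \<eta>) (\<alpha> s \<eta>) - f' (t + s) (concat_path T t \<omega> \<eta>) (\<alpha> s \<eta>)) $ i\<bar> \<le> \<kappa>"
          using order_trans[OF component_le_norm_cart] close[OF ts c a] by blast
        then show ?thesis using True close[OF ts c a] by (simp add: shifted_drift_def shifted_cost_def)
      next
        case False
        then show ?thesis using \<kappa> by (simp add: shifted_drift_def shifted_cost_def)
      qed
    next
      fix \<eta> assume "\<eta> \<in> space Q"
      then have "norm (\<xi> (concat_path T t \<omega> \<eta>) - \<xi>' (concat_path T t \<omega> \<eta>)) \<le> \<kappa>"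
        using concat_path_in_path_space[OF \<omega> _ t] by (intro close\<xi>) simp
      from order_trans[OF component_le_norm_cart this, of i]
      show "\<bar>\<xi> (concat_path T t \<omega> \<eta>) $ i - \<xi>' (concat_path T t \<omega> \<eta>) $ i\<bar> \<le> \<kappa>" by simp
    qed (use sets.top[of Q] in auto)
  qed
qed

end

section \<open>Set values and their limits\<close>

lemma INF_dist_eq_0:
  assumes "y \<in> D" shows "(INF z\<in>D. ereal (dist y z)) = 0"
proof (rule antisym)
  show "(INF z\<in>D. ereal (dist y z)) \<le> 0" using INF_lower[OF assms, of "\<lambda>z. ereal (dist y z)"] by (simp add: zero_ereal_def)
  show "0 \<le> (INF z\<in>D. ereal (dist y z))" by (intro INF_greatest) simp
qed

text \<open>Any loss in \<epsilon> disappears in the intersection over all \<epsilon>.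
  \<open>V\<close> into \<open>D\<close> puts the intersection of the \<open>V \<epsilon>\<close>
  inside the lower limits, \<open>D\<close> into \<open>V\<close> puts the upper limits inside each
  \<open>V \<epsilon>\<close>, and lower limits always lie in upper limits.\<close>

lemma set_limits_eq:
  fixes V :: "real \<Rightarrow> 'y::metric_space set" and D :: "real \<Rightarrow> nat \<Rightarrow> 'y set"
  assumes near: "\<And>e e' y z. 0 < e \<Longrightarrow> z \<in> V e \<Longrightarrow> dist y z \<le> e' - e \<Longrightarrow> y \<in> V e'"
    and VD: "\<And>e e'. 0 < e \<Longrightarrow> e < e' \<Longrightarrow> \<forall>\<^sub>F n in sequentially. V e \<subseteq> D e' n"
    and DV: "\<And>e e'. 0 < e \<Longrightarrow> e < e' \<Longrightarrow> \<forall>\<^sub>F n in sequentially. D e n \<subseteq> V e'"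
  shows "(\<Inter>\<epsilon>\<in>{0<..}. V \<epsilon>) = (\<Inter>\<epsilon>\<in>{0<..}. set_liminf (D \<epsilon>))"
    and "(\<Inter>\<epsilon>\<in>{0<..}. V \<epsilon>) = (\<Inter>\<epsilon>\<in>{0<..}. set_limsup (D \<epsilon>))"
proof -
  have 1: "(\<Inter>\<epsilon>\<in>{0<..}. V \<epsilon>) \<subseteq> (\<Inter>\<epsilon>\<in>{0<..}. set_liminf (D \<epsilon>))"
  proof (intro subsetI INT_I)
    fix y and e :: real assume y: "y \<in> (\<Inter>\<epsilon>\<in>{0<..}. V \<epsilon>)" and e: "e \<in> {0<..}"
    then have "y \<in> V (e / 2)" by simp
    have "\<forall>\<^sub>F n in sequentially. V (e / 2) \<subseteq> D e n" using e by (intro VD) auto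
    then have "\<forall>\<^sub>F n in sequentially. (INF z\<in>D e n. ereal (dist y z)) = 0"
      by eventually_elim (use \<open>y \<in> V (e / 2)\<close> in \<open>auto intro!: INF_dist_eq_0\<close>)
    then show "y \<in> set_liminf (D e)" unfolding set_liminf_def by (auto intro: tendsto_eventually)
  qed
  have 2: "(\<Inter>\<epsilon>\<in>{0<..}. set_liminf (D \<epsilon>)) \<subseteq> (\<Inter>\<epsilon>\<in>{0<..}. set_limsup (D \<epsilon>))"
    unfolding set_liminf_def set_limsup_def by (auto intro: lim_imp_Liminf[OF trivial_limit_sequentially])
  have 3: "(\<Inter>\<epsilon>\<in>{0<..}. set_limsup (D \<epsilon>)) \<subseteq> (\<Inter>\<epsilon>\<in>{0<..}. V \<epsilon>)"
  proof (intro subsetI INT_I)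
    fix y and e :: real assume y: "y \<in> (\<Inter>\<epsilon>\<in>{0<..}. set_limsup (D \<epsilon>))" and "e \<in> {0<..}"
    \<comment> \<open>The budget: a quarter of \<open>e\<close> as index of \<open>D\<close>,
      enlarged to \<open>e / 2\<close> by the inclusion into \<open>V\<close>, which leaves room for
      the distance \<open>e / 4\<close> from \<open>y\<close> to a point of
      \<open>D\<close>.\<close>
    then have e: "0 < e" and "y \<in> set_limsup (D (e / 4))" by auto
    then have "liminf (\<lambda>n. INF z\<in>D (e / 4) n. ereal (dist y z)) < ereal (e / 4)" by (simp add: set_limsup_def)
    \<comment> \<open>A lower limit below the threshold means infinitely many indices below it. At
      such an index the set is nonempty, since the infimum over the empty set is infinite.\<close>
    then have "\<exists>\<^sub>F n in sequentially. (INF z\<in>D (e / 4) n. ereal (dist y z)) < ereal (e / 4)"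
      by (rule contrapos_pp) (auto simp: not_frequently not_less intro: Liminf_bounded)
    moreover have "\<forall>\<^sub>F n in sequentially. D (e / 4) n \<subseteq> V (e / 2)" using e by (intro DV) auto
    then have "\<forall>\<^sub>F n in sequentially. (INF z\<in>D (e / 4) n. ereal (dist y z)) < ereal (e / 4) \<longrightarrow>
        (INF z\<in>D (e / 4) n. ereal (dist y z)) < ereal (e / 4) \<and> D (e / 4) n \<subseteq> V (e / 2)"
      by eventually_elim blast
    ultimately have "\<exists>\<^sub>F n in sequentially. (INF z\<in>D (e / 4) n. ereal (dist y z)) < ereal (e / 4) \<and> D (e / 4) n \<subseteq> V (e / 2)"
      by (rule frequently_rev_mp)
    from frequently_ex[OF this]
    obtain n where n: "(INF z\<in>D (e / 4) n. ereal (dist y z)) < ereal (e / 4)" "D (e / 4) n \<subseteq> V (e / 2)"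
      by blast
    then obtain z where z: "z \<in> D (e / 4) n" "dist y z < e / 4" unfolding INF_less_iff by auto
    then have "z \<in> V (e / 2)" using n(2) by blast
    moreover have "0 < e / 2" "dist y z \<le> e - e / 2" using z(2) e by simp_all
    ultimately show "y \<in> V e" using near by blast
  qed
  show "(\<Inter>\<epsilon>\<in>{0<..}. V \<epsilon>) = (\<Inter>\<epsilon>\<in>{0<..}. set_liminf (D \<epsilon>))" using 1 2 3 by (intro subset_antisym) (rule 1, rule order_trans[OF 2 3])
  show "(\<Inter>\<epsilon>\<in>{0<..}. V \<epsilon>) = (\<Inter>\<epsilon>\<in>{0<..}. set_limsup (D \<epsilon>))" using 1 2 3 by (intro subset_antisym) (rule order_trans[OF 1 2], rule 3)
qed

lemma norm_le_of_near:
  fixes x y :: "'v::real_normed_vector"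
  shows "norm (x - y) \<le> c \<Longrightarrow> norm y \<le> C \<Longrightarrow> norm x \<le> C + c"
  using norm_triangle_sub[of x y] by linarith

lemma bounded_image_tripleD:
  assumes "bounded ((\<lambda>(s, w, a). g s w a) ` (S \<times> W \<times> A))"
  obtains C where "\<And>s w a. s \<in> S \<Longrightarrow> w \<in> W \<Longrightarrow> a \<in> A \<Longrightarrow> norm (g s w a) \<le> C"
proof -
  obtain C where C: "\<And>x. x \<in> (\<lambda>(s, w, a). g s w a) ` (S \<times> W \<times> A) \<Longrightarrow> norm x \<le> C"
    using assms unfolding bounded_iff by blast
  have "norm (g s w a) \<le> C" if "s \<in> S" "w \<in> W" "a \<in> A" for s w a
    using C[OF imageI, of "(s, w, a)"] that by simp
  then show ?thesis by (rule that)
qed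

lemma uniform_limit_tripleD:
  fixes g :: "'s \<Rightarrow> 'w \<Rightarrow> 'x \<Rightarrow> 'v::real_normed_vector"
  assumes "uniform_limit (S \<times> W \<times> A) (\<lambda>n (s, w, a). gn n s w a) (\<lambda>(s, w, a). g s w a) F" "0 < \<kappa>"
  shows "\<forall>\<^sub>F n in F. \<forall>s\<in>S. \<forall>w\<in>W. \<forall>a\<in>A. norm (gn n s w a - g s w a) \<le> \<kappa>"
  using uniform_limitD[OF assms]
proof eventually_elim
  fix n assume n: "\<forall>x\<in>S \<times> W \<times> A. dist (case x of (s, w, a) \<Rightarrow> gn n s w a) (case x of (s, w, a) \<Rightarrow> g s w a) < \<kappa>"
  show "\<forall>s\<in>S. \<forall>w\<in>W. \<forall>a\<in>A. norm (gn n s w a - g s w a) \<le> \<kappa>"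
  proof (intro ballI)
    fix s w a assume "s \<in> S" "w \<in> W" "a \<in> A"
    then show "norm (gn n s w a - g s w a) \<le> \<kappa>" using bspec[OF n, of "(s, w, a)"] by (simp add: dist_norm)
  qed
qed

lemma eps_equilibria_mono:
  assumes "\<epsilon> \<le> \<epsilon>'" shows "eps_equilibria T P A b f \<xi> \<epsilon> t \<omega> \<subseteq> eps_equilibria T P A b f \<xi> \<epsilon>' t \<omega>"
proof
  fix \<alpha> assume \<alpha>: "\<alpha> \<in> eps_equilibria T P A b f \<xi> \<epsilon> t \<omega>"
  have "game_cost T P b f \<xi> t \<omega> \<alpha> $ i \<le> game_cost T P b f \<xi> t \<omega> (replace_control \<alpha> i \<beta>) $ i + \<epsilon>'"
    if "\<beta> \<in> player_controls T P A i" for i \<beta>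
  proof -
    have "game_cost T P b f \<xi> t \<omega> \<alpha> $ i \<le> game_cost T P b f \<xi> t \<omega> (replace_control \<alpha> i \<beta>) $ i + \<epsilon>"
      using \<alpha> that unfolding eps_equilibria_def by blast
    then show ?thesis using assms by linarith
  qed
  then show "\<alpha> \<in> eps_equilibria T P A b f \<xi> \<epsilon>' t \<omega>" using \<alpha> unfolding eps_equilibria_def by blast
qed

text \<open>The same \<epsilon> is the slack of the equilibrium and the radius of the ball, so
  enlarging it relaxes both conditions and absorbs the distance.\<close>

lemma set_value_eps_near:
  assumes "z \<in> set_value_eps T P A b f \<xi> \<epsilon> t \<omega>" "dist y z \<le> \<epsilon>' - \<epsilon>"
  shows "y \<in> set_value_eps T P A b f \<xi> \<epsilon>' t \<omega>"
proof -
  obtain \<alpha> where \<alpha>: "\<alpha> \<in> eps_equilibria T P A b f \<xi> \<epsilon> t \<omega>" "dist (game_cost T P b f \<xi> t \<omega> \<alpha>) z < \<epsilon>"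
    using assms(1) by (auto simp: set_value_eps_def)
  have "0 \<le> dist y z" by simp
  then have "\<epsilon> \<le> \<epsilon>'" using assms(2) by linarith
  then have "\<alpha> \<in> eps_equilibria T P A b f \<xi> \<epsilon>' t \<omega>" using \<alpha>(1) eps_equilibria_mono by blast
  moreover have "dist (game_cost T P b f \<xi> t \<omega> \<alpha>) y < \<epsilon>'"
    using dist_triangle[of "game_cost T P b f \<xi> t \<omega> \<alpha>" y z] \<alpha>(2) assms(2) by (simp add: dist_commute)
  ultimately show ?thesis unfolding set_value_eps_def by auto
qed

section \<open>From uniform closeness of costs to set values\<close>

context wiener begin

text \<open>The same control serves both games. The equilibrium inequality loses
  \<open>2 * e\<close>, once for the control and once for the deviation, which is again a control.
  The ball loses \<open>CARD('n) * e\<close>, as the Euclidean norm is bounded by the sum of the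
  components.\<close>

lemma set_value_eps_subset:
  fixes A :: "'n::finite \<Rightarrow> 'a::euclidean_space set"
  assumes close: "\<And>\<alpha> i. \<alpha> \<in> controls T P A \<Longrightarrow> \<bar>game_cost T P b f \<xi> t \<omega> \<alpha> $ i - game_cost T P b' f' \<xi>' t' \<omega>' \<alpha> $ i\<bar> \<le> e"
    and e: "\<epsilon> + (2 + real CARD('n)) * e \<le> \<epsilon>'" "0 \<le> e"
  shows "set_value_eps T P A b f \<xi> \<epsilon> t \<omega> \<subseteq> set_value_eps T P A b' f' \<xi>' \<epsilon>' t' \<omega>'"
proof
  fix y assume "y \<in> set_value_eps T P A b f \<xi> \<epsilon> t \<omega>"
  then obtain \<alpha> where \<alpha>: "\<alpha> \<in> eps_equilibria T P A b f \<xi> \<epsilon> t \<omega>" and y: "dist (game_cost T P b f \<xi> t \<omega> \<alpha>) y < \<epsilon>"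
    by (auto simp: set_value_eps_def)
  let ?J = "game_cost T P b f \<xi> t \<omega>" and ?J' = "game_cost T P b' f' \<xi>' t' \<omega>'"
  have \<alpha>c: "\<alpha> \<in> controls T P A" using \<alpha> by (simp add: eps_equilibria_def)
  have split: "(2 + real CARD('n)) * e = 2 * e + real CARD('n) * e" by (simp add: algebra_simps)
  have pos: "0 \<le> real CARD('n) * e" using e(2) by simp
  have "?J' \<alpha> $ i \<le> ?J' (replace_control \<alpha> i \<beta>) $ i + \<epsilon>'" if \<beta>: "\<beta> \<in> player_controls T P A i" for i \<beta>
  proof -
    have "?J \<alpha> $ i \<le> ?J (replace_control \<alpha> i \<beta>) $ i + \<epsilon>" using \<alpha> \<beta> unfolding eps_equilibria_def by blast
    moreover have "\<bar>?J \<alpha> $ i - ?J' \<alpha> $ i\<bar> \<le> e" by (rule close[OF \<alpha>c])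
    moreover have "\<bar>?J (replace_control \<alpha> i \<beta>) $ i - ?J' (replace_control \<alpha> i \<beta>) $ i\<bar> \<le> e"
      by (rule close[OF replace_control_in_controls[OF \<alpha>c \<beta>]])
    ultimately show ?thesis using e(1) split pos by linarith
  qed
  then have "\<alpha> \<in> eps_equilibria T P A b' f' \<xi>' \<epsilon>' t' \<omega>'" using \<alpha>c unfolding eps_equilibria_def by blast
  moreover have "dist (?J' \<alpha>) y < \<epsilon>'"
  proof -
    have "dist (?J' \<alpha>) (?J \<alpha>) \<le> (\<Sum>i\<in>UNIV. \<bar>(?J' \<alpha> - ?J \<alpha>) $ i\<bar>)" unfolding dist_norm by (rule norm_le_l1_cart)
    also have "\<dots> \<le> (\<Sum>i\<in>(UNIV :: 'n set). e)" using close[OF \<alpha>c] by (intro sum_mono) (simp add: abs_minus_commute)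
    also have "\<dots> = real CARD('n) * e" by simp
    finally have "dist (?J' \<alpha>) (?J \<alpha>) \<le> real CARD('n) * e" .
    then show ?thesis using y e split dist_triangle[of "?J' \<alpha>" y "?J \<alpha>"] by linarith
  qed
  ultimately show "y \<in> set_value_eps T P A b' f' \<xi>' \<epsilon>' t' \<omega>'" unfolding set_value_eps_def by auto
qed

lemma game_data_regular:
  assumes gd: "game_data T P A b f \<xi>" and \<rho>: "modulus_of_continuity \<rho>" "state_modulus T A b f \<xi> \<rho>"
  obtains C where "regular_game C A b f \<xi> \<rho>"
proof -
  have bd: "bounded ((\<lambda>(s, \<omega>, a). b s \<omega> a) ` ({0..T} \<times> path_space T \<times> action_set A))"
    "bounded ((\<lambda>(s, \<omega>, a). f s \<omega> a) ` ({0..T} \<times> path_space T \<times> action_set A))" "bounded (\<xi> ` path_space T)"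
    using gd unfolding game_data_def by blast+
  obtain C1 where C1: "\<And>s \<omega> a. s \<in> {0..T} \<Longrightarrow> \<omega> \<in> path_space T \<Longrightarrow> a \<in> action_set A \<Longrightarrow> norm (b s \<omega> a) \<le> C1"
    using bounded_image_tripleD[OF bd(1)] by blast
  obtain C2 where C2: "\<And>s \<omega> a. s \<in> {0..T} \<Longrightarrow> \<omega> \<in> path_space T \<Longrightarrow> a \<in> action_set A \<Longrightarrow> norm (f s \<omega> a) \<le> C2"
    using bounded_image_tripleD[OF bd(2)] by blast
  obtain C3 where C3: "\<And>\<omega>. \<omega> \<in> path_space T \<Longrightarrow> norm (\<xi> \<omega>) \<le> C3"
    using bd(3) unfolding bounded_iff by blast
  have "regular_game (max C1 (max C2 C3)) A b f \<xi> \<rho>"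
    unfolding regular_game_def using gd \<rho> C1 C2 C3 by (auto simp: le_max_iff_disj)
  then show ?thesis by (rule that)
qed

lemma regular_game_mono:
  "regular_game C A b f \<xi> \<rho> \<Longrightarrow> C \<le> C' \<Longrightarrow> regular_game C' A b f \<xi> \<rho>"
  unfolding regular_game_def by (meson order_trans)

lemma set_value_eps_uniform_subset:
  fixes A :: "'n::finite \<Rightarrow> 'a::euclidean_space set"
  assumes g: "regular_game C A b f \<xi> \<rho>" and e: "\<epsilon>\<^sub>1 < \<epsilon>\<^sub>2"
  obtains \<delta> where "0 < \<delta>"
    "\<And>t t' \<omega> \<omega>'. t \<in> {0..T} \<Longrightarrow> t' \<in> {0..T} \<Longrightarrow> \<omega> \<in> path_space T \<Longrightarrow> \<omega>' \<in> path_space T \<Longrightarrow> path_dist T t \<omega> t' \<omega>' \<le> \<delta> \<Longrightarrow>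
      set_value_eps T P A b f \<xi> \<epsilon>\<^sub>1 t \<omega> \<subseteq> set_value_eps T P A b f \<xi> \<epsilon>\<^sub>2 t' \<omega>'"
proof -
  define \<eta> where "\<eta> = (\<epsilon>\<^sub>2 - \<epsilon>\<^sub>1) / (2 + real CARD('n))"
  have \<eta>: "0 < \<eta>" "\<epsilon>\<^sub>1 + (2 + real CARD('n)) * \<eta> = \<epsilon>\<^sub>2"
    using e by (auto simp: \<eta>_def add_nonneg_eq_0_iff)
  obtain \<delta> where \<delta>: "0 < \<delta>"
    "\<And>t t' \<omega> \<omega>' \<alpha> i. t \<in> {0..T} \<Longrightarrow> t' \<in> {0..T} \<Longrightarrow> \<omega> \<in> path_space T \<Longrightarrow> \<omega>' \<in> path_space T \<Longrightarrow>
      path_dist T t \<omega> t' \<omega>' \<le> \<delta> \<Longrightarrow> \<alpha> \<in> controls T P A \<Longrightarrow>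
      \<bar>game_cost T P b f \<xi> t \<omega> \<alpha> $ i - game_cost T P b f \<xi> t' \<omega>' \<alpha> $ i\<bar> \<le> \<eta>"
    using game_cost_continuous[OF g \<eta>(1)] by blast
  show ?thesis
  proof (rule that[OF \<delta>(1)])
    fix t t' and \<omega> \<omega>' :: "'d path"
    assume "t \<in> {0..T}" "t' \<in> {0..T}" "\<omega> \<in> path_space T" "\<omega>' \<in> path_space T" "path_dist T t \<omega> t' \<omega>' \<le> \<delta>"
    then show "set_value_eps T P A b f \<xi> \<epsilon>\<^sub>1 t \<omega> \<subseteq> set_value_eps T P A b f \<xi> \<epsilon>\<^sub>2 t' \<omega>'"
      using \<eta> by (intro set_value_eps_subset[of A b f \<xi> t \<omega> b f \<xi> t' \<omega>' \<eta>] \<delta>(2)) auto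
  qed
qed

lemma set_value_continuous:
  fixes A :: "'n::finite \<Rightarrow> 'a::euclidean_space set"
  assumes g: "regular_game C A b f \<xi> \<rho>" and t: "t \<in> {0..T}" "\<omega> \<in> path_space T"
    and tn: "\<And>n. tn n \<in> {0..T}" "\<And>n. \<omega>n n \<in> path_space T"
    and lim: "(\<lambda>n. path_dist T (tn n) (\<omega>n n) t \<omega>) \<longlonglongrightarrow> 0"
  shows "set_value T P A b f \<xi> t \<omega> = (\<Inter>\<epsilon>\<in>{0<..}. set_liminf (\<lambda>n. set_value_eps T P A b f \<xi> \<epsilon> (tn n) (\<omega>n n)))"
    and "set_value T P A b f \<xi> t \<omega> = (\<Inter>\<epsilon>\<in>{0<..}. set_limsup (\<lambda>n. set_value_eps T P A b f \<xi> \<epsilon> (tn n) (\<omega>n n)))"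
proof -
  have ev: "\<forall>\<^sub>F n in sequentially. path_dist T (tn n) (\<omega>n n) t \<omega> < \<delta>" if "0 < \<delta>" for \<delta>
    using order_tendstoD(2)[OF lim that] .
  have DV: "\<forall>\<^sub>F n in sequentially. set_value_eps T P A b f \<xi> e (tn n) (\<omega>n n) \<subseteq> set_value_eps T P A b f \<xi> e' t \<omega>"
    if "e < e'" for e e'
  proof -
    obtain \<delta> where \<delta>: "0 < \<delta>"
      "\<And>t t' \<omega> \<omega>'. t \<in> {0..T} \<Longrightarrow> t' \<in> {0..T} \<Longrightarrow> \<omega> \<in> path_space T \<Longrightarrow> \<omega>' \<in> path_space T \<Longrightarrow> path_dist T t \<omega> t' \<omega>' \<le> \<delta> \<Longrightarrow>
        set_value_eps T P A b f \<xi> e t \<omega> \<subseteq> set_value_eps T P A b f \<xi> e' t' \<omega>'"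
      using set_value_eps_uniform_subset[OF g \<open>e < e'\<close>] by blast
    from ev[OF \<delta>(1)] show ?thesis
    proof eventually_elim
      fix n assume "path_dist T (tn n) (\<omega>n n) t \<omega> < \<delta>"
      then show "set_value_eps T P A b f \<xi> e (tn n) (\<omega>n n) \<subseteq> set_value_eps T P A b f \<xi> e' t \<omega>"
        by (intro \<delta>(2) tn t less_imp_le)
    qed
  qed
  have VD: "\<forall>\<^sub>F n in sequentially. set_value_eps T P A b f \<xi> e t \<omega> \<subseteq> set_value_eps T P A b f \<xi> e' (tn n) (\<omega>n n)"
    if "e < e'" for e e'
  proof -
    obtain \<delta> where \<delta>: "0 < \<delta>"
      "\<And>t t' \<omega> \<omega>'. t \<in> {0..T} \<Longrightarrow> t' \<in> {0..T} \<Longrightarrow> \<omega> \<in> path_space T \<Longrightarrow> \<omega>' \<in> path_space T \<Longrightarrow> path_dist T t \<omega> t' \<omega>' \<le> \<delta> \<Longrightarrow>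
        set_value_eps T P A b f \<xi> e t \<omega> \<subseteq> set_value_eps T P A b f \<xi> e' t' \<omega>'"
      using set_value_eps_uniform_subset[OF g \<open>e < e'\<close>] by blast
    from ev[OF \<delta>(1)] show ?thesis
    proof eventually_elim
      fix n assume "path_dist T (tn n) (\<omega>n n) t \<omega> < \<delta>"
      then have "path_dist T t \<omega> (tn n) (\<omega>n n) < \<delta>" by (simp only: path_dist_commute[of T t])
      then show "set_value_eps T P A b f \<xi> e t \<omega> \<subseteq> set_value_eps T P A b f \<xi> e' (tn n) (\<omega>n n)"
        by (intro \<delta>(2) tn t less_imp_le)
    qed
  qed
  note L = set_limits_eq[of "\<lambda>\<epsilon>. set_value_eps T P A b f \<xi> \<epsilon> t \<omega>" "\<lambda>\<epsilon> n. set_value_eps T P A b f \<xi> \<epsilon> (tn n) (\<omega>n n)",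
      OF set_value_eps_near VD DV]
  show "set_value T P A b f \<xi> t \<omega> = (\<Inter>\<epsilon>\<in>{0<..}. set_liminf (\<lambda>n. set_value_eps T P A b f \<xi> \<epsilon> (tn n) (\<omega>n n)))"
    unfolding set_value_def by (rule L(1))
  show "set_value T P A b f \<xi> t \<omega> = (\<Inter>\<epsilon>\<in>{0<..}. set_limsup (\<lambda>n. set_value_eps T P A b f \<xi> \<epsilon> (tn n) (\<omega>n n)))"
    unfolding set_value_def by (rule L(2))
qed

text \<open>The approximating data are bounded for each \<open>n\<close> without a prescribed common
  bound. Uniform convergence brings them under \<open>C + 1\<close> eventually, and from then on one
  choice of \<kappa> serves the whole tail of the sequence.\<close>

lemma set_value_data_continuous:
  fixes A :: "'n::finite \<Rightarrow> 'a::euclidean_space set"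
  assumes g: "regular_game C A b f \<xi> \<rho>" and t: "t \<in> {0..T}" "\<omega> \<in> path_space T"
    and gn: "\<And>n. game_data T P A (bn n) (fn n) (\<xi>n n)"
    and \<rho>': "modulus_of_continuity \<rho>'" "\<And>n. state_modulus T A (bn n) (fn n) (\<xi>n n) \<rho>'"
    and lim: "uniform_limit ({0..T} \<times> path_space T \<times> action_set A) (\<lambda>n (s, \<omega>, a). bn n s \<omega> a) (\<lambda>(s, \<omega>, a). b s \<omega> a) sequentially"
      "uniform_limit ({0..T} \<times> path_space T \<times> action_set A) (\<lambda>n (s, \<omega>, a). fn n s \<omega> a) (\<lambda>(s, \<omega>, a). f s \<omega> a) sequentially"
      "uniform_limit (path_space T) \<xi>n \<xi> sequentially"
  shows "set_value T P A b f \<xi> t \<omega> = (\<Inter>\<epsilon>\<in>{0<..}. set_liminf (\<lambda>n. set_value_eps T P A (bn n) (fn n) (\<xi>n n) \<epsilon> t \<omega>))"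
    and "set_value T P A b f \<xi> t \<omega> = (\<Inter>\<epsilon>\<in>{0<..}. set_limsup (\<lambda>n. set_value_eps T P A (bn n) (fn n) (\<xi>n n) \<epsilon> t \<omega>))"
proof -
  have C: "0 \<le> C" by (rule regular_game_nonneg[OF g])
  have g1: "regular_game (C + 1) A b f \<xi> \<rho>" by (rule regular_game_mono[OF g]) simp
  have near: "\<forall>\<^sub>F n in sequentially.
      (\<forall>s\<in>{0..T}. \<forall>\<omega>\<in>path_space T. \<forall>a\<in>action_set A. norm (bn n s \<omega> a - b s \<omega> a) \<le> \<kappa> \<and> norm (fn n s \<omega> a - f s \<omega> a) \<le> \<kappa>) \<and>
      (\<forall>\<omega>\<in>path_space T. norm (\<xi>n n \<omega> - \<xi> \<omega>) \<le> \<kappa>)" if "0 < \<kappa>" for \<kappa>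
  proof -
    have "\<forall>\<^sub>F n in sequentially. \<forall>\<omega>\<in>path_space T. norm (\<xi>n n \<omega> - \<xi> \<omega>) \<le> \<kappa>"
      using uniform_limitD[OF lim(3) that] by eventually_elim (auto simp: dist_norm intro: less_imp_le)
    with uniform_limit_tripleD[OF lim(1) that] uniform_limit_tripleD[OF lim(2) that]
    show ?thesis by eventually_elim blast
  qed
  have reg: "\<forall>\<^sub>F n in sequentially. regular_game (C + 1) A (bn n) (fn n) (\<xi>n n) \<rho>'"
    using near[OF zero_less_one]
  proof eventually_elim
    fix n
    assume n: "(\<forall>s\<in>{0..T}. \<forall>\<omega>\<in>path_space T. \<forall>a\<in>action_set A. norm (bn n s \<omega> a - b s \<omega> a) \<le> 1 \<and> norm (fn n s \<omega> a - f s \<omega> a) \<le> 1) \<and>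
      (\<forall>\<omega>\<in>path_space T. norm (\<xi>n n \<omega> - \<xi> \<omega>) \<le> 1)"
    show "regular_game (C + 1) A (bn n) (fn n) (\<xi>n n) \<rho>'"
      unfolding regular_game_def
    proof (intro conjI ballI gn \<rho>')
      fix s a and \<omega> :: "'d path" assume sa: "s \<in> {0..T}" "\<omega> \<in> path_space T" "a \<in> action_set A"
      show "norm (bn n s \<omega> a) \<le> C + 1"
        by (rule norm_le_of_near[of _ "b s \<omega> a"]) (use n sa regular_gameD(6)[OF g sa] in blast)+
      show "norm (fn n s \<omega> a) \<le> C + 1"
        by (rule norm_le_of_near[of _ "f s \<omega> a"]) (use n sa regular_gameD(7)[OF g sa] in blast)+
    next
      fix \<omega> :: "'d path" assume \<omega>: "\<omega> \<in> path_space T"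
      show "norm (\<xi>n n \<omega>) \<le> C + 1"
        by (rule norm_le_of_near[of _ "\<xi> \<omega>"]) (use n \<omega> regular_gameD(8)[OF g \<omega>] in blast)+
    qed
  qed
  have close: "\<forall>\<^sub>F n in sequentially. \<forall>\<alpha>\<in>controls T P A. \<forall>i.
      \<bar>game_cost T P (bn n) (fn n) (\<xi>n n) t \<omega> \<alpha> $ i - game_cost T P b f \<xi> t \<omega> \<alpha> $ i\<bar> \<le> \<eta>" if \<eta>: "0 < \<eta>" for \<eta>
  proof -
    have C1: "0 \<le> C + 1" using C by simp
    obtain \<kappa> where \<kappa>: "0 < \<kappa>" and stab:
      "\<And>(b :: real \<Rightarrow> 'd path \<Rightarrow> 'a ^ 'n \<Rightarrow> real ^ 'd) f \<xi> \<rho> b' f' \<xi>' \<rho>' t \<omega> \<alpha> i. regular_game (C + 1) A b f \<xi> \<rho> \<Longrightarrow> regular_game (C + 1) A b' f' \<xi>' \<rho>' \<Longrightarrow>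
      (\<And>s \<omega> a. s \<in> {0..T} \<Longrightarrow> \<omega> \<in> path_space T \<Longrightarrow> a \<in> action_set A \<Longrightarrow>
        norm (b s \<omega> a - b' s \<omega> a) \<le> \<kappa> \<and> norm (f s \<omega> a - f' s \<omega> a) \<le> \<kappa>) \<Longrightarrow>
      (\<And>\<omega>. \<omega> \<in> path_space T \<Longrightarrow> norm (\<xi> \<omega> - \<xi>' \<omega>) \<le> \<kappa>) \<Longrightarrow>
      t \<in> {0..T} \<Longrightarrow> \<omega> \<in> path_space T \<Longrightarrow> \<alpha> \<in> controls T P A \<Longrightarrow>
      \<bar>game_cost T P b f \<xi> t \<omega> \<alpha> $ i - game_cost T P b' f' \<xi>' t \<omega> \<alpha> $ i\<bar> \<le> \<eta>"
      using game_cost_data_stability[where A=A, OF C1 \<eta>] by blast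
    from near[OF \<kappa>] reg show ?thesis
    proof eventually_elim
      fix n
      assume n: "(\<forall>s\<in>{0..T}. \<forall>\<omega>\<in>path_space T. \<forall>a\<in>action_set A. norm (bn n s \<omega> a - b s \<omega> a) \<le> \<kappa> \<and> norm (fn n s \<omega> a - f s \<omega> a) \<le> \<kappa>) \<and>
      (\<forall>\<omega>\<in>path_space T. norm (\<xi>n n \<omega> - \<xi> \<omega>) \<le> \<kappa>)" and r: "regular_game (C + 1) A (bn n) (fn n) (\<xi>n n) \<rho>'"
      show "\<forall>\<alpha>\<in>controls T P A. \<forall>i. \<bar>game_cost T P (bn n) (fn n) (\<xi>n n) t \<omega> \<alpha> $ i - game_cost T P b f \<xi> t \<omega> \<alpha> $ i\<bar> \<le> \<eta>"
      proof (intro ballI allI)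
        fix \<alpha> i assume \<alpha>: "\<alpha> \<in> controls T P A"
        show "\<bar>game_cost T P (bn n) (fn n) (\<xi>n n) t \<omega> \<alpha> $ i - game_cost T P b f \<xi> t \<omega> \<alpha> $ i\<bar> \<le> \<eta>"
          by (rule stab[OF r g1 _ _ t \<alpha>]) (use n in blast)+
      qed
    qed
  qed
  define N where "N = 2 + real CARD('n)"
  have N: "0 < N" unfolding N_def by (intro add_pos_nonneg) auto
  have DV: "\<forall>\<^sub>F n in sequentially. set_value_eps T P A (bn n) (fn n) (\<xi>n n) e t \<omega> \<subseteq> set_value_eps T P A b f \<xi> e' t \<omega>"
    and VD: "\<forall>\<^sub>F n in sequentially. set_value_eps T P A b f \<xi> e t \<omega> \<subseteq> set_value_eps T P A (bn n) (fn n) (\<xi>n n) e' t \<omega>"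
    if "e < e'" for e e'
  proof -
    define \<eta> where "\<eta> = (e' - e) / N"
    have \<eta>: "0 < \<eta>" "e + N * \<eta> \<le> e'" using that N by (auto simp: \<eta>_def)
    from close[OF \<eta>(1)]
    show "\<forall>\<^sub>F n in sequentially. set_value_eps T P A (bn n) (fn n) (\<xi>n n) e t \<omega> \<subseteq> set_value_eps T P A b f \<xi> e' t \<omega>"
      by eventually_elim (rule set_value_eps_subset[OF _ \<eta>(2)[unfolded N_def] less_imp_le[OF \<eta>(1)]], blast)
    from close[OF \<eta>(1)]
    show "\<forall>\<^sub>F n in sequentially. set_value_eps T P A b f \<xi> e t \<omega> \<subseteq> set_value_eps T P A (bn n) (fn n) (\<xi>n n) e' t \<omega>"
    proof eventually_elim
      fix n assume n: "\<forall>\<alpha>\<in>controls T P A. \<forall>i. \<bar>game_cost T P (bn n) (fn n) (\<xi>n n) t \<omega> \<alpha> $ i - game_cost T P b f \<xi> t \<omega> \<alpha> $ i\<bar> \<le> \<eta>"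
      show "set_value_eps T P A b f \<xi> e t \<omega> \<subseteq> set_value_eps T P A (bn n) (fn n) (\<xi>n n) e' t \<omega>"
      proof (rule set_value_eps_subset[OF _ \<eta>(2)[unfolded N_def] less_imp_le[OF \<eta>(1)]])
        fix \<alpha> i assume "\<alpha> \<in> controls T P A"
        then show "\<bar>game_cost T P b f \<xi> t \<omega> \<alpha> $ i - game_cost T P (bn n) (fn n) (\<xi>n n) t \<omega> \<alpha> $ i\<bar> \<le> \<eta>"
          using n by (subst abs_minus_commute) blast
      qed
    qed
  qed
  note L = set_limits_eq[of "\<lambda>\<epsilon>. set_value_eps T P A b f \<xi> \<epsilon> t \<omega>" "\<lambda>\<epsilon> n. set_value_eps T P A (bn n) (fn n) (\<xi>n n) \<epsilon> t \<omega>",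
      OF set_value_eps_near VD DV]
  show "set_value T P A b f \<xi> t \<omega> = (\<Inter>\<epsilon>\<in>{0<..}. set_liminf (\<lambda>n. set_value_eps T P A (bn n) (fn n) (\<xi>n n) \<epsilon> t \<omega>))"
    unfolding set_value_def by (rule L(1))
  show "set_value T P A b f \<xi> t \<omega> = (\<Inter>\<epsilon>\<in>{0<..}. set_limsup (\<lambda>n. set_value_eps T P A (bn n) (fn n) (\<xi>n n) \<epsilon> t \<omega>))"
    unfolding set_value_def by (rule L(2))
qed

end

theorem theorem3p7:
  fixes T :: real
    and P0 :: "'d::finite path measure"
    and A :: "'n::finite \<Rightarrow> 'a::euclidean_space set"
    and b :: "real \<Rightarrow> 'd path \<Rightarrow> 'a ^ 'n \<Rightarrow> real ^ 'd"
    and f :: "real \<Rightarrow> 'd path \<Rightarrow> 'a ^ 'n \<Rightarrow> real ^ 'n"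
    and \<xi> :: "'d path \<Rightarrow> real ^ 'n"
    and \<rho>\<^sub>0 :: "real \<Rightarrow> real"
  assumes T_pos: "0 < T"
    and wiener: "wiener_measure T P0"
    and A_domain: "convex (action_set A)" "action_set A \<noteq> {}"
    and data: "game_data T P0 A b f \<xi>"
    and modulus: "modulus_of_continuity \<rho>\<^sub>0" "state_modulus T A b f \<xi> \<rho>\<^sub>0"
  shows
    "(\<forall>\<epsilon>\<^sub>1 \<epsilon>\<^sub>2. 0 < \<epsilon>\<^sub>1 \<longrightarrow> \<epsilon>\<^sub>1 < \<epsilon>\<^sub>2 \<longrightarrow>
       (\<exists>\<delta>>0. \<forall>t\<in>{0..T}. \<forall>\<omega>\<in>path_space T. \<forall>t'\<in>{0..T}. \<forall>\<omega>'\<in>path_space T.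
          path_dist T t \<omega> t' \<omega>' \<le> \<delta> \<longrightarrow>
          set_value_eps T P0 A b f \<xi> \<epsilon>\<^sub>1 t' \<omega>' \<subseteq> set_value_eps T P0 A b f \<xi> \<epsilon>\<^sub>2 t \<omega>)) \<and>
     (\<forall>t\<in>{0..T}. \<forall>\<omega>\<in>path_space T. \<forall>tn \<omega>n.
        (\<forall>n. tn n \<in> {0..T} \<and> \<omega>n n \<in> path_space T) \<longrightarrow>
        (\<lambda>n. path_dist T (tn n) (\<omega>n n) t \<omega>) \<longlonglongrightarrow> 0 \<longrightarrow>
        set_value T P0 A b f \<xi> t \<omega>
          = (\<Inter>\<epsilon>\<in>{0<..}. set_liminf (\<lambda>n. set_value_eps T P0 A b f \<xi> \<epsilon> (tn n) (\<omega>n n))) \<and>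
        set_value T P0 A b f \<xi> t \<omega>
          = (\<Inter>\<epsilon>\<in>{0<..}. set_limsup (\<lambda>n. set_value_eps T P0 A b f \<xi> \<epsilon> (tn n) (\<omega>n n)))) \<and>
     (\<forall>bn fn \<xi>n.
        (\<forall>n. game_data T P0 A (bn n) (fn n) (\<xi>n n)) \<longrightarrow>
        (\<exists>\<rho>. modulus_of_continuity \<rho> \<and> (\<forall>n. state_modulus T A (bn n) (fn n) (\<xi>n n) \<rho>)) \<longrightarrow>
        (\<exists>\<rho>. modulus_of_continuity \<rho> \<and> (\<forall>n. action_modulus T A (bn n) (fn n) \<rho>)) \<longrightarrow>
        uniform_limit ({0..T} \<times> path_space T \<times> action_set A)
          (\<lambda>n (s, \<omega>, a). bn n s \<omega> a) (\<lambda>(s, \<omega>, a). b s \<omega> a) sequentially \<longrightarrow>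
        uniform_limit ({0..T} \<times> path_space T \<times> action_set A)
          (\<lambda>n (s, \<omega>, a). fn n s \<omega> a) (\<lambda>(s, \<omega>, a). f s \<omega> a) sequentially \<longrightarrow>
        uniform_limit (path_space T) \<xi>n \<xi> sequentially \<longrightarrow>
        (\<forall>t\<in>{0..T}. \<forall>\<omega>\<in>path_space T.
           set_value T P0 A b f \<xi> t \<omega>
             = (\<Inter>\<epsilon>\<in>{0<..}. set_liminf (\<lambda>n. set_value_eps T P0 A (bn n) (fn n) (\<xi>n n) \<epsilon> t \<omega>)) \<and>
           set_value T P0 A b f \<xi> t \<omega>
             = (\<Inter>\<epsilon>\<in>{0<..}. set_limsup (\<lambda>n. set_value_eps T P0 A (bn n) (fn n) (\<xi>n n) \<epsilon> t \<omega>))))"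
  proof -
  interpret wiener T P0 using T_pos wiener by unfold_locales
  obtain C where g: "regular_game C A b f \<xi> \<rho>\<^sub>0" using game_data_regular[OF data modulus] by blast
  show ?thesis
  proof (intro conjI allI impI ballI)
    fix \<epsilon>\<^sub>1 \<epsilon>\<^sub>2 :: real assume "0 < \<epsilon>\<^sub>1" and e: "\<epsilon>\<^sub>1 < \<epsilon>\<^sub>2"
    obtain \<delta> where \<delta>: "0 < \<delta>"
      "\<And>t t' \<omega> \<omega>'. t \<in> {0..T} \<Longrightarrow> t' \<in> {0..T} \<Longrightarrow> \<omega> \<in> path_space T \<Longrightarrow> \<omega>' \<in> path_space T \<Longrightarrow> path_dist T t \<omega> t' \<omega>' \<le> \<delta> \<Longrightarrow>
        set_value_eps T P0 A b f \<xi> \<epsilon>\<^sub>1 t \<omega> \<subseteq> set_value_eps T P0 A b f \<xi> \<epsilon>\<^sub>2 t' \<omega>'"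
      using set_value_eps_uniform_subset[OF g e] by blast
    show "\<exists>\<delta>>0. \<forall>t\<in>{0..T}. \<forall>\<omega>\<in>path_space T. \<forall>t'\<in>{0..T}. \<forall>\<omega>'\<in>path_space T.
          path_dist T t \<omega> t' \<omega>' \<le> \<delta> \<longrightarrow>
          set_value_eps T P0 A b f \<xi> \<epsilon>\<^sub>1 t' \<omega>' \<subseteq> set_value_eps T P0 A b f \<xi> \<epsilon>\<^sub>2 t \<omega>"
    proof (intro exI[of _ \<delta>] conjI ballI impI \<delta>(1))
      fix t t' and \<omega> \<omega>' :: "'d path"
      assume *: "t \<in> {0..T}" "\<omega> \<in> path_space T" "t' \<in> {0..T}" "\<omega>' \<in> path_space T" and d: "path_dist T t \<omega> t' \<omega>' \<le> \<delta>"
      have "path_dist T t' \<omega>' t \<omega> \<le> \<delta>" using d by (simp only: path_dist_commute[of T t'])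
      then show "set_value_eps T P0 A b f \<xi> \<epsilon>\<^sub>1 t' \<omega>' \<subseteq> set_value_eps T P0 A b f \<xi> \<epsilon>\<^sub>2 t \<omega>"
        by (intro \<delta>(2) *)
    qed
  next
    fix t and \<omega> :: "'d path" and tn \<omega>n
    assume t: "t \<in> {0..T}" "\<omega> \<in> path_space T" and tn: "\<forall>n. tn n \<in> {0..T} \<and> \<omega>n n \<in> path_space T"
      and lim: "(\<lambda>n. path_dist T (tn n) (\<omega>n n) t \<omega>) \<longlonglongrightarrow> 0"
    have tn': "tn n \<in> {0..T}" "\<omega>n n \<in> path_space T" for n using tn by blast+
    show "set_value T P0 A b f \<xi> t \<omega> = (\<Inter>\<epsilon>\<in>{0<..}. set_liminf (\<lambda>n. set_value_eps T P0 A b f \<xi> \<epsilon> (tn n) (\<omega>n n)))"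
      by (rule set_value_continuous(1)[OF g t tn' lim])
    show "set_value T P0 A b f \<xi> t \<omega> = (\<Inter>\<epsilon>\<in>{0<..}. set_limsup (\<lambda>n. set_value_eps T P0 A b f \<xi> \<epsilon> (tn n) (\<omega>n n)))"
      by (rule set_value_continuous(2)[OF g t tn' lim])
  next
    fix bn fn \<xi>n t and \<omega> :: "'d path"
    assume gn: "\<forall>n. game_data T P0 A (bn n) (fn n) (\<xi>n n)"
      and "\<exists>\<rho>. modulus_of_continuity \<rho> \<and> (\<forall>n. state_modulus T A (bn n) (fn n) (\<xi>n n) \<rho>)"
      and lim: "uniform_limit ({0..T} \<times> path_space T \<times> action_set A)
          (\<lambda>n (s, \<omega>, a). bn n s \<omega> a) (\<lambda>(s, \<omega>, a). b s \<omega> a) sequentially"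
        "uniform_limit ({0..T} \<times> path_space T \<times> action_set A)
          (\<lambda>n (s, \<omega>, a). fn n s \<omega> a) (\<lambda>(s, \<omega>, a). f s \<omega> a) sequentially"
        "uniform_limit (path_space T) \<xi>n \<xi> sequentially"
      and t: "t \<in> {0..T}" "\<omega> \<in> path_space T"
    then obtain \<rho>' where \<rho>': "modulus_of_continuity \<rho>'" "\<And>n. state_modulus T A (bn n) (fn n) (\<xi>n n) \<rho>'" by blast
    show "set_value T P0 A b f \<xi> t \<omega> = (\<Inter>\<epsilon>\<in>{0<..}. set_liminf (\<lambda>n. set_value_eps T P0 A (bn n) (fn n) (\<xi>n n) \<epsilon> t \<omega>))"
      by (rule set_value_data_continuous(1)[OF g t gn[rule_format] \<rho>' lim])
    show "set_value T P0 A b f \<xi> t \<omega> = (\<Inter>\<epsilon>\<in>{0<..}. set_limsup (\<lambda>n. set_value_eps T P0 A (bn n) (fn n) (\<xi>n n) \<epsilon> t \<omega>))"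
      by (rule set_value_data_continuous(2)[OF g t gn[rule_format] \<rho>' lim])
  qed
qed

end
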